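(* Let $r\ge 0$ be an integer and let $g\in C^{r+1}(\mathbb{R}^d\times[0,T],\mathbb{R}^d)$. Consider the initial value problem $$\dot x(t)=g(x(t),t),\qquad x(0)=x.$$ Denote by $F_{t,t_0}:\mathbb{R}^d\to\mathbb{R}^d$ the associated flow, and assume that it is defined for all $t,t_0\in[0,T]$. Let $\hat F_{t+\Delta t,t}:\mathbb{R}^d\to\mathbb{R}^d$ be a one-step method of class $C^r$ with respect to $x$ and with time step $\Delta t$, and define $$x_{k+1}=\hat F_{t_{k+1},t_k}(x_k),\qquad t_k=k\Delta t,\qquad x_0=x,$$ and $\Phi^k_{\Delta t}:=\hat F_{t_k,t_{k-1}}\circ\cdots\circ\hat F_{t_1,t_0}$. Assume that for each compact $K\subset\mathbb{R}^d$ the following stability and consistency conditions hold: (i) There exists a constant $M_K>0$ such that $$\sup_{(x,t)\in K\times[0,T-\Delta t]}\big\|D^l\hat F_{t+\Delta t,t}(x)-D^lF_{t+\Delta t,t}(x)\big\|\le M_K\,\Delta t^2,\qquad l=0,\dots,r,$$ where $D^l$ denotes the $l$-th derivative with respect to the $x$ variable; (ii) There exists a constant $L_K>0$ such that $$\sup_{(x,t)\in K\times[0,T-\Delta t]}\big\|D\hat F_{t+\Delta t,t}(x)\big\|\le 1+L_K\,\Delta t.$$ Then for every compact $K\subset\mathbb{R}^d$ there exists a constant $C_K>0$ such that $$\max_{0\le k\le\lfloor T/\Delta t\rfloor}\big\|\Phi^k_{\Delta t}-F_{t_k,0}\big\|_{C^r(K)}\le C_K\,\Delta t.$$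
   Context: Here $T>0$, and the flow $F_{t,t_0}$ maps $x$ to the value at time $t$ of the solution of $\dot x=g(x,t)$ that equals $x$ at time $t_0$. The map $\Phi^k_{\Delta t}$ is the $k$-step numerical flow, so $x_k=\Phi^k_{\Delta t}(x)$, with $\Phi^0_{\Delta t}$ the identity. $D=D^1$ is the derivative with respect to $x$. For a compact set $K$, $\|\cdot\|_{C^r(K)}$ denotes the usual $C^r$ norm on $K$: the maximum over $0\le l\le r$ of the supremum over $x\in K$ of the norm of the $l$-th derivative with respect to $x$. *)

theory Defs
  imports "HOL-Analysis.Analysis"
begin

(* Iterated Frechet derivative of f within S:
   higher_deriv S f [v1, ..., vl] x  is  (D^l f)(x)(v1, ..., vl).
   The recursion is D^(l+1) f = D (D^l f), read off at fixed vectors: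
   (D^(l+1) f)(x)(v, vs) is the derivative at x, in direction v, of y \<mapsto> (D^l f)(y)(vs).
   For S = UNIV the filter "at x within S" is "at x". *)
primrec higher_deriv ::
    "'a::real_normed_vector set \<Rightarrow> ('a \<Rightarrow> 'b::real_normed_vector) \<Rightarrow> 'a list \<Rightarrow> 'a \<Rightarrow> 'b" where
  "higher_deriv S f [] = f"
| "higher_deriv S f (v # vs) =
     (\<lambda>x. frechet_derivative (higher_deriv S f vs) (at x within S) v)"

(* f is of class C^n on S.  In finite dimension, D^l f is differentiable (continuous) as a map into
   the l-linear maps iff it is so after evaluation at arbitrary fixed vectors.  On sets such as
   UNIV \<times> {0..T}, derivatives within the set are unique; at boundary points they are one-sided. *)
definition class_C_on :: "nat \<Rightarrow> ('a::euclidean_space \<Rightarrow> 'b::euclidean_space) \<Rightarrow> 'a set \<Rightarrow> bool" where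
  "class_C_on n f S \<longleftrightarrow>
     (\<forall>vs. length vs < n \<longrightarrow> higher_deriv S f vs differentiable_on S) \<and>
     (\<forall>vs. length vs \<le> n \<longrightarrow> continuous_on S (higher_deriv S f vs))"

(* Operator norm of an l-linear map, given as a function of argument lists of length l.
   Norms and suprema take values in ennreal, so that every supremum is a genuine one. *)
definition multilinear_norm :: "nat \<Rightarrow> ('a::real_normed_vector list \<Rightarrow> 'b::real_normed_vector) \<Rightarrow> ennreal" where
  "multilinear_norm l A =
     (SUP vs\<in>{vs. length vs = l \<and> (\<forall>v\<in>set vs. norm v \<le> 1)}. ennreal (norm (A vs)))"

definition C_norm :: "nat \<Rightarrow> 'a::euclidean_space set \<Rightarrow> ('a \<Rightarrow> 'b::euclidean_space) \<Rightarrow> ennreal" where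
  "C_norm r K f =
     (MAX l\<in>{0..r}. SUP x\<in>K. multilinear_norm l (\<lambda>vs. higher_deriv UNIV f vs x))"

(* F t t0 x is the value at time t of the solution of x' = g(x,t) that equals x at time t0,
   for all t, t0 in [0,T]. *)
definition is_flow :: "('a::euclidean_space \<Rightarrow> real \<Rightarrow> 'a) \<Rightarrow> real \<Rightarrow> (real \<Rightarrow> real \<Rightarrow> 'a \<Rightarrow> 'a) \<Rightarrow> bool" where
  "is_flow g T F \<longleftrightarrow>
     (\<forall>t0\<in>{0..T}. \<forall>x. F t0 t0 x = x \<and>
        (\<forall>t\<in>{0..T}. ((\<lambda>s. F s t0 x) has_vector_derivative g (F t t0 x) t) (at t within {0..T})))"

primrec numerical_flow :: "(real \<Rightarrow> real \<Rightarrow> 'a \<Rightarrow> 'a) \<Rightarrow> real \<Rightarrow> nat \<Rightarrow> 'a \<Rightarrow> 'a" where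
  "numerical_flow Fh h 0 = id"
| "numerical_flow Fh h (Suc k) = Fh (real (Suc k) * h) (real k * h) \<circ> numerical_flow Fh h k"

definition consistent_on ::
    "nat \<Rightarrow> real \<Rightarrow> (real \<Rightarrow> real \<Rightarrow> 'a::euclidean_space \<Rightarrow> 'a) \<Rightarrow> (real \<Rightarrow> real \<Rightarrow> 'a \<Rightarrow> 'a) \<Rightarrow> 'a set \<Rightarrow> bool" where
  "consistent_on r T F Fh K \<longleftrightarrow>
     (\<exists>M>0. \<forall>h\<in>{0<..T}. \<forall>l\<in>{0..r}.
        (SUP (x, t)\<in>K \<times> {0..T - h}.
           multilinear_norm l (\<lambda>vs. higher_deriv UNIV (Fh (t + h) t) vs x
                                    - higher_deriv UNIV (F (t + h) t) vs x))
        \<le> ennreal (M * h\<^sup>2))"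

(* The bound on D Fh presupposes that Fh (t + h) t is differentiable; this is automatic for methods
   of class C^r with r \<ge> 1, but not for r = 0. *)
definition stable_on ::
    "real \<Rightarrow> (real \<Rightarrow> real \<Rightarrow> 'a::euclidean_space \<Rightarrow> 'a) \<Rightarrow> 'a set \<Rightarrow> bool" where
  "stable_on T Fh K \<longleftrightarrow>
     (\<exists>L>0. \<forall>h\<in>{0<..T}.
        (\<forall>x\<in>K. \<forall>t\<in>{0..T - h}. Fh (t + h) t differentiable (at x)) \<and>
        (SUP (x, t)\<in>K \<times> {0..T - h}.
           multilinear_norm 1 (\<lambda>vs. higher_deriv UNIV (Fh (t + h) t) vs x))
        \<le> ennreal (1 + L * h))"

end

theory Submission
  imports Defs
begin

text \<open>Write \<open>\<Phi>\<^sub>k\<close> for the numerical flow after \<open>k\<close> steps, \<open>F\<^sub>k\<close> for the exact flow from time \<open>0\<close> to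
\<open>t\<^sub>k = k h\<close>, \<open>f\<close> for the exact flow from \<open>t\<^sub>k\<close> to \<open>t\<^sub>k + h\<close>, \<open>\<rho>\<close> for the difference between the one-step
map and \<open>f\<close>, and \<open>\<psi> x = f x - x\<close>. The group property of the flow gives the exact error recursion
\<open>\<Phi>\<^sub>k\<^sub>+\<^sub>1 - F\<^sub>k\<^sub>+\<^sub>1 = (\<Phi>\<^sub>k - F\<^sub>k) + \<rho> \<circ> \<Phi>\<^sub>k + (\<psi> \<circ> \<Phi>\<^sub>k - \<psi> \<circ> F\<^sub>k)\<close>.
All three terms are estimated in \<open>C\<^sup>r\<close> at once. Consistency makes \<open>\<rho>\<close> of size \<open>h\<^sup>2\<close>, and composing with a
map bounded in \<open>C\<^sup>r\<close> preserves this (\<open>Cn_bound_compose\<close>). The map \<open>\<psi>\<close> is of size \<open>h\<close> in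
\<open>C\<^sup>r\<^sup>+\<^sup>1\<close>, so the last difference is at most a constant times \<open>h\<close> times the present error
(\<open>Cn_bound_compose_diff\<close>; the additional derivative of \<open>\<psi>\<close> is what makes
\<open>\<psi>\<close>, with its derivatives up to order \<open>r\<close>, Lipschitz). The errors therefore
satisfy \<open>E\<^sub>k\<^sub>+\<^sub>1 \<le> (1 + a h) E\<^sub>k + b h\<^sup>2\<close>, and so they are \<open>O(h)\<close> on bounded time intervals.

The constants \<open>a\<close> and \<open>b\<close> depend on \<open>C\<^sup>r\<close> bounds for \<open>\<Phi>\<^sub>k\<close>, which are obtained in the same
induction: as long as the error is at most \<open>1\<close>, the bound for \<open>\<Phi>\<^sub>k\<close> exceeds that for \<open>F\<^sub>k\<close> by at most
\<open>1\<close>, and for small \<open>h\<close> the resulting error bound \<open>C h\<close> is itself at most \<open>1\<close>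
(\<open>convergence_small_step\<close>). When \<open>C h > 1\<close> there are at most \<open>C T\<close> steps, and it is enough that
each \<open>\<Phi>\<^sub>k\<close> is bounded in \<open>C\<^sup>r\<close> uniformly in \<open>h\<close> (\<open>numerical_flow_Cn_bound\<close>).

The analytic input is that the flow of a vector field of class \<open>C\<^sup>r\<^sup>+\<^sup>1\<close> has spatial
derivatives up to order \<open>r + 1\<close>, and that these are continuously differentiable in time
(\<open>flow_family\<close>). It rests on Gronwall's inequality. The spatial difference quotients of a
solution solve a linear equation whose inhomogeneity converges uniformly; hence they converge, and their
limit solves the limiting equation (\<open>linear_ode_limit\<close>). Applied to a linear equation with smooth
parameters, this yields a derived equation with the same homogeneous part, so that induction on the
order of differentiability gives smooth dependence (\<open>linear_ode_family\<close>). Applied to the flow, it yields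
the variational equation, which is linear with coefficients \<open>D g\<close> along the flow. These coefficients are as smooth
as the flow itself as long as \<open>D g\<close> permits, so each order of smoothness of the flow produces the next.\<close>

section \<open>Bounds on all derivatives up to a given order\<close>

text \<open>The bounds are taken along arguments in the unit ball, as in the operator norm. Only the size of
the derivatives is restricted to \<open>U\<close>; differentiability is required everywhere, so that derivatives need
no reference to \<open>U\<close> and \<open>U\<close> may have empty interior. The derivative \<open>f'\<close> is quantified
existentially so that the calculus below works with whatever formula the product or chain rule gives.\<close>

primrec Cn_bound ::
    "nat \<Rightarrow> 'a set \<Rightarrow> ('a::real_normed_vector \<Rightarrow> 'b::real_normed_vector) \<Rightarrow> real \<Rightarrow> bool" where
  "Cn_bound 0 U f B \<longleftrightarrow> (\<forall>x\<in>U. norm (f x) \<le> B)"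
| "Cn_bound (Suc n) U f B \<longleftrightarrow> (\<forall>x\<in>U. norm (f x) \<le> B) \<and>
     (\<exists>f'. (\<forall>x. (f has_derivative f' x) (at x)) \<and>
           (\<forall>v. norm v \<le> 1 \<longrightarrow> Cn_bound n U (\<lambda>x. f' x v) B))"

lemma Cn_bound_SucI:
  assumes "\<And>x. x \<in> U \<Longrightarrow> norm (f x) \<le> B"
    and "\<And>x. (f has_derivative f' x) (at x)"
    and "\<And>v. norm v \<le> 1 \<Longrightarrow> Cn_bound n U (\<lambda>x. f' x v) B"
  shows "Cn_bound (Suc n) U f B"
  using assms by auto

lemma Cn_bound_SucE:
  assumes "Cn_bound (Suc n) U f B"
  obtains f' where "\<And>x. (f has_derivative f' x) (at x)"
    and "\<And>v. norm v \<le> 1 \<Longrightarrow> Cn_bound n U (\<lambda>x. f' x v) B"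
  using assms by auto

lemma Cn_bound_norm: "Cn_bound n U f B \<Longrightarrow> x \<in> U \<Longrightarrow> norm (f x) \<le> B"
  by (cases n) auto

lemma Cn_bound_mono: "Cn_bound n U f B \<Longrightarrow> B \<le> B' \<Longrightarrow> Cn_bound n U f B'"
proof (induction n arbitrary: f)
  case 0
  then show ?case by force
next
  case (Suc n)
  from Suc.prems(1) obtain f' where "\<And>x. (f has_derivative f' x) (at x)"
    "\<And>v. norm v \<le> 1 \<Longrightarrow> Cn_bound n U (\<lambda>x. f' x v) B"
    by (rule Cn_bound_SucE) blast
  with Suc show ?case by (intro Cn_bound_SucI[of _ _ _ f']) (fastforce dest: Cn_bound_norm)+
qed

lemma Cn_bound_SucD: "Cn_bound (Suc n) U f B \<Longrightarrow> Cn_bound n U f B"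
proof (induction n arbitrary: f)
  case (Suc n)
  from Suc.prems obtain f' where "\<And>x. (f has_derivative f' x) (at x)"
    "\<And>v. norm v \<le> 1 \<Longrightarrow> Cn_bound (Suc n) U (\<lambda>x. f' x v) B"
    by (rule Cn_bound_SucE) blast
  with Suc.IH Cn_bound_norm[OF Suc.prems] show ?case
    by (intro Cn_bound_SucI[of _ _ _ f']) blast+
qed auto

lemma Cn_bound_zero: "0 \<le> B \<Longrightarrow> Cn_bound n U (\<lambda>x. 0) B"
  by (induction n) (auto intro!: exI[of _ "\<lambda>x v. 0"])

lemma Cn_bound_add:
  "Cn_bound n U f A \<Longrightarrow> Cn_bound n U g B \<Longrightarrow> Cn_bound n U (\<lambda>x. f x + g x) (A + B)"
proof (induction n arbitrary: f g)
  case 0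
  then show ?case by (auto intro: norm_triangle_mono)
next
  case (Suc n)
  from Suc.prems obtain f' g' where
    f': "\<forall>x. (f has_derivative f' x) (at x)" "\<forall>v. norm v \<le> 1 \<longrightarrow> Cn_bound n U (\<lambda>x. f' x v) A" and
    g': "\<forall>x. (g has_derivative g' x) (at x)" "\<forall>v. norm v \<le> 1 \<longrightarrow> Cn_bound n U (\<lambda>x. g' x v) B"
    by auto
  have "\<forall>x. ((\<lambda>x. f x + g x) has_derivative (\<lambda>v. f' x v + g' x v)) (at x)"
    using f' g' by (auto intro: has_derivative_add)
  with f' g' Suc.IH Suc.prems show ?case
    by (intro Cn_bound_SucI[of _ _ _ "\<lambda>x v. f' x v + g' x v"])
       (auto intro: norm_triangle_mono Cn_bound_norm)
qed

lemma Cn_bound_linear: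
  assumes T: "bounded_linear T" and c: "0 \<le> c" "\<And>y. norm (T y) \<le> c * norm y"
  shows "Cn_bound n U f A \<Longrightarrow> Cn_bound n U (\<lambda>x. T (f x)) (c * A)"
proof (induction n arbitrary: f)
  case 0
  then show ?case using c by (auto intro: order_trans[OF c(2)] mult_left_mono)
next
  case (Suc n)
  from Suc.prems obtain f' where
    f': "\<forall>x. (f has_derivative f' x) (at x)" "\<forall>v. norm v \<le> 1 \<longrightarrow> Cn_bound n U (\<lambda>x. f' x v) A"
    by auto
  have "\<forall>x. ((\<lambda>x. T (f x)) has_derivative (\<lambda>v. T (f' x v))) (at x)"
    using f' by (auto intro: bounded_linear.has_derivative[OF T])
  moreover have "\<forall>x\<in>U. norm (T (f x)) \<le> c * A"
    using Suc.prems c by (auto intro: order_trans[OF c(2)] mult_left_mono)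
  ultimately show ?case using f' Suc.IH
    by (intro Cn_bound_SucI[of _ _ _ "\<lambda>x v. T (f' x v)"]) auto
qed

lemma Cn_bound_diff:
  assumes "Cn_bound n U f A" "Cn_bound n U g B"
  shows "Cn_bound n U (\<lambda>x. f x - g x) (A + B)"
proof -
  have "Cn_bound n U (\<lambda>x. - g x) (1 * B)"
    using assms(2) by (intro Cn_bound_linear) (auto intro: bounded_linear_minus bounded_linear_ident)
  from Cn_bound_add[OF assms(1) this] show ?thesis by simp
qed

lemma Cn_bound_sum:
  assumes "finite I" "\<And>i. i \<in> I \<Longrightarrow> Cn_bound n U (f i) (B i)"
  shows "Cn_bound n U (\<lambda>x. \<Sum>i\<in>I. f i x) (\<Sum>i\<in>I. B i)"
  using assms by (induction I) (auto intro: Cn_bound_zero Cn_bound_add)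

text \<open>Leibniz' rule doubles the number of terms with every differentiation, hence the factor \<open>2 ^ n\<close>.\<close>

lemma Cn_bound_scaleR:
  assumes "0 \<le> A" "0 \<le> B"
  shows "Cn_bound n U f A \<Longrightarrow> Cn_bound n U g B \<Longrightarrow> Cn_bound n U (\<lambda>x. f x *\<^sub>R g x) (2 ^ n * A * B)"
proof (induction n arbitrary: f g)
  case 0
  then show ?case using assms by (auto intro!: mult_mono)
next
  case (Suc n)
  from Suc.prems obtain f' g' where
    f': "\<forall>x. (f has_derivative f' x) (at x)" "\<forall>v. norm v \<le> 1 \<longrightarrow> Cn_bound n U (\<lambda>x. f' x v) A" and
    g': "\<forall>x. (g has_derivative g' x) (at x)" "\<forall>v. norm v \<le> 1 \<longrightarrow> Cn_bound n U (\<lambda>x. g' x v) B"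
    by auto
  have d: "\<forall>x. ((\<lambda>x. f x *\<^sub>R g x) has_derivative (\<lambda>v. f x *\<^sub>R g' x v + f' x v *\<^sub>R g x)) (at x)"
    using f' g' by (auto intro: has_derivative_scaleR)
  have "Cn_bound n U (\<lambda>x. f x *\<^sub>R g' x v + f' x v *\<^sub>R g x) (2 ^ Suc n * A * B)" if "norm v \<le> 1" for v
    using Cn_bound_add[OF Suc.IH[OF Cn_bound_SucD[OF Suc.prems(1)]] Suc.IH[OF _ Cn_bound_SucD[OF Suc.prems(2)]],
        of "\<lambda>x. g' x v" "\<lambda>x. f' x v"] f' g' that by (simp add: algebra_simps)
  moreover have "norm (f x *\<^sub>R g x) \<le> 2 ^ Suc n * A * B" if "x \<in> U" for x
  proof -
    have "norm (f x *\<^sub>R g x) \<le> A * B"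
      using Suc.prems that assms by (auto intro!: mult_mono)
    also have "\<dots> \<le> 2 ^ Suc n * (A * B)"
      using assms mult_right_mono[of 1 "2 ^ Suc n" "A * B"] by (simp add: one_le_power del: power_Suc)
    finally show ?thesis by (simp add: mult.assoc)
  qed
  ultimately show ?case using d
    by (intro Cn_bound_SucI[of _ _ _ "\<lambda>x v. f x *\<^sub>R g' x v + f' x v *\<^sub>R g x"]) blast+
qed

lemma linear_basis_expansion:
  fixes y :: "'a::euclidean_space"
  assumes "linear f"
  shows "f y = (\<Sum>b\<in>Basis. (y \<bullet> b) *\<^sub>R f b)"
proof -
  have "f y = f (\<Sum>b\<in>Basis. (y \<bullet> b) *\<^sub>R b)"
    by (simp only: euclidean_representation)
  also have "\<dots> = (\<Sum>b\<in>Basis. (y \<bullet> b) *\<^sub>R f b)"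
    using assms by (simp add: linear_sum linear_scale)
  finally show ?thesis .
qed

lemma Cn_bound_inner_Basis:
  assumes "Cn_bound n U f B" "b \<in> Basis"
  shows "Cn_bound n U (\<lambda>x. f x \<bullet> b) B"
  using Cn_bound_linear[of "\<lambda>y. y \<bullet> b" 1 n U f B] assms
  by (simp add: bounded_linear_inner_left Basis_le_norm)

text \<open>The chain rule, iterated. Expanding \<open>D f (g x) (D g x v)\<close> in the standard basis turns one differentiation of
\<open>f \<circ> g\<close> into products of components of \<open>D g\<close> with partial derivatives of \<open>f\<close> composed with \<open>g\<close>, to which the
induction hypothesis applies. The estimate is linear in the bound for \<open>f\<close>, with a factor depending on \<open>g\<close>
only through its bound \<open>B\<close>; the error analysis uses it with a small \<open>f\<close>.\<close>

lemma Cn_bound_compose: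
  assumes B: "0 \<le> B"
  shows "\<exists>c\<ge>0. \<forall>(f::'b::euclidean_space \<Rightarrow> 'c::real_normed_vector) (g::'a::real_normed_vector \<Rightarrow> 'b) A U V.
    0 \<le> A \<longrightarrow> Cn_bound n V f A \<longrightarrow> Cn_bound n U g B \<longrightarrow> g ` U \<subseteq> V \<longrightarrow> Cn_bound n U (\<lambda>x. f (g x)) (c * A)"
proof (induction n)
  case 0
  show ?case by (rule exI[of _ 1]) auto
next
  case (Suc n)
  then obtain c where c: "c \<ge> 0" and IH: "\<And>(f::'b \<Rightarrow> 'c) (g::'a \<Rightarrow> 'b) A U V.
    0 \<le> A \<Longrightarrow> Cn_bound n V f A \<Longrightarrow> Cn_bound n U g B \<Longrightarrow> g ` U \<subseteq> V \<Longrightarrow> Cn_bound n U (\<lambda>x. f (g x)) (c * A)"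
    by blast
  define c' where "c' = 1 + DIM('b) * (2 ^ n * B * c)"
  have c': "c' \<ge> 1" using B c by (simp add: c'_def)
  have "Cn_bound (Suc n) U (\<lambda>x. f (g x)) (c' * A)"
    if A: "0 \<le> A" and f: "Cn_bound (Suc n) V f A" and g: "Cn_bound (Suc n) U g B" and UV: "g ` U \<subseteq> V"
    for f :: "'b \<Rightarrow> 'c" and g :: "'a \<Rightarrow> 'b" and A U V
  proof -
    from f g obtain f' g' where
      f': "\<And>x. (f has_derivative f' x) (at x)" "\<And>v. norm v \<le> 1 \<Longrightarrow> Cn_bound n V (\<lambda>x. f' x v) A" and
      g': "\<And>x. (g has_derivative g' x) (at x)" "\<And>v. norm v \<le> 1 \<Longrightarrow> Cn_bound n U (\<lambda>x. g' x v) B"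
      by auto
    have "((\<lambda>x. f (g x)) has_derivative (\<lambda>v. f' (g x) (g' x v))) (at x)" for x
      using has_derivative_compose[OF g'(1) f'(1)] .
    moreover have "Cn_bound n U (\<lambda>x. f' (g x) (g' x v)) (c' * A)" if v: "norm v \<le> 1" for v
    proof -
      have eq: "(\<lambda>x. f' (g x) (g' x v)) = (\<lambda>x. \<Sum>b\<in>Basis. (g' x v \<bullet> b) *\<^sub>R f' (g x) b)"
        using linear_basis_expansion[OF has_derivative_linear[OF f'(1)]] by blast
      have "Cn_bound n U (\<lambda>x. \<Sum>b\<in>Basis. (g' x v \<bullet> b) *\<^sub>R f' (g x) b)
              (\<Sum>b\<in>(Basis::'b set). 2 ^ n * B * (c * A))"
        by (intro Cn_bound_sum Cn_bound_scaleR Cn_bound_inner_Basis g' v IH[OF A f'(2) Cn_bound_SucD[OF g] UV])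
           (auto simp: A B c)
      then show ?thesis unfolding eq
        by (rule Cn_bound_mono) (simp add: c'_def A algebra_simps)
    qed
    moreover have "norm (f (g x)) \<le> c' * A" if "x \<in> U" for x
      using Cn_bound_norm[OF f, of "g x"] UV that mult_right_mono[OF c' A] by force
    ultimately show ?thesis
      by (intro Cn_bound_SucI[of _ _ _ "\<lambda>x v. f' (g x) (g' x v)"]) blast+
  qed
  with c' show ?case by (intro exI[of _ c']) auto
qed

lemma linear_norm_le_of_unit_ball:
  assumes "linear f" "\<And>v. norm v \<le> 1 \<Longrightarrow> norm (f v) \<le> B"
  shows "norm (f v) \<le> B * norm v"
proof (cases "v = 0")
  case True
  then show ?thesis using linear_0[OF assms(1)] by simp
next
  case False
  have "norm (f (inverse (norm v) *\<^sub>R v)) \<le> B"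
    by (rule assms(2)) (use False in simp)
  then show ?thesis using False by (simp add: linear_scale[OF assms(1)] field_simps)
qed

lemma Cn_bound_lipschitz:
  assumes V: "convex V" and f: "Cn_bound (Suc n) V f A" and x: "x \<in> V" and y: "y \<in> V"
  shows "norm (f x - f y) \<le> A * norm (x - y)"
proof -
  from f obtain f' where
    f': "\<And>x. (f has_derivative f' x) (at x)" "\<And>v. norm v \<le> 1 \<Longrightarrow> Cn_bound n V (\<lambda>x. f' x v) A"
    by (rule Cn_bound_SucE) blast
  have "norm (f' z v) \<le> A * norm v" if "z \<in> V" for z v
    using Cn_bound_norm[OF f'(2) that]
    by (intro linear_norm_le_of_unit_ball has_derivative_linear[OF f'(1)]) auto
  moreover have "0 \<le> A"
    using Cn_bound_norm[OF f x] by (rule order_trans[OF norm_ge_zero])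
  ultimately have "onorm (f' z) \<le> A" if "z \<in> V" for z
    using that by (intro onorm_bound) auto
  then show ?thesis
    using V f'(1) x y by (intro differentiable_bound[of V f f']) (auto intro: has_derivative_at_withinI)
qed

text \<open>Left composition with a map of one more order of smoothness is locally Lipschitz in \<open>C\<^sup>n\<close>. In order zero this is
the mean value theorem. Differentiating the difference of compositions gives terms in which either the partial
derivative of \<open>f\<close> is differenced, which is the same situation in lower order, or the inner derivative is, which
is controlled by the bound \<open>E\<close> on \<open>g - h\<close>.\<close>

lemma Cn_bound_compose_diff:
  assumes B: "0 \<le> B"
  shows "\<exists>c\<ge>0. \<forall>(f::'b::euclidean_space \<Rightarrow> 'c::real_normed_vector) (g::'a::real_normed_vector \<Rightarrow> 'b) h A E U V.
    convex V \<longrightarrow> 0 \<le> A \<longrightarrow> 0 \<le> E \<longrightarrow> Cn_bound (Suc n) V f A \<longrightarrow>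
    Cn_bound n U g B \<longrightarrow> Cn_bound n U h B \<longrightarrow> Cn_bound n U (\<lambda>x. g x - h x) E \<longrightarrow>
    g ` U \<subseteq> V \<longrightarrow> h ` U \<subseteq> V \<longrightarrow> Cn_bound n U (\<lambda>x. f (g x) - f (h x)) (c * (A * E))"
proof -
  have lip: "norm (f (g x) - f (h x)) \<le> A * E"
    if V: "convex V" and A: "0 \<le> A" "0 \<le> E" and f: "Cn_bound (Suc n) V f A" 
      and E: "Cn_bound m U (\<lambda>x. g x - h x) E"
      and UV: "g ` U \<subseteq> V" "h ` U \<subseteq> V" and x: "x \<in> U"
    for f :: "'b \<Rightarrow> 'c" and g h :: "'a \<Rightarrow> 'b" and A E U V x n m
  proof -
    have "norm (f (g x) - f (h x)) \<le> A * norm (g x - h x)"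
      using UV x by (intro Cn_bound_lipschitz[OF V f]) auto
    also have "\<dots> \<le> A * E"
      using A Cn_bound_norm[OF E x] by (intro mult_left_mono) auto
    finally show ?thesis .
  qed
  show ?thesis
  proof (induction n)
    case 0
    show ?case
      by (rule exI[of _ 1]) (use lip[where m = 0 and n = 0] in simp)
  next
    case (Suc n)
    then obtain c1 where c1: "c1 \<ge> 0" and IH:
      "\<And>(f::'b \<Rightarrow> 'c) (g::'a \<Rightarrow> 'b) h A E U V. convex V \<Longrightarrow> 0 \<le> A \<Longrightarrow> 0 \<le> E \<Longrightarrow>
        Cn_bound (Suc n) V f A \<Longrightarrow> Cn_bound n U g B \<Longrightarrow> Cn_bound n U h B \<Longrightarrow>
        Cn_bound n U (\<lambda>x. g x - h x) E \<Longrightarrow> g ` U \<subseteq> V \<Longrightarrow> h ` U \<subseteq> V \<Longrightarrow>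
        Cn_bound n U (\<lambda>x. f (g x) - f (h x)) (c1 * (A * E))"
      by blast
    obtain c2 where c2: "c2 \<ge> 0" and comp:
      "\<And>(f::'b \<Rightarrow> 'c) (g::'a \<Rightarrow> 'b) A U V. 0 \<le> A \<Longrightarrow> Cn_bound n V f A \<Longrightarrow> Cn_bound n U g B \<Longrightarrow>
         g ` U \<subseteq> V \<Longrightarrow> Cn_bound n U (\<lambda>x. f (g x)) (c2 * A)"
      using Cn_bound_compose[OF B, of n] by blast
    define c where "c = 1 + DIM('b) * (2 ^ n * (B * c1 + c2))"
    have c: "c \<ge> 1" using B c1 c2 by (simp add: c_def)
    have "Cn_bound (Suc n) U (\<lambda>x. f (g x) - f (h x)) (c * (A * E))"
      if V: "convex V" and A: "0 \<le> A" and E: "0 \<le> E" and f: "Cn_bound (Suc (Suc n)) V f A"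
        and g: "Cn_bound (Suc n) U g B" and h: "Cn_bound (Suc n) U h B"
        and gh: "Cn_bound (Suc n) U (\<lambda>x. g x - h x) E" and UV: "g ` U \<subseteq> V" "h ` U \<subseteq> V"
      for f :: "'b \<Rightarrow> 'c" and g h :: "'a \<Rightarrow> 'b" and A E U V
    proof -
      from f obtain f' where
        f': "\<And>x. (f has_derivative f' x) (at x)" "\<And>v. norm v \<le> 1 \<Longrightarrow> Cn_bound (Suc n) V (\<lambda>x. f' x v) A"
        by (rule Cn_bound_SucE) blast
      from g h gh obtain g' h' d' where
        g': "\<And>x. (g has_derivative g' x) (at x)" "\<And>v. norm v \<le> 1 \<Longrightarrow> Cn_bound n U (\<lambda>x. g' x v) B" and
        h': "\<And>x. (h has_derivative h' x) (at x)" "\<And>v. norm v \<le> 1 \<Longrightarrow> Cn_bound n U (\<lambda>x. h' x v) B" and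
        d': "\<And>x. ((\<lambda>x. g x - h x) has_derivative d' x) (at x)"
            "\<And>v. norm v \<le> 1 \<Longrightarrow> Cn_bound n U (\<lambda>x. d' x v) E"
        by auto
      have "d' x = (\<lambda>v. g' x v - h' x v)" for x
        using d'(1) has_derivative_diff[OF g'(1) h'(1)] by (rule has_derivative_unique)
      then have gh': "Cn_bound n U (\<lambda>x. g' x v - h' x v) E" if "norm v \<le> 1" for v
        using d'(2)[OF that] by simp
      note small = Cn_bound_SucD[OF g] Cn_bound_SucD[OF h] Cn_bound_SucD[OF gh]
      have "((\<lambda>x. f (g x) - f (h x)) has_derivative (\<lambda>v. f' (g x) (g' x v) - f' (h x) (h' x v))) (at x)" for x
        using has_derivative_compose[OF g'(1) f'(1)] has_derivative_compose[OF h'(1) f'(1)]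
        by (rule has_derivative_diff)
      moreover have "Cn_bound n U (\<lambda>x. f' (g x) (g' x v) - f' (h x) (h' x v)) (c * (A * E))"
        if v: "norm v \<le> 1" for v
      proof -
        have "f' (g x) (g' x v) - f' (h x) (h' x v) =
            (\<Sum>b\<in>Basis. (g' x v \<bullet> b) *\<^sub>R (f' (g x) b - f' (h x) b)
                    + ((g' x v - h' x v) \<bullet> b) *\<^sub>R f' (h x) b)" for x
          by (subst (1 2) linear_basis_expansion[OF has_derivative_linear[OF f'(1)]])
             (simp add: sum_subtractf[symmetric] algebra_simps)
        moreover have "Cn_bound n U (\<lambda>x. \<Sum>b\<in>Basis. (g' x v \<bullet> b) *\<^sub>R (f' (g x) b - f' (h x) b)
                    + ((g' x v - h' x v) \<bullet> b) *\<^sub>R f' (h x) b)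
                (\<Sum>b\<in>(Basis::'b set). 2 ^ n * B * (c1 * (A * E)) + 2 ^ n * E * (c2 * A))"
          by (intro Cn_bound_sum Cn_bound_add Cn_bound_scaleR Cn_bound_inner_Basis g' gh' v
                IH[OF V A E f'(2) small UV] comp[OF A Cn_bound_SucD[OF f'(2)] small(2) UV(2)])
             (auto simp: A B E c1 c2)
        ultimately have "Cn_bound n U (\<lambda>x. f' (g x) (g' x v) - f' (h x) (h' x v))
                (\<Sum>b\<in>(Basis::'b set). 2 ^ n * B * (c1 * (A * E)) + 2 ^ n * E * (c2 * A))"
          by simp
        then show ?thesis
          by (rule Cn_bound_mono) (simp add: c_def A E algebra_simps)
      qed
      moreover have "norm (f (g x) - f (h x)) \<le> c * (A * E)" if "x \<in> U" for x
        using lip[OF V A E f gh UV that] mult_right_mono[OF c, of "A * E"] A E by simp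
      ultimately show ?thesis
        by (intro Cn_bound_SucI[of _ _ _ "\<lambda>x v. f' (g x) (g' x v) - f' (h x) (h' x v)"]) blast+
    qed
    with c show ?case by (intro exI[of _ c]) auto
  qed
qed

text \<open>The head of the argument list is the direction of the outermost derivative. Peeling off the last entry
instead exhibits the iterated derivative as one of a first derivative, which is the shape of the
recursion in \<open>Cn_bound\<close> and of the one in \<open>diff_family\<close>.\<close>

lemma higher_deriv_snoc:
  "higher_deriv S f (vs @ [v]) = higher_deriv S (\<lambda>x. frechet_derivative f (at x within S) v) vs"
  by (induction vs) auto

lemma Cn_bound_of_higher_deriv:
  assumes "\<And>vs x. length vs < n \<Longrightarrow> higher_deriv UNIV f vs differentiable (at x)"
    and "\<And>vs x. length vs < n \<Longrightarrow> higher_deriv UNIV g vs differentiable (at x)"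
    and "\<And>vs x. length vs \<le> n \<Longrightarrow> \<forall>v\<in>set vs. norm v \<le> 1 \<Longrightarrow> x \<in> U \<Longrightarrow>
           norm (higher_deriv UNIV f vs x - higher_deriv UNIV g vs x) \<le> B"
  shows "Cn_bound n U (\<lambda>x. f x - g x) B"
  using assms
proof (induction n arbitrary: f g)
  case 0
  from "0.prems"(3)[of "[]"] show ?case by simp
next
  case (Suc n)
  let ?D = "\<lambda>f x. frechet_derivative f (at x)"
  have d: "(f has_derivative ?D f x) (at x)" "(g has_derivative ?D g x) (at x)" for x
    using Suc.prems(1,2)[of "[]" x] by (auto simp: frechet_derivative_works)
  have "Cn_bound n U (\<lambda>x. ?D f x v - ?D g x v) B" if "norm v \<le> 1" for v
  proof (rule Suc.IH)
    show "higher_deriv UNIV (\<lambda>x. ?D f x v) vs differentiable at x"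
         "higher_deriv UNIV (\<lambda>x. ?D g x v) vs differentiable at x" if "length vs < n" for vs x
      using Suc.prems(1,2)[of "vs @ [v]" x] that by (auto simp: higher_deriv_snoc)
    show "norm (higher_deriv UNIV (\<lambda>x. ?D f x v) vs x - higher_deriv UNIV (\<lambda>x. ?D g x v) vs x) \<le> B"
      if "length vs \<le> n" "\<forall>v\<in>set vs. norm v \<le> 1" "x \<in> U" for vs x
      using Suc.prems(3)[of "vs @ [v]" x] that \<open>norm v \<le> 1\<close> by (auto simp: higher_deriv_snoc)
  qed
  moreover have "\<forall>x\<in>U. norm (f x - g x) \<le> B"
    using Suc.prems(3)[of "[]"] by simp
  ultimately show ?case
    using has_derivative_diff[OF d]
    by (intro Cn_bound_SucI[of _ _ _ "\<lambda>x v. ?D f x v - ?D g x v"]) auto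
qed

lemma higher_deriv_le_of_Cn_bound:
  assumes "Cn_bound n U f B" "length vs \<le> n" "\<forall>v\<in>set vs. norm v \<le> 1" "x \<in> U"
  shows "norm (higher_deriv UNIV f vs x) \<le> B"
  using assms
proof (induction n arbitrary: f vs)
  case (Suc n)
  show ?case
  proof (cases vs rule: rev_cases)
    case (snoc ws v)
    from Suc.prems(1) obtain f' where f': "\<And>x. (f has_derivative f' x) (at x)"
      "\<And>v. norm v \<le> 1 \<Longrightarrow> Cn_bound n U (\<lambda>x. f' x v) B" by auto
    have "(\<lambda>x. frechet_derivative f (at x) v) = (\<lambda>x. f' x v)"
      using frechet_derivative_at[OF f'(1)] by metis
    with Suc.IH[OF f'(2)] Suc.prems snoc show ?thesis
      by (auto simp: higher_deriv_snoc)
  qed (use Suc.prems in simp)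
qed simp

lemma C_norm_le_of_Cn_bound:
  assumes "Cn_bound n K f B"
  shows "C_norm n K f \<le> ennreal B"
  unfolding C_norm_def multilinear_norm_def
  by (auto intro!: Max.boundedI SUP_least ennreal_leI higher_deriv_le_of_Cn_bound[OF assms])

section \<open>Families of maps that are smooth in space, jointly continuous with the parameter\<close>

text \<open>The predicate \<open>Q\<close> is imposed on the family and on each of its iterated spatial directional derivatives. It is
instantiated with joint continuity in parameter and space, and with continuous
differentiability in a time parameter.\<close>

primrec diff_family ::
    "(('p \<Rightarrow> 'a::real_normed_vector \<Rightarrow> 'b::real_normed_vector) \<Rightarrow> bool) \<Rightarrow> 'p set \<Rightarrow> nat \<Rightarrow>
     ('p \<Rightarrow> 'a \<Rightarrow> 'b) \<Rightarrow> bool" where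
  "diff_family Q P 0 f \<longleftrightarrow> Q f"
| "diff_family Q P (Suc n) f \<longleftrightarrow> Q f \<and>
     (\<exists>f'. (\<forall>p\<in>P. \<forall>x. (f p has_derivative f' p x) (at x)) \<and>
           (\<forall>v. diff_family Q P n (\<lambda>p x. f' p x v)))"

definition jointly_continuous ::
    "'p::topological_space set \<Rightarrow> ('p \<Rightarrow> 'a::real_normed_vector \<Rightarrow> 'b::real_normed_vector) \<Rightarrow> bool" where
  "jointly_continuous P f \<longleftrightarrow> continuous_on (P \<times> UNIV) (\<lambda>(p, x). f p x)"

abbreviation Cn_family ::
    "nat \<Rightarrow> 'p::topological_space set \<Rightarrow> ('p \<Rightarrow> 'a::real_normed_vector \<Rightarrow> 'b::real_normed_vector) \<Rightarrow> bool" where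
  "Cn_family n P f \<equiv> diff_family (jointly_continuous P) P n f"

lemma diff_family_base: "diff_family Q P n f \<Longrightarrow> Q f"
  by (cases n) auto

lemma diff_family_SucI:
  assumes "Q f" "\<And>p x. p \<in> P \<Longrightarrow> (f p has_derivative f' p x) (at x)"
    and "\<And>v. diff_family Q P n (\<lambda>p x. f' p x v)"
  shows "diff_family Q P (Suc n) f"
  using assms by auto

lemma diff_family_SucE:
  assumes "diff_family Q P (Suc n) f"
  obtains f' where "\<And>p x. p \<in> P \<Longrightarrow> (f p has_derivative f' p x) (at x)"
    and "\<And>v. diff_family Q P n (\<lambda>p x. f' p x v)"
  using assms by auto

lemma diff_family_SucD: "diff_family Q P (Suc n) f \<Longrightarrow> diff_family Q P n f"
proof (induction n arbitrary: f)
  case (Suc n)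
  from Suc.prems obtain f' where "\<And>p x. p \<in> P \<Longrightarrow> (f p has_derivative f' p x) (at x)"
    "\<And>v. diff_family Q P (Suc n) (\<lambda>p x. f' p x v)"
    by (rule diff_family_SucE) blast
  with Suc.IH diff_family_base[OF Suc.prems] show ?case
    by (intro diff_family_SucI[of _ _ _ f']) blast+
qed auto

lemma diff_family_le: "diff_family Q P n f \<Longrightarrow> m \<le> n \<Longrightarrow> diff_family Q P m f"
proof (induction n)
  case (Suc n)
  then show ?case
    by (cases "m = Suc n") (auto dest: diff_family_SucD simp del: diff_family.simps(2))
qed simp

lemma diff_family_weaken:
  assumes "diff_family Q P n f" "\<And>f. Q f \<Longrightarrow> Q' f"
  shows "diff_family Q' P n f"
  using assms(1)
proof (induction n arbitrary: f)
  case (Suc n)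
  from Suc.prems obtain f' where "\<And>p x. p \<in> P \<Longrightarrow> (f p has_derivative f' p x) (at x)"
    "\<And>v. diff_family Q P n (\<lambda>p x. f' p x v)"
    by (rule diff_family_SucE) blast
  with Suc.IH diff_family_base[OF Suc.prems] show ?case
    by (intro diff_family_SucI[of _ _ _ f']) (auto intro: assms(2))
qed (use assms(2) in auto)

lemma diff_family_const:
  assumes "\<And>c. Q (\<lambda>p x. c)"
  shows "diff_family Q P n (\<lambda>p x. c)"
proof (induction n arbitrary: c)
  case (Suc n)
  show ?case
    by (rule diff_family_SucI[where f' = "\<lambda>p x v. 0"]) (use Suc assms in auto)
qed (simp add: assms)

lemma diff_family_ident:
  assumes "\<And>c. Q (\<lambda>p x. c)" "Q (\<lambda>p x. x)"
  shows "diff_family Q P n (\<lambda>p x. x)"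
proof (cases n)
  case (Suc m)
  show ?thesis unfolding Suc
    by (rule diff_family_SucI[where f' = "\<lambda>p x v. v"])
       (use assms diff_family_const[of Q P m] in auto)
qed (simp add: assms)

lemma diff_family_diff:
  assumes Q: "\<And>f g. Q f \<Longrightarrow> Q g \<Longrightarrow> Q (\<lambda>p x. f p x - g p x)"
  shows "diff_family Q P n f \<Longrightarrow> diff_family Q P n g \<Longrightarrow> diff_family Q P n (\<lambda>p x. f p x - g p x)"
proof (induction n arbitrary: f g)
  case (Suc n)
  from Suc.prems(1) obtain f' where f': "\<And>p x. p \<in> P \<Longrightarrow> (f p has_derivative f' p x) (at x)"
    "\<And>v. diff_family Q P n (\<lambda>p x. f' p x v)"
    by (rule diff_family_SucE) blast
  from Suc.prems(2) obtain g' where g': "\<And>p x. p \<in> P \<Longrightarrow> (g p has_derivative g' p x) (at x)"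
    "\<And>v. diff_family Q P n (\<lambda>p x. g' p x v)"
    by (rule diff_family_SucE) blast
  show ?case
    by (rule diff_family_SucI[of _ _ _ "\<lambda>p x v. f' p x v - g' p x v"])
       (auto intro!: Q Suc.IH has_derivative_diff f' g' diff_family_base[OF Suc.prems(1)]
          diff_family_base[OF Suc.prems(2)])
qed (auto intro: Q)

lemma jointly_continuous_compose:
  assumes f: "jointly_continuous P f" and g: "jointly_continuous P g"
  shows "jointly_continuous P (\<lambda>p x. f p (g p x))"
proof -
  have "continuous_on (P \<times> UNIV) (\<lambda>z. (\<lambda>(p, x). f p x) (fst z, (\<lambda>(p, x). g p x) z))"
    by (rule continuous_on_compose2[OF f[unfolded jointly_continuous_def]])
       (use g in \<open>auto simp: jointly_continuous_def intro!: continuous_intros\<close>)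
  then show ?thesis by (simp add: jointly_continuous_def case_prod_unfold)
qed

lemma jointly_continuous_reparam:
  assumes f: "jointly_continuous P f" and q: "continuous_on P' q" "q ` P' \<subseteq> P"
  shows "jointly_continuous P' (\<lambda>p. f (q p))"
proof -
  have "continuous_on (P' \<times> UNIV) (\<lambda>z. q (fst z))"
    by (rule continuous_on_compose2[OF q(1)]) (auto intro: continuous_intros)
  then have "continuous_on (P' \<times> UNIV) (\<lambda>z. (\<lambda>(p, x). f p x) (q (fst z), snd z))"
    by (intro continuous_on_compose2[OF f[unfolded jointly_continuous_def]])
       (use q in \<open>auto intro!: continuous_intros\<close>)
  then show ?thesis by (simp add: jointly_continuous_def case_prod_unfold)
qed

lemma jointly_continuous_const: "jointly_continuous P (\<lambda>p x. c)"
  by (simp add: jointly_continuous_def case_prod_unfold)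

lemma jointly_continuous_add:
  "jointly_continuous P f \<Longrightarrow> jointly_continuous P g \<Longrightarrow> jointly_continuous P (\<lambda>p x. f p x + g p x)"
  by (auto simp: jointly_continuous_def case_prod_unfold intro: continuous_on_add)

lemma jointly_continuous_scaleR:
  "jointly_continuous P f \<Longrightarrow> jointly_continuous P g \<Longrightarrow> jointly_continuous P (\<lambda>p x. f p x *\<^sub>R g p x)"
  by (auto simp: jointly_continuous_def case_prod_unfold intro: continuous_on_scaleR)

lemma Cn_family_add:
  "Cn_family n P f \<Longrightarrow> Cn_family n P g \<Longrightarrow> Cn_family n P (\<lambda>p x. f p x + g p x)"
proof (induction n arbitrary: f g)
  case 0
  then show ?case by (simp add: jointly_continuous_add)
next
  case (Suc n)
  from Suc.prems(1) obtain f' where f': "\<And>p x. p \<in> P \<Longrightarrow> (f p has_derivative f' p x) (at x)"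
    "\<And>v. Cn_family n P (\<lambda>p x. f' p x v)"
    by (rule diff_family_SucE) blast
  from Suc.prems(2) obtain g' where g': "\<And>p x. p \<in> P \<Longrightarrow> (g p has_derivative g' p x) (at x)"
    "\<And>v. Cn_family n P (\<lambda>p x. g' p x v)"
    by (rule diff_family_SucE) blast
  show ?case
    by (rule diff_family_SucI[of _ _ _ "\<lambda>p x v. f' p x v + g' p x v"])
       (auto intro!: jointly_continuous_add Suc.IH has_derivative_add f' g' diff_family_base[OF Suc.prems(1)]
          diff_family_base[OF Suc.prems(2)])
qed

lemma Cn_family_sum:
  assumes "finite I" "\<And>i. i \<in> I \<Longrightarrow> Cn_family n P (f i)"
  shows "Cn_family n P (\<lambda>p x. \<Sum>i\<in>I. f i p x)"
  using assms
proof (induction I)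
  case empty
  show ?case by (simp add: diff_family_const jointly_continuous_const)
next
  case (insert i I)
  then show ?case by (simp add: Cn_family_add)
qed

lemma Cn_family_scaleR:
  "Cn_family n P f \<Longrightarrow> Cn_family n P g \<Longrightarrow> Cn_family n P (\<lambda>p x. f p x *\<^sub>R g p x)"
proof (induction n arbitrary: f g)
  case 0
  then show ?case by (simp add: jointly_continuous_scaleR)
next
  case (Suc n)
  from Suc.prems(1) obtain f' where f': "\<And>p x. p \<in> P \<Longrightarrow> (f p has_derivative f' p x) (at x)"
    "\<And>v. Cn_family n P (\<lambda>p x. f' p x v)"
    by (rule diff_family_SucE) blast
  from Suc.prems(2) obtain g' where g': "\<And>p x. p \<in> P \<Longrightarrow> (g p has_derivative g' p x) (at x)"
    "\<And>v. Cn_family n P (\<lambda>p x. g' p x v)"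
    by (rule diff_family_SucE) blast
  show ?case
    by (rule diff_family_SucI[of _ _ _ "\<lambda>p x v. f p x *\<^sub>R g' p x v + f' p x v *\<^sub>R g p x"])
       (auto intro!: jointly_continuous_scaleR Cn_family_add Suc.IH has_derivative_scaleR f' g'
          diff_family_base[OF Suc.prems(1)] diff_family_base[OF Suc.prems(2)]
          diff_family_SucD[OF Suc.prems(1)] diff_family_SucD[OF Suc.prems(2)])
qed

lemma Cn_family_linear:
  assumes T: "bounded_linear T"
  shows "Cn_family n P f \<Longrightarrow> Cn_family n P (\<lambda>p x. T (f p x))"
proof (induction n arbitrary: f)
  case 0
  then show ?case
    using T by (auto simp: jointly_continuous_def case_prod_unfold intro: bounded_linear.continuous_on)
next
  case (Suc n)
  from Suc.prems(1) obtain f' where f': "\<And>p x. p \<in> P \<Longrightarrow> (f p has_derivative f' p x) (at x)"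
    "\<And>v. Cn_family n P (\<lambda>p x. f' p x v)"
    by (rule diff_family_SucE) blast
  have "jointly_continuous P (\<lambda>p x. T (f p x))"
    using diff_family_base[OF Suc.prems] T
    by (auto simp: jointly_continuous_def case_prod_unfold intro: bounded_linear.continuous_on)
  then show ?case
    by (rule diff_family_SucI[of _ _ _ "\<lambda>p x v. T (f' p x v)"])
       (auto intro!: Suc.IH bounded_linear.has_derivative[OF T] f')
qed

lemma Cn_family_reparam:
  assumes q: "continuous_on P' q" "q ` P' \<subseteq> P"
  shows "Cn_family n P f \<Longrightarrow> Cn_family n P' (\<lambda>p. f (q p))"
proof (induction n arbitrary: f)
  case 0
  then show ?case using jointly_continuous_reparam[OF _ q] by simp
next
  case (Suc n)
  from Suc.prems(1) obtain f' where f': "\<And>p x. p \<in> P \<Longrightarrow> (f p has_derivative f' p x) (at x)"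
    "\<And>v. Cn_family n P (\<lambda>p x. f' p x v)"
    by (rule diff_family_SucE) blast
  have "jointly_continuous P' (\<lambda>p. f (q p))"
    using jointly_continuous_reparam[OF diff_family_base[OF Suc.prems] q] .
  then show ?case
    by (rule diff_family_SucI[of _ _ _ "\<lambda>p. f' (q p)"]) (use f'(1) q Suc.IH[OF f'(2)] in auto)
qed

lemma Cn_family_compose:
  fixes g :: "'p::topological_space \<Rightarrow> 'a::real_normed_vector \<Rightarrow> 'b::euclidean_space"
    and f :: "'p \<Rightarrow> 'b \<Rightarrow> 'c::real_normed_vector"
  shows "Cn_family n P f \<Longrightarrow> Cn_family n P g \<Longrightarrow> Cn_family n P (\<lambda>p x. f p (g p x))"
proof (induction n arbitrary: f)
  case 0
  then show ?case by (simp add: jointly_continuous_compose)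
next
  case (Suc n)
  from Suc.prems(1) obtain f' where f': "\<And>p x. p \<in> P \<Longrightarrow> (f p has_derivative f' p x) (at x)"
    "\<And>v. Cn_family n P (\<lambda>p x. f' p x v)"
    by (rule diff_family_SucE) blast
  from Suc.prems(2) obtain g' where g': "\<And>p x. p \<in> P \<Longrightarrow> (g p has_derivative g' p x) (at x)"
    "\<And>v. Cn_family n P (\<lambda>p x. g' p x v)"
    by (rule diff_family_SucE) blast
  have j: "jointly_continuous P (\<lambda>p x. f p (g p x))"
    by (rule jointly_continuous_compose)
       (use diff_family_base[OF Suc.prems(1)] diff_family_base[OF Suc.prems(2)] in auto)
  let ?d = "\<lambda>p x v. \<Sum>b\<in>Basis. (g' p x v \<bullet> b) *\<^sub>R f' p (g p x) b"
  show ?case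
  proof (rule diff_family_SucI[where f = "\<lambda>p x. f p (g p x)" and f' = ?d])
    show "jointly_continuous P (\<lambda>p x. f p (g p x))" by (fact j)
    show "((\<lambda>x. f p (g p x)) has_derivative ?d p x) (at x)" if "p \<in> P" for p x
    proof -
      have "?d p x = (\<lambda>v. f' p (g p x) (g' p x v))"
        using linear_basis_expansion[OF has_derivative_linear[OF f'(1)[OF that]]] by metis
      then show ?thesis
        using has_derivative_compose[OF g'(1)[OF that] f'(1)[OF that]] by simp
    qed
    show "Cn_family n P (\<lambda>p x. ?d p x v)" for v
      by (intro Cn_family_sum Cn_family_scaleR Cn_family_linear[OF bounded_linear_inner_left] g'
            Suc.IH f' diff_family_SucD[OF Suc.prems(2)]) auto
  qed
qed

lemma jointly_continuous_bounded:
  assumes "jointly_continuous P f" "compact P" "compact U"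
  obtains B where "0 \<le> B" "\<And>p x. p \<in> P \<Longrightarrow> x \<in> U \<Longrightarrow> norm (f p x) \<le> B"
proof -
  have "compact ((\<lambda>(p, x). f p x) ` (P \<times> U))"
    using assms by (intro compact_continuous_image compact_Times)
      (auto simp: jointly_continuous_def intro: continuous_on_subset)
  then obtain B where "\<forall>y\<in>(\<lambda>(p, x). f p x) ` (P \<times> U). norm y \<le> B"
    using compact_imp_bounded bounded_iff by blast
  then show ?thesis
    by (intro that[of "max B 0"]) (force simp: le_max_iff_disj)+
qed

lemma jointly_continuous_uniformly:
  fixes f :: "'p::metric_space \<Rightarrow> 'a::real_normed_vector \<Rightarrow> 'b::real_normed_vector"
  assumes "jointly_continuous P f" "compact P" "compact U" "0 < e"
  obtains d where "0 < d"
    "\<And>p p' x x'. p \<in> P \<Longrightarrow> p' \<in> P \<Longrightarrow> x \<in> U \<Longrightarrow> x' \<in> U \<Longrightarrow> dist p p' < d \<Longrightarrow> dist x x' < d \<Longrightarrow>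
       norm (f p x - f p' x') < e"
proof -
  have "uniformly_continuous_on (P \<times> U) (\<lambda>(p, x). f p x)"
    using assms by (intro compact_uniformly_continuous compact_Times)
      (auto simp: jointly_continuous_def intro: continuous_on_subset)
  then obtain d where d: "0 < d" "\<And>z z'. z \<in> P \<times> U \<Longrightarrow> z' \<in> P \<times> U \<Longrightarrow> dist z' z < d \<Longrightarrow>
      dist ((\<lambda>(p, x). f p x) z') ((\<lambda>(p, x). f p x) z) < e"
    using \<open>0 < e\<close> unfolding uniformly_continuous_on_def by metis
  show ?thesis
  proof (rule that[of "d / 2"])
    fix p p' x x' assume *: "p \<in> P" "p' \<in> P" "x \<in> U" "x' \<in> U" "dist p p' < d / 2" "dist x x' < d / 2"
    have "dist (p, x) (p', x') \<le> dist p p' + dist x x'"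
      by (auto simp: dist_Pair_Pair intro: sqrt_sum_squares_le_sum)
    with * have "dist (p, x) (p', x') < d" by linarith
    with d(2)[of "(p', x')" "(p, x)"] * show "norm (f p x - f p' x') < e"
      by (simp add: dist_norm)
  qed (use d in simp)
qed

lemma Cn_bound_of_linear_family:
  fixes f' :: "'a::euclidean_space \<Rightarrow> 'a \<Rightarrow> 'b::real_normed_vector"
  assumes "\<And>x. linear (f' x)" "\<And>b. b \<in> Basis \<Longrightarrow> Cn_bound n U (\<lambda>x. f' x b) (B b)"
    and "norm v \<le> 1" "\<And>b. b \<in> Basis \<Longrightarrow> 0 \<le> B b"
  shows "Cn_bound n U (\<lambda>x. f' x v) (\<Sum>b\<in>Basis. B b)"
proof -
  have "Cn_bound n U (\<lambda>x. \<Sum>b\<in>Basis. (v \<bullet> b) *\<^sub>R f' x b) (\<Sum>b\<in>Basis. B b)"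
  proof (rule Cn_bound_sum)
    fix b :: 'a assume b: "b \<in> Basis"
    have "\<bar>v \<bullet> b\<bar> \<le> 1" using Basis_le_norm[OF b, of v] assms(3) by simp
    then have "Cn_bound n U (\<lambda>x. (v \<bullet> b) *\<^sub>R f' x b) (1 * B b)"
      by (intro Cn_bound_linear[where T = "\<lambda>y. (v \<bullet> b) *\<^sub>R y" and c = 1]
          bounded_linear_scaleR_right assms(2) b) (simp_all add: mult_left_le_one_le)
    then show "Cn_bound n U (\<lambda>x. (v \<bullet> b) *\<^sub>R f' x b) (B b)" by simp
  qed simp
  moreover have "f' x v = (\<Sum>b\<in>Basis. (v \<bullet> b) *\<^sub>R f' x b)" for x
    by (rule linear_basis_expansion) (rule assms)
  ultimately show ?thesis by simp
qed

text \<open>Joint continuity on the compact set \<open>P \<times> U\<close> bounds every single directional derivative. Linearity in the direction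
reduces the uniformity over the unit ball to the finitely many basis directions.\<close>

lemma Cn_family_bounded:
  fixes f :: "'p::topological_space \<Rightarrow> 'a::euclidean_space \<Rightarrow> 'b::real_normed_vector"
  assumes "compact P" "compact U"
  shows "Cn_family n P f \<Longrightarrow> \<exists>B\<ge>0. \<forall>p\<in>P. Cn_bound n U (f p) B"
proof (induction n arbitrary: f)
  case 0
  then have "jointly_continuous P f" by simp
  then obtain B where "0 \<le> B" "\<And>p x. p \<in> P \<Longrightarrow> x \<in> U \<Longrightarrow> norm (f p x) \<le> B"
    using jointly_continuous_bounded[OF _ assms] by metis
  then show ?case by auto
next
  case (Suc n)
  from Suc.prems(1) obtain f' where f': "\<And>p x. p \<in> P \<Longrightarrow> (f p has_derivative f' p x) (at x)"
    "\<And>v. Cn_family n P (\<lambda>p x. f' p x v)"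
    by (rule diff_family_SucE) blast
  obtain B0 where B0: "0 \<le> B0" "\<And>p x. p \<in> P \<Longrightarrow> x \<in> U \<Longrightarrow> norm (f p x) \<le> B0"
    using jointly_continuous_bounded[OF diff_family_base[OF Suc.prems] assms] by metis
  obtain B where B: "\<And>v. 0 \<le> B v" "\<And>v p. p \<in> P \<Longrightarrow> Cn_bound n U (\<lambda>x. f' p x v) (B v)"
    using Suc.IH[OF f'(2)] by metis
  have "Cn_bound (Suc n) U (f p) (B0 + (\<Sum>b\<in>Basis. B b))" if p: "p \<in> P" for p
  proof (rule Cn_bound_SucI[OF _ f'(1)[OF p]])
    show "norm (f p x) \<le> B0 + (\<Sum>b\<in>Basis. B b)" if "x \<in> U" for x
      using B0(2)[OF p that] B(1) by (simp add: add_increasing2 sum_nonneg)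
    show "Cn_bound n U (\<lambda>x. f' p x v) (B0 + (\<Sum>b\<in>Basis. B b))" if "norm v \<le> 1" for v
      using B0(1)
      by (intro Cn_bound_mono[OF Cn_bound_of_linear_family[of "f' p" n U B v]] that B p
          has_derivative_linear[OF f'(1)[OF p]]) auto
  qed
  moreover have "0 \<le> B0 + (\<Sum>b\<in>Basis. B b)" using B0 B by (simp add: sum_nonneg)
  ultimately show ?case by blast
qed

text \<open>The remainder of the first order Taylor expansion is governed by the modulus of continuity of the derivative,
which is uniform on a ball of radius \<open>R + 1\<close>; the margin \<open>1\<close> leaves room for the increment.\<close>

lemma Cn_family_uniform_linearization:
  fixes f :: "'p::metric_space \<Rightarrow> 'a::euclidean_space \<Rightarrow> 'b::real_normed_vector"
  assumes f': "\<And>p x. p \<in> P \<Longrightarrow> (f p has_derivative f' p x) (at x)"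
    "\<And>v. jointly_continuous P (\<lambda>p x. f' p x v)"
    and P: "compact P" and e: "0 < e"
  obtains d where "0 < d"
    "\<And>p x y. p \<in> P \<Longrightarrow> norm x \<le> R \<Longrightarrow> norm (y - x) < d \<Longrightarrow>
       norm (f p y - f p x - f' p x (y - x)) \<le> e * norm (y - x)"
proof -
  define e' where "e' = e / DIM('a)"
  have e': "0 < e'" using e by (simp add: e'_def)
  have "\<exists>d>0. \<forall>p\<in>P. \<forall>x\<in>cball 0 (R + 1). \<forall>y\<in>cball 0 (R + 1). dist y x < d \<longrightarrow>
      norm (f' p y b - f' p x b) < e'" for b
  proof -
    obtain d where "0 < d" "\<And>p p' x x'. p \<in> P \<Longrightarrow> p' \<in> P \<Longrightarrow> x \<in> cball 0 (R + 1) \<Longrightarrow> x' \<in> cball 0 (R + 1) \<Longrightarrow>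
        dist p p' < d \<Longrightarrow> dist x x' < d \<Longrightarrow> norm (f' p x b - f' p' x' b) < e'"
      using jointly_continuous_uniformly[OF f'(2) P compact_cball e'] by metis
    then show ?thesis by (intro exI[of _ d]) (metis dist_self)
  qed
  then obtain d where d: "\<And>b. 0 < d b" "\<And>b p x y. p \<in> P \<Longrightarrow> x \<in> cball 0 (R + 1) \<Longrightarrow> y \<in> cball 0 (R + 1) \<Longrightarrow>
      dist y x < d b \<Longrightarrow> norm (f' p y b - f' p x b) < e'"
    by metis
  define d0 where "d0 = min 1 (Min (d ` Basis))"
  have d0: "0 < d0" "d0 \<le> 1" "\<And>b. b \<in> Basis \<Longrightarrow> d0 \<le> d b"
    using d(1) by (auto simp: d0_def min_le_iff_disj)
  show ?thesis
  proof (rule that[OF d0(1)])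
    fix p and x y :: 'a assume p: "p \<in> P" and x: "norm x \<le> R" and y: "norm (y - x) < d0"
    have "onorm (f' p z - f' p x) \<le> e" if z: "z \<in> ball x d0" for z
    proof (rule onorm_le)
      fix v
      have lin: "linear (f' p z)" "linear (f' p x)"
        using has_derivative_linear[OF f'(1)[OF p]] by auto
      have "norm z \<le> R + 1"
        using z x d0(2) norm_triangle_ineq2[of z x] by (simp add: dist_norm norm_minus_commute)
      then have *: "norm (f' p z b - f' p x b) \<le> e'" if "b \<in> Basis" for b
        using d(2)[OF p, of x z b] d0(3)[OF that] z x by (auto simp: dist_commute less_imp_le)
      have "norm ((f' p z - f' p x) v) = norm (\<Sum>b\<in>Basis. (v \<bullet> b) *\<^sub>R (f' p z b - f' p x b))"
        by (simp add: linear_basis_expansion[OF lin(1), of v] linear_basis_expansion[OF lin(2), of v]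
            sum_subtractf scaleR_diff_right)
      also have "\<dots> \<le> (\<Sum>b\<in>(Basis::'a set). norm v * e')"
        by (intro sum_norm_le) (auto intro!: mult_mono simp: Basis_le_norm *)
      also have "\<dots> = e * norm v" by (simp add: e'_def)
      finally show "norm ((f' p z - f' p x) v) \<le> e * norm v" .
    qed
    moreover have "x + t *\<^sub>R (y - x) \<in> ball x d0" if "t \<in> {0..1}" for t
    proof -
      have "norm (t *\<^sub>R (y - x)) \<le> norm (y - x)"
        using that by (simp add: mult_left_le_one_le)
      with y show ?thesis by (simp add: dist_norm)
    qed
    ultimately have "norm (f p y - f p x - f' p x (y - x)) \<le> norm (y - x) * e"
      using d0 f'(1)[OF p]
      by (intro differentiable_bound_linearization[of x y "ball x d0" "f p" "f' p" x e])
         (auto intro: has_derivative_at_withinI)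
    then show "norm (f p y - f p x - f' p x (y - x)) \<le> e * norm (y - x)"
      by (simp add: mult.commute)
  qed
qed

text \<open>Spatial derivatives are the derivatives within the space-time strip in the directions \<open>(v, 0)\<close>.\<close>

lemma Cn_family_of_class_C_on:
  fixes H :: "'a::euclidean_space \<times> real \<Rightarrow> 'b::euclidean_space"
  shows "class_C_on n H (UNIV \<times> I) \<Longrightarrow> Cn_family n I (\<lambda>t x. H (x, t))"
proof (induction n arbitrary: H)
  case 0
  then have "continuous_on (UNIV \<times> I) H" by (simp add: class_C_on_def)
  then have "continuous_on (I \<times> UNIV) (\<lambda>z. H (snd z, fst z))"
    by (rule continuous_on_compose2) (auto intro!: continuous_intros)
  then show ?case by (simp add: jointly_continuous_def case_prod_unfold)
next
  case (Suc n)
  let ?S = "(UNIV :: 'a set) \<times> I"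
  let ?D = "\<lambda>z. frechet_derivative H (at z within ?S)"
  have "continuous_on ?S H"
    using Suc.prems unfolding class_C_on_def by (metis bot_nat_0.extremum higher_deriv.simps(1) list.size(3))
  then have "continuous_on (I \<times> UNIV) (\<lambda>z. H (snd z, fst z))"
    by (rule continuous_on_compose2) (auto intro!: continuous_intros)
  then have j: "jointly_continuous I (\<lambda>t x. H (x, t))"
    by (simp add: jointly_continuous_def case_prod_unfold)
  have "H differentiable_on ?S"
    using Suc.prems unfolding class_C_on_def by (metis zero_less_Suc higher_deriv.simps(1) list.size(3))
  then have D: "(H has_derivative ?D z) (at z within ?S)" if "z \<in> ?S" for z
    using that by (auto simp: differentiable_on_def frechet_derivative_works)
  show ?case
  proof (rule diff_family_SucI[where f = "\<lambda>t x. H (x, t)" and f' = "\<lambda>t x v. ?D (x, t) (v, 0)"])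
    show "jointly_continuous I (\<lambda>t x. H (x, t))" by (fact j)
    show "((\<lambda>x. H (x, t)) has_derivative (\<lambda>v. ?D (x, t) (v, 0))) (at x)" if "t \<in> I" for t x
    proof (rule has_derivative_in_compose[of "\<lambda>x. (x, t)" "\<lambda>v. (v, 0)" x UNIV H "?D (x, t)"])
      show "((\<lambda>x. (x, t)) has_derivative (\<lambda>v. (v, 0))) (at x)"
        by (auto intro!: derivative_eq_intros)
      show "(H has_derivative ?D (x, t)) (at (x, t) within range (\<lambda>x. (x, t)))"
        by (rule has_derivative_subset[OF D]) (use that in auto)
    qed
    show "Cn_family n I (\<lambda>t x. ?D (x, t) (v, 0))" for v
    proof (rule Suc.IH)
      show "class_C_on n (\<lambda>z. ?D z (v, 0)) ?S"
        unfolding class_C_on_def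
      proof (intro conjI allI impI)
        fix vs :: "('a \<times> real) list"
        show "higher_deriv ?S (\<lambda>z. ?D z (v, 0)) vs differentiable_on ?S" if "length vs < n"
          using Suc.prems that unfolding class_C_on_def higher_deriv_snoc[symmetric] by simp
        show "continuous_on ?S (higher_deriv ?S (\<lambda>z. ?D z (v, 0)) vs)" if "length vs \<le> n"
          using Suc.prems that unfolding class_C_on_def higher_deriv_snoc[symmetric] by simp
      qed
    qed
  qed
qed

section \<open>Gronwall estimates and linear differential equations\<close>

text \<open>A crude Gronwall constant, valid forwards and backwards in time over an interval of length at most \<open>T\<close>.\<close>

definition gronwall_factor :: "real \<Rightarrow> real \<Rightarrow> real" where
  "gronwall_factor L T = (1 + T) * exp ((2 * L + 1) * T)"

lemma gronwall_factor_ge_1: "0 \<le> L \<Longrightarrow> 0 \<le> T \<Longrightarrow> 1 \<le> gronwall_factor L T"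
  using mult_mono[of 1 "1 + T" 1 "exp ((2 * L + 1) * T)"] by (simp add: gronwall_factor_def)

text \<open>The squared norm \<open>V = \<parallel>w\<parallel>\<^sup>2\<close> is differentiable everywhere, unlike the norm, and satisfies
\<open>\<bar>V'\<bar> \<le> 2 L V + 2 \<beta> \<parallel>w\<parallel> \<le> (2 L + 1) V + \<beta>\<^sup>2\<close>. Multiplying \<open>V\<close> by a decaying exponential and
correcting by \<open>\<beta>\<^sup>2\<close> times the elapsed time makes it monotone on either side of \<open>t0\<close>.\<close>

lemma gronwall_norm:
  fixes w :: "real \<Rightarrow> 'b::real_inner"
  assumes w: "\<And>t. t \<in> {a..b} \<Longrightarrow> (w has_vector_derivative w' t) (at t within {a..b})"
    and le: "\<And>t. t \<in> {a..b} \<Longrightarrow> norm (w' t) \<le> L * norm (w t) + \<beta>"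
    and pos: "0 \<le> L" "0 \<le> \<beta>" and t0: "t0 \<in> {a..b}" and t: "t \<in> {a..b}" and T: "b - a \<le> T"
  shows "norm (w t) \<le> (norm (w t0) + \<beta>) * gronwall_factor L T"
proof -
  define c where "c = 2 * L + 1"
  have c: "c \<ge> 1" using pos by (simp add: c_def)
  have T0: "0 \<le> T" using t0 T by auto
  have V': "\<bar>2 * (w s \<bullet> w' s)\<bar> \<le> c * (norm (w s))\<^sup>2 + \<beta>\<^sup>2" if "s \<in> {a..b}" for s
  proof -
    have "\<bar>2 * (w s \<bullet> w' s)\<bar> \<le> 2 * (norm (w s) * norm (w' s))"
      using Cauchy_Schwarz_ineq2[of "w s" "w' s"] by simp
    also have "\<dots> \<le> 2 * (norm (w s) * (L * norm (w s) + \<beta>))"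
      using le[OF that] by (intro mult_left_mono) auto
    also have "\<dots> \<le> c * (norm (w s))\<^sup>2 + \<beta>\<^sup>2"
      using sum_squares_ge_zero[of "norm (w s) - \<beta>" 0]
      by (simp add: c_def power2_eq_square algebra_simps)
    finally show ?thesis .
  qed
  have dV: "((\<lambda>s. w s \<bullet> w s) has_real_derivative 2 * (w s \<bullet> w' s)) (at s)" if "s \<in> {a<..<b}" for s
  proof -
    have "(w has_derivative (\<lambda>h. h *\<^sub>R w' s)) (at s)"
      using w[of s] that by (auto simp: has_vector_derivative_def at_within_Icc_at)
    from has_derivative_inner[OF this this] show ?thesis
      by (simp add: has_field_derivative_def inner_commute mult_commute_abs algebra_simps)
  qed
  have contw: "continuous_on {a..b} w"
    using w by (intro continuous_on_vector_derivative) auto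
  have main: "(norm (w t))\<^sup>2 * exp (- (c * \<bar>t - t0\<bar>)) - \<beta>\<^sup>2 * \<bar>t - t0\<bar> \<le> (norm (w t0))\<^sup>2"
  proof (cases "t0 \<le> t")
    case True
    let ?\<psi> = "\<lambda>s. (w s \<bullet> w s) * exp (- (c * (s - t0))) - \<beta>\<^sup>2 * (s - t0)"
    have "?\<psi> t \<le> ?\<psi> t0"
    proof (rule DERIV_nonpos_imp_decreasing_open[OF True])
      show "continuous_on {t0..t} ?\<psi>"
        using t0 t by (auto intro!: continuous_intros continuous_on_subset[OF contw])
      fix s assume s: "t0 < s" "s < t"
      then have s': "s \<in> {a<..<b}" "s \<in> {a..b}" using t0 t by auto
      let ?e = "exp (- (c * (s - t0)))"
      have e: "?e \<le> 1" "0 < ?e" using s c by auto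
      have "(?\<psi> has_real_derivative (2 * (w s \<bullet> w' s) * ?e + (w s \<bullet> w s) * (?e * (- c)) - \<beta>\<^sup>2)) (at s)"
        by (rule derivative_eq_intros dV[OF s'(1)] refl | simp)+
      moreover have "(2 * (w s \<bullet> w' s)) * ?e \<le> (c * (norm (w s))\<^sup>2 + \<beta>\<^sup>2) * ?e"
        using V'[OF s'(2)] e by (intro mult_right_mono) auto
      then have "2 * (w s \<bullet> w' s) * ?e + (w s \<bullet> w s) * (?e * (- c)) - \<beta>\<^sup>2 \<le> \<beta>\<^sup>2 * ?e - \<beta>\<^sup>2"
        by (simp add: power2_norm_eq_inner algebra_simps)
      moreover have "\<beta>\<^sup>2 * ?e \<le> \<beta>\<^sup>2" using e by (simp add: mult_left_le)
      ultimately show "\<exists>y. (?\<psi> has_real_derivative y) (at s) \<and> y \<le> 0"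
        by (meson diff_le_0_iff_le order_trans)
    qed
    with True show ?thesis by (simp add: power2_norm_eq_inner)
  next
    case False
    then have tt: "t \<le> t0" by simp
    \<comment> \<open>Backwards in time the signs of both corrections are reversed, as \<open>s - t0\<close> is negative.\<close>
    let ?\<psi> = "\<lambda>s. (w s \<bullet> w s) * exp (c * (s - t0)) + \<beta>\<^sup>2 * (s - t0)"
    have "?\<psi> t \<le> ?\<psi> t0"
    proof (rule DERIV_nonneg_imp_increasing_open[OF tt])
      show "continuous_on {t..t0} ?\<psi>"
        using t0 t by (auto intro!: continuous_intros continuous_on_subset[OF contw])
      fix s assume s: "t < s" "s < t0"
      then have s': "s \<in> {a<..<b}" "s \<in> {a..b}" using t0 t by auto
      let ?e = "exp (c * (s - t0))"
      have e: "?e \<le> 1" "0 < ?e" using s c by (auto simp: mult_nonneg_nonpos)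
      have "(?\<psi> has_real_derivative (2 * (w s \<bullet> w' s) * ?e + (w s \<bullet> w s) * (?e * c) + \<beta>\<^sup>2)) (at s)"
        by (rule derivative_eq_intros dV[OF s'(1)] refl | simp)+
      moreover have "(- (2 * (w s \<bullet> w' s))) * ?e \<le> (c * (norm (w s))\<^sup>2 + \<beta>\<^sup>2) * ?e"
        using V'[OF s'(2)] e by (intro mult_right_mono) auto
      then have "\<beta>\<^sup>2 - \<beta>\<^sup>2 * ?e \<le> 2 * (w s \<bullet> w' s) * ?e + (w s \<bullet> w s) * (?e * c) + \<beta>\<^sup>2"
        by (simp add: power2_norm_eq_inner algebra_simps)
      moreover have "\<beta>\<^sup>2 * ?e \<le> \<beta>\<^sup>2" using e by (simp add: mult_left_le)
      ultimately show "\<exists>y. (?\<psi> has_real_derivative y) (at s) \<and> 0 \<le> y"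
        by (meson diff_ge_0_iff_ge order_trans)
    qed
    with False show ?thesis by (simp add: power2_norm_eq_inner algebra_simps)
  qed
  let ?C = "gronwall_factor L T"
  have C: "?C \<ge> 1" using gronwall_factor_ge_1[OF pos(1) T0] .
  have dT: "\<bar>t - t0\<bar> \<le> T" using t t0 T by auto
  have "(norm (w t))\<^sup>2 = ((norm (w t))\<^sup>2 * exp (- (c * \<bar>t - t0\<bar>))) * exp (c * \<bar>t - t0\<bar>)"
    by (simp add: exp_minus)
  also have "\<dots> \<le> ((norm (w t0))\<^sup>2 + \<beta>\<^sup>2 * \<bar>t - t0\<bar>) * exp (c * T)"
    using main dT c by (intro mult_mono) auto
  also have "\<dots> \<le> ((norm (w t0))\<^sup>2 + \<beta>\<^sup>2 * T) * exp (c * T)"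
    using dT by (intro mult_right_mono add_left_mono mult_left_mono) auto
  also have "\<dots> \<le> ((norm (w t0) + \<beta>)\<^sup>2 * (1 + T)) * exp (c * T)"
  proof (intro mult_right_mono)
    have "(norm (w t0))\<^sup>2 + \<beta>\<^sup>2 * T \<le> (norm (w t0) + \<beta>)\<^sup>2 * 1 + (norm (w t0) + \<beta>)\<^sup>2 * T"
      using pos T0 by (intro add_mono mult_right_mono) (auto simp: power_mono)
    then show "(norm (w t0))\<^sup>2 + \<beta>\<^sup>2 * T \<le> (norm (w t0) + \<beta>)\<^sup>2 * (1 + T)"
      by (simp add: algebra_simps)
  qed simp
  also have "\<dots> = (norm (w t0) + \<beta>)\<^sup>2 * ?C" by (simp add: gronwall_factor_def c_def)
  also have "\<dots> \<le> (norm (w t0) + \<beta>)\<^sup>2 * ?C\<^sup>2"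
    using C by (intro mult_left_mono) (auto simp: power2_eq_square)
  also have "\<dots> = ((norm (w t0) + \<beta>) * ?C)\<^sup>2" by (simp add: power_mult_distrib)
  finally show ?thesis
    by (rule power2_le_imp_le) (use pos C in auto)
qed

text \<open>By Gronwall's inequality the difference of two members \<open>q s\<close> is controlled by the difference of their
inhomogeneities, so the members form a uniform Cauchy family along any sequence of parameters tending to \<open>0\<close>. Their
derivatives then converge uniformly as well, and the limit solves the limiting equation. In particular
this produces a solution of that equation without a separate existence theorem.\<close>

lemma linear_ode_limit:
  fixes q :: "real \<Rightarrow> real \<Rightarrow> 'b::euclidean_space"
  assumes A: "\<And>t. t \<in> {0..T} \<Longrightarrow> linear (A t)" "\<And>t y. t \<in> {0..T} \<Longrightarrow> norm (A t y) \<le> L * norm y"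
    and L: "0 \<le> L" and t0: "t0 \<in> {0..T}"
    and q: "\<And>s t. s \<noteq> 0 \<Longrightarrow> t \<in> {0..T} \<Longrightarrow>
              (q s has_vector_derivative A t (q s t) + \<beta> s t) (at t within {0..T})"
    and q0: "\<And>s. s \<noteq> 0 \<Longrightarrow> q s t0 = c"
    and \<beta>: "uniform_limit {0..T} \<beta> \<beta>0 (at 0)"
  shows "\<exists>w. w t0 = c \<and>
    (\<forall>t\<in>{0..T}. (w has_vector_derivative A t (w t) + \<beta>0 t) (at t within {0..T})) \<and>
    (\<forall>t\<in>{0..T}. ((\<lambda>s. q s t) \<longlongrightarrow> w t) (at 0))"
proof -
  let ?C = "gronwall_factor L T"
  have T: "0 \<le> T" using t0 by simp
  have C: "?C > 0" using gronwall_factor_ge_1[OF L T] by linarith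
  have est: "norm (q s t - y t) \<le> e * ?C"
    if s: "s \<noteq> 0" and y: "\<And>t. t \<in> {0..T} \<Longrightarrow> (y has_vector_derivative A t (y t) + \<gamma> t) (at t within {0..T})"
      and y0: "y t0 = c" and e: "0 \<le> e" "\<And>t. t \<in> {0..T} \<Longrightarrow> norm (\<beta> s t - \<gamma> t) \<le> e" and t: "t \<in> {0..T}"
    for s t y \<gamma> e
  proof -
    have "norm (q s t - y t) \<le> (norm (q s t0 - y t0) + e) * ?C"
    proof (rule gronwall_norm[of 0 T _ _ L e t0 t T])
      fix t assume t: "t \<in> {0..T}"
      show "((\<lambda>t. q s t - y t) has_vector_derivative (A t (q s t) + \<beta> s t - (A t (y t) + \<gamma> t))) (at t within {0..T})"
        by (intro has_vector_derivative_diff q s y t)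
      have "A t (q s t) + \<beta> s t - (A t (y t) + \<gamma> t) = A t (q s t - y t) + (\<beta> s t - \<gamma> t)"
        by (simp add: linear_diff[OF A(1)[OF t]])
      also have "norm \<dots> \<le> L * norm (q s t - y t) + e"
        by (intro norm_triangle_mono A(2) e t)
      finally show "norm (A t (q s t) + \<beta> s t - (A t (y t) + \<gamma> t)) \<le> L * norm (q s t - y t) + e" .
    qed (use L e t t0 in auto)
    then show ?thesis by (simp add: q0 s y0)
  qed
  define \<sigma> where "\<sigma> n = inverse (real (Suc n))" for n
  have \<sigma>: "\<sigma> n \<noteq> 0" for n by (simp add: \<sigma>_def)
  have "filterlim \<sigma> (at 0) sequentially"
    unfolding \<sigma>_def by (intro filterlim_atI LIMSEQ_inverse_real_of_nat) simp
  with \<beta> have \<beta>\<sigma>: "uniform_limit {0..T} (\<lambda>n. \<beta> (\<sigma> n)) \<beta>0 sequentially"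
    by (auto intro!: uniform_limitI dest!: uniform_limitD intro: eventually_compose_filterlim)
  have "uniformly_Cauchy_on {0..T} (\<lambda>n. q (\<sigma> n))"
    unfolding uniformly_Cauchy_on_def
  proof (intro allI impI)
    fix e :: real assume e: "0 < e"
    define d where "d = e / (4 * ?C)"
    have d: "0 < d" using e C by (simp add: d_def)
    from uniform_limitD[OF \<beta>\<sigma> this] obtain N where
      N: "\<And>n t. n \<ge> N \<Longrightarrow> t \<in> {0..T} \<Longrightarrow> dist (\<beta> (\<sigma> n) t) (\<beta>0 t) < d"
      unfolding eventually_sequentially by blast
    have "dist (q (\<sigma> m) t) (q (\<sigma> n) t) < e" if "t \<in> {0..T}" "m \<ge> N" "n \<ge> N" for t m n
    proof -
      have "norm (\<beta> (\<sigma> m) t - \<beta> (\<sigma> n) t) \<le> 2 * d" if "t \<in> {0..T}" for t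
        using N[OF \<open>m \<ge> N\<close> that] N[OF \<open>n \<ge> N\<close> that]
          dist_triangle2[of "\<beta> (\<sigma> m) t" "\<beta> (\<sigma> n) t" "\<beta>0 t"] by (simp add: dist_norm)
      from est[OF \<sigma> q[OF \<sigma>] q0[OF \<sigma>] _ this that(1)] d
      have "norm (q (\<sigma> m) t - q (\<sigma> n) t) \<le> 2 * d * ?C" by simp
      also have "\<dots> < e" using e C by (simp add: d_def)
      finally show ?thesis by (simp add: dist_norm)
    qed
    then show "\<exists>M. \<forall>t\<in>{0..T}. \<forall>m\<ge>M. \<forall>n\<ge>M. dist (q (\<sigma> m) t) (q (\<sigma> n) t) < e" by blast
  qed
  then obtain w where w: "uniform_limit {0..T} (\<lambda>n. q (\<sigma> n)) w sequentially"
    using Cauchy_uniformly_convergent uniformly_convergent_on_def by blast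
  have lim: "(\<lambda>n. q (\<sigma> n) t) \<longlonglongrightarrow> w t" if "t \<in> {0..T}" for t
    using tendsto_uniform_limitI[OF w that] .
  have "\<exists>g. \<forall>t\<in>{0..T}. (\<lambda>n. q (\<sigma> n) t) \<longlonglongrightarrow> g t \<and>
          (g has_derivative (\<lambda>h. h *\<^sub>R (A t (w t) + \<beta>0 t))) (at t within {0..T})"
  proof (rule has_derivative_sequence)
    show "(q (\<sigma> n) has_derivative (\<lambda>h. h *\<^sub>R (A t (q (\<sigma> n) t) + \<beta> (\<sigma> n) t))) (at t within {0..T})"
      if "t \<in> {0..T}" for n t
      using q[OF \<sigma> that] by (simp add: has_vector_derivative_def)
    show "(\<lambda>n. q (\<sigma> n) t0) \<longlonglongrightarrow> w t0" using lim[OF t0] .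
    fix e :: real assume e: "0 < e"
    define d where "d = e / (L + 1)"
    have d: "0 < d" using e L by (simp add: d_def)
    show "\<forall>\<^sub>F n in sequentially. \<forall>t\<in>{0..T}. \<forall>h. norm (h *\<^sub>R (A t (q (\<sigma> n) t) + \<beta> (\<sigma> n) t)
            - h *\<^sub>R (A t (w t) + \<beta>0 t)) \<le> e * norm h"
      using uniform_limitD[OF \<beta>\<sigma> d] uniform_limitD[OF w d]
    proof eventually_elim
      case (elim n)
      show ?case
      proof (intro ballI allI)
        fix t h assume t: "t \<in> {0..T}"
        have "norm ((A t (q (\<sigma> n) t) + \<beta> (\<sigma> n) t) - (A t (w t) + \<beta>0 t))
            = norm (A t (q (\<sigma> n) t - w t) + (\<beta> (\<sigma> n) t - \<beta>0 t))"
          by (simp add: linear_diff[OF A(1)[OF t]] algebra_simps)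
        also have "\<dots> \<le> L * norm (q (\<sigma> n) t - w t) + norm (\<beta> (\<sigma> n) t - \<beta>0 t)"
          by (intro norm_triangle_mono A(2) t order_refl)
        also have "\<dots> \<le> L * d + d"
          using elim t L by (intro add_mono mult_left_mono) (auto simp: dist_norm less_imp_le)
        also have "\<dots> = (L + 1) * d" by (simp add: algebra_simps)
        also have "\<dots> = e" using L by (simp add: d_def)
        finally have "\<bar>h\<bar> * norm ((A t (q (\<sigma> n) t) + \<beta> (\<sigma> n) t) - (A t (w t) + \<beta>0 t)) \<le> \<bar>h\<bar> * e"
          by (rule mult_left_mono) simp
        then show "norm (h *\<^sub>R (A t (q (\<sigma> n) t) + \<beta> (\<sigma> n) t) - h *\<^sub>R (A t (w t) + \<beta>0 t)) \<le> e * norm h"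
          by (simp add: scaleR_diff_right[symmetric] mult.commute)
      qed
    qed
  qed (use t0 in auto)
  then obtain g where g: "\<And>t. t \<in> {0..T} \<Longrightarrow> (\<lambda>n. q (\<sigma> n) t) \<longlonglongrightarrow> g t"
    "\<And>t. t \<in> {0..T} \<Longrightarrow> (g has_vector_derivative A t (w t) + \<beta>0 t) (at t within {0..T})"
    unfolding has_vector_derivative_def by blast
  have gw: "g t = w t" if "t \<in> {0..T}" for t
    using LIMSEQ_unique[OF g(1)[OF that] lim[OF that]] .
  have g': "(g has_vector_derivative A t (g t) + \<beta>0 t) (at t within {0..T})" if "t \<in> {0..T}" for t
    using g(2)[OF that] by (simp add: gw[OF that])
  have g0: "g t0 = c"
    using g(1)[OF t0] by (simp add: q0 \<sigma> LIMSEQ_const_iff)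
  have "((\<lambda>s. q s t) \<longlongrightarrow> g t) (at 0)" if t: "t \<in> {0..T}" for t
  proof (rule tendstoI)
    fix e :: real assume e: "0 < e"
    define d where "d = e / (2 * ?C)"
    have d: "0 < d" using e C by (simp add: d_def)
    have "\<forall>\<^sub>F s in at 0. s \<noteq> (0::real)" by (simp add: eventually_at_filter)
    with uniform_limitD[OF \<beta> d] show "\<forall>\<^sub>F s in at 0. dist (q s t) (g t) < e"
    proof eventually_elim
      case (elim s)
      have "norm (q s t - g t) \<le> d * ?C"
        using elim d by (intro est[OF _ g' g0 _ _ t]) (auto simp: dist_norm less_imp_le)
      also have "\<dots> < e" using e C by (simp add: d_def)
      finally show ?case by (simp add: dist_norm)
    qed
  qed
  with g0 g' show ?thesis by blast
qed

text \<open>Continuity of the partial derivatives implies total differentiability. The increment is performed one coordinate at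
a time, with the mean value inequality along each coordinate segment.\<close>

lemma has_derivative_of_directional:
  fixes f :: "'a::euclidean_space \<Rightarrow> 'b::real_normed_vector"
  assumes dir: "\<And>x v. ((\<lambda>s. (f (x + s *\<^sub>R v) - f x) /\<^sub>R s) \<longlongrightarrow> D x v) (at 0)"
    and cont: "\<And>b. b \<in> Basis \<Longrightarrow> isCont (\<lambda>y. D y b) x"
  shows "(f has_derivative D x) (at x)"
proof -
  have line: "((\<lambda>s. f (y + s *\<^sub>R v)) has_vector_derivative D (y + s *\<^sub>R v) v) (at s)" for y v s
  proof -
    have "norm (f (y + (s + h) *\<^sub>R v) - f (y + s *\<^sub>R v) - h *\<^sub>R D (y + s *\<^sub>R v) v) / norm h
        = norm ((f ((y + s *\<^sub>R v) + h *\<^sub>R v) - f (y + s *\<^sub>R v)) /\<^sub>R h - D (y + s *\<^sub>R v) v)" if "h \<noteq> 0" for h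
    proof -
      have "(f ((y + s *\<^sub>R v) + h *\<^sub>R v) - f (y + s *\<^sub>R v)) /\<^sub>R h - D (y + s *\<^sub>R v) v
          = (f (y + (s + h) *\<^sub>R v) - f (y + s *\<^sub>R v) - h *\<^sub>R D (y + s *\<^sub>R v) v) /\<^sub>R h"
        using that by (simp add: algebra_simps)
      then show ?thesis by (simp add: divide_inverse mult.commute)
    qed
    then have "((\<lambda>h. norm (f (y + (s + h) *\<^sub>R v) - f (y + s *\<^sub>R v) - h *\<^sub>R D (y + s *\<^sub>R v) v) / norm h) \<longlongrightarrow> 0) (at 0)
        \<longleftrightarrow> ((\<lambda>h. norm ((f ((y + s *\<^sub>R v) + h *\<^sub>R v) - f (y + s *\<^sub>R v)) /\<^sub>R h - D (y + s *\<^sub>R v) v)) \<longlongrightarrow> 0) (at 0)"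
      by (intro filterlim_cong) (auto simp: eventually_at_filter)
    moreover have "((\<lambda>h. norm ((f ((y + s *\<^sub>R v) + h *\<^sub>R v) - f (y + s *\<^sub>R v)) /\<^sub>R h - D (y + s *\<^sub>R v) v)) \<longlongrightarrow> 0) (at 0)"
      using dir[of "y + s *\<^sub>R v" v] by (simp add: LIM_zero tendsto_norm_zero)
    ultimately show ?thesis
      unfolding has_vector_derivative_def has_derivative_at
      by (auto intro: bounded_linear_scaleR_left)
  qed
  define l where "l v = (\<Sum>b\<in>Basis. (v \<bullet> b) *\<^sub>R D x b)" for v
  have approx: "\<exists>d>0. \<forall>y h. norm (y - x) < d \<longrightarrow> norm h < d \<longrightarrow>
      norm (f (y + (\<Sum>b\<in>S. (h \<bullet> b) *\<^sub>R b)) - f y - (\<Sum>b\<in>S. (h \<bullet> b) *\<^sub>R D x b)) \<le> e * card S * norm h"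
    if "finite S" "S \<subseteq> Basis" "0 < e" for S and e :: real
    using that(1,2)
  proof (induction S)
    case empty
    show ?case by (intro exI[of _ 1]) auto
  next
    case (insert b S)
    then obtain d1 where d1: "d1 > 0" and IH: "\<And>y h. norm (y - x) < d1 \<Longrightarrow> norm h < d1 \<Longrightarrow>
      norm (f (y + (\<Sum>b\<in>S. (h \<bullet> b) *\<^sub>R b)) - f y - (\<Sum>b\<in>S. (h \<bullet> b) *\<^sub>R D x b)) \<le> e * card S * norm h"
      by auto
    have b: "b \<in> Basis" using insert by auto
    then have nb: "norm b = 1" by simp
    from cont[OF b, unfolded continuous_at_eps_delta] \<open>0 < e\<close> obtain d2 where d2: "d2 > 0"
      "\<And>y. dist y x < d2 \<Longrightarrow> dist (D y b) (D x b) < e" by metis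
    define d where "d = min d1 d2 / 2"
    have d: "0 < d" "2 * d \<le> d1" "2 * d \<le> d2" using d1 d2 by (auto simp: d_def)
    have "norm (f (y + (\<Sum>b\<in>insert b S. (h \<bullet> b) *\<^sub>R b)) - f y - (\<Sum>b\<in>insert b S. (h \<bullet> b) *\<^sub>R D x b))
        \<le> e * card (insert b S) * norm h" if y: "norm (y - x) < d" and h: "norm h < d" for y h
    proof -
      let ?z = "y + (h \<bullet> b) *\<^sub>R b" and ?J = "closed_segment 0 (h \<bullet> b)"
      have near: "norm (y + s *\<^sub>R b - x) < 2 * d" if "s \<in> ?J" for s
      proof -
        have "\<bar>s\<bar> \<le> \<bar>h \<bullet> b\<bar>" using that by (auto simp: closed_segment_eq_real_ivl split: if_splits)
        also have "\<dots> \<le> norm h" by (rule Basis_le_norm[OF b])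
        finally have "norm (s *\<^sub>R b) < d" using h nb by simp
        with y norm_triangle_ineq[of "y - x" "s *\<^sub>R b"] show ?thesis by (simp add: algebra_simps)
      qed
      have "norm ((f (y + (h \<bullet> b) *\<^sub>R b) - (h \<bullet> b) *\<^sub>R D x b) - (f (y + 0 *\<^sub>R b) - 0 *\<^sub>R D x b))
          \<le> e * norm (h \<bullet> b - 0)"
      proof (rule differentiable_bound[where S = ?J and f = "\<lambda>s. f (y + s *\<^sub>R b) - s *\<^sub>R D x b"
            and f' = "\<lambda>s k. k *\<^sub>R (D (y + s *\<^sub>R b) b - D x b)"])
        fix s assume s: "s \<in> ?J"
        have "((\<lambda>s. f (y + s *\<^sub>R b) - s *\<^sub>R D x b) has_derivative (\<lambda>k. k *\<^sub>R D (y + s *\<^sub>R b) b - k *\<^sub>R D x b)) (at s)"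
          using line[of y b s, unfolded has_vector_derivative_def]
          by (rule has_derivative_diff) (intro bounded_linear_imp_has_derivative bounded_linear_scaleR_left)
        then show "((\<lambda>s. f (y + s *\<^sub>R b) - s *\<^sub>R D x b) has_derivative (\<lambda>k. k *\<^sub>R (D (y + s *\<^sub>R b) b - D x b))) (at s within ?J)"
          by (simp add: scaleR_diff_right has_derivative_at_withinI)
        have "norm (D (y + s *\<^sub>R b) b - D x b) \<le> e"
          using d2(2)[of "y + s *\<^sub>R b"] near[OF s] d(3) by (simp add: dist_norm)
        then show "onorm (\<lambda>k. k *\<^sub>R (D (y + s *\<^sub>R b) b - D x b)) \<le> e"
          by (intro onorm_le) (simp add: mult.commute[of e] mult_left_mono)
      qed auto
      also have "\<dots> \<le> e * norm h"
        using Basis_le_norm[OF b, of h] \<open>0 < e\<close> by (intro mult_left_mono) auto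
      finally have 1: "norm (f ?z - f y - (h \<bullet> b) *\<^sub>R D x b) \<le> e * norm h"
        by (simp add: algebra_simps)
      have 2: "norm (f (?z + (\<Sum>b\<in>S. (h \<bullet> b) *\<^sub>R b)) - f ?z - (\<Sum>b\<in>S. (h \<bullet> b) *\<^sub>R D x b)) \<le> e * card S * norm h"
      proof (rule IH)
        show "norm (?z - x) < d1" using near[of "h \<bullet> b"] d(2) by auto
        show "norm h < d1" using h d by linarith
      qed
      have "f (y + (\<Sum>b\<in>insert b S. (h \<bullet> b) *\<^sub>R b)) - f y - (\<Sum>b\<in>insert b S. (h \<bullet> b) *\<^sub>R D x b)
          = (f ?z - f y - (h \<bullet> b) *\<^sub>R D x b)
            + (f (?z + (\<Sum>b\<in>S. (h \<bullet> b) *\<^sub>R b)) - f ?z - (\<Sum>b\<in>S. (h \<bullet> b) *\<^sub>R D x b))"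
        using insert by (simp add: algebra_simps)
      also have "norm \<dots> \<le> e * norm h + e * card S * norm h"
        using 1 2 by (rule norm_triangle_mono)
      also have "\<dots> = e * card (insert b S) * norm h"
        using insert by (simp add: algebra_simps)
      finally show ?thesis .
    qed
    with d(1) show ?case by blast
  qed
  have "(f has_derivative l) (at x)"
    unfolding has_derivative_at_alt
  proof (intro conjI allI impI)
    show "bounded_linear l"
      unfolding l_def by (intro bounded_linear_sum bounded_linear_scaleR_const bounded_linear_inner_left)
    fix e :: real assume e: "0 < e"
    then have "0 < e / DIM('a)" by simp
    from approx[OF finite_Basis order_refl this] obtain d where d: "d > 0"
      "\<And>y h. norm (y - x) < d \<Longrightarrow> norm h < d \<Longrightarrow>
        norm (f (y + (\<Sum>b\<in>Basis. (h \<bullet> b) *\<^sub>R b)) - f y - l h) \<le> e * norm h"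
      by (auto simp: l_def)
    show "\<exists>d>0. \<forall>y. norm (y - x) < d \<longrightarrow> norm (f y - f x - l (y - x)) \<le> e * norm (y - x)"
      using d(1) d(2)[of x "_ - x"] by (intro exI[of _ d]) (simp add: euclidean_representation)
  qed
  moreover have "l v = D x v" for v
  proof (rule vector_derivative_unique_at)
    have "((\<lambda>s. x + s *\<^sub>R v) has_derivative (\<lambda>s. s *\<^sub>R v)) (at 0)"
      by (auto intro!: derivative_eq_intros)
    moreover have "(f has_derivative l) (at (x + 0 *\<^sub>R v))"
      using \<open>(f has_derivative l) (at x)\<close> by simp
    ultimately have "((\<lambda>s. f (x + s *\<^sub>R v)) has_derivative (\<lambda>s. l (s *\<^sub>R v))) (at 0)"
      by (rule has_derivative_compose)
    moreover have "l (s *\<^sub>R v) = s *\<^sub>R l v" for s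
      by (simp add: l_def scaleR_sum_right)
    ultimately show "((\<lambda>s. f (x + s *\<^sub>R v)) has_vector_derivative l v) (at 0)"
      by (simp add: has_vector_derivative_def)
    show "((\<lambda>s. f (x + s *\<^sub>R v)) has_vector_derivative D x v) (at 0)"
      using line[of x v 0] by simp
  qed
  ultimately show ?thesis by (simp add: ext[of l "D x"])
qed

section \<open>Continuous dependence of linear equations on a parameter\<close>

abbreviation time_square :: "real \<Rightarrow> (real \<times> real) set" where
  "time_square T \<equiv> {0..T} \<times> {0..T}"

text \<open>The parameter \<open>(t, t0)\<close> stands for the current time and the initial time; differentiation is in the
current time.\<close>

definition C1_in_time :: "real \<Rightarrow> (real \<times> real \<Rightarrow> 'a::real_normed_vector \<Rightarrow> 'b::real_normed_vector) \<Rightarrow> bool" where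
  "C1_in_time T f \<longleftrightarrow> jointly_continuous (time_square T) f \<and>
     (\<exists>f'. jointly_continuous (time_square T) f' \<and>
        (\<forall>t\<in>{0..T}. \<forall>t0\<in>{0..T}. \<forall>x.
           ((\<lambda>s. f (s, t0) x) has_vector_derivative f' (t, t0) x) (at t within {0..T})))"

abbreviation lin_comb :: "('b::euclidean_space \<Rightarrow> 'c::real_normed_vector) \<Rightarrow> 'b \<Rightarrow> 'c" where
  "lin_comb a y \<equiv> (\<Sum>b\<in>Basis. (y \<bullet> b) *\<^sub>R a b)"

lemma linear_lin_comb: "linear (lin_comb a)"
  by (intro bounded_linear.linear bounded_linear_sum bounded_linear_scaleR_const bounded_linear_inner_left)

lemma norm_lin_comb_le: "norm (lin_comb a y) \<le> (\<Sum>b\<in>Basis. norm (a b)) * norm y"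
proof -
  have "norm (lin_comb a y) \<le> (\<Sum>b\<in>Basis. norm (a b) * norm y)"
    by (intro sum_norm_le) (simp add: mult.commute[of _ "norm (a _)"] mult_left_mono Basis_le_norm)
  then show ?thesis by (simp add: sum_distrib_right)
qed

lemma C1_in_time_diff:
  assumes "C1_in_time T f" "C1_in_time T g"
  shows "C1_in_time T (\<lambda>p x. f p x - g p x)"
proof -
  from assms obtain f' g' where
    f': "jointly_continuous (time_square T) f'"
      "\<forall>t\<in>{0..T}. \<forall>t0\<in>{0..T}. \<forall>x. ((\<lambda>s. f (s, t0) x) has_vector_derivative f' (t, t0) x) (at t within {0..T})" and
    g': "jointly_continuous (time_square T) g'"
      "\<forall>t\<in>{0..T}. \<forall>t0\<in>{0..T}. \<forall>x. ((\<lambda>s. g (s, t0) x) has_vector_derivative g' (t, t0) x) (at t within {0..T})"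
    unfolding C1_in_time_def by blast
  have "jointly_continuous (time_square T) (\<lambda>p x. f p x - g p x)"
       "jointly_continuous (time_square T) (\<lambda>p x. f' p x - g' p x)"
    using assms f' g' by (auto simp: C1_in_time_def jointly_continuous_def case_prod_unfold intro: continuous_on_diff)
  then show ?thesis
    unfolding C1_in_time_def using f'(2) g'(2)
    by (intro conjI exI[of _ "\<lambda>p x. f' p x - g' p x"]) (auto intro: has_vector_derivative_diff)
qed

lemma C1_in_time_const: "C1_in_time T (\<lambda>p x. h x)" if "continuous_on UNIV h"
proof -
  have "jointly_continuous (time_square T) (\<lambda>p x. h x)"
    unfolding jointly_continuous_def case_prod_unfold
    by (rule continuous_on_compose2[OF that]) (auto intro!: continuous_intros)
  then show ?thesis unfolding C1_in_time_def
    by (intro conjI exI[of _ "\<lambda>p x. 0"]) (auto simp: jointly_continuous_const)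
qed

text \<open>The mean value inequality in time, for each spatial derivative: all of them vanish for \<open>t = t0\<close> because \<open>f\<close>
itself vanishes there.\<close>

lemma Cn_bound_of_C1_in_time:
  fixes f :: "real \<times> real \<Rightarrow> 'a::euclidean_space \<Rightarrow> 'b::euclidean_space"
  assumes U: "compact U"
  shows "diff_family (C1_in_time T) (time_square T) n f \<Longrightarrow> (\<And>t x. t \<in> {0..T} \<Longrightarrow> f (t, t) x = 0) \<Longrightarrow>
    \<exists>B\<ge>0. \<forall>t\<in>{0..T}. \<forall>t0\<in>{0..T}. Cn_bound n U (f (t, t0)) (B * \<bar>t - t0\<bar>)"
proof (induction n arbitrary: f)
  note cpt = compact_Times[OF compact_Icc compact_Icc]
  have base: "\<exists>B\<ge>0. \<forall>t\<in>{0..T}. \<forall>t0\<in>{0..T}. \<forall>x\<in>U. norm (f (t, t0) x) \<le> B * \<bar>t - t0\<bar>"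
    if f: "C1_in_time T f" and 0: "\<And>t x. t \<in> {0..T} \<Longrightarrow> f (t, t) x = 0"
    for f :: "real \<times> real \<Rightarrow> 'a \<Rightarrow> 'b"
  proof -
    from f obtain f' where f': "jointly_continuous (time_square T) f'"
      "\<And>t t0 x. t \<in> {0..T} \<Longrightarrow> t0 \<in> {0..T} \<Longrightarrow>
         ((\<lambda>s. f (s, t0) x) has_vector_derivative f' (t, t0) x) (at t within {0..T})"
      unfolding C1_in_time_def by blast
    from jointly_continuous_bounded[OF f'(1) cpt U] obtain B where
      B: "0 \<le> B" "\<And>p x. p \<in> time_square T \<Longrightarrow> x \<in> U \<Longrightarrow> norm (f' p x) \<le> B" by blast
    have "norm (f (t, t0) x) \<le> B * \<bar>t - t0\<bar>" if t: "t \<in> {0..T}" "t0 \<in> {0..T}" and x: "x \<in> U" for t t0 x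
    proof -
      have "norm (f (t, t0) x - f (t0, t0) x) \<le> B * norm (t - t0)"
      proof (rule differentiable_bound[where S = "{0..T}" and f = "\<lambda>s. f (s, t0) x" and f' = "\<lambda>s h. h *\<^sub>R f' (s, t0) x"])
        fix s assume s: "s \<in> {0..T}"
        show "((\<lambda>s. f (s, t0) x) has_derivative (\<lambda>h. h *\<^sub>R f' (s, t0) x)) (at s within {0..T})"
          using f'(2)[OF s t(2)] by (simp add: has_vector_derivative_def)
        show "onorm (\<lambda>h. h *\<^sub>R f' (s, t0) x) \<le> B"
          using B(2)[of "(s, t0)" x] s t x
          by (intro onorm_le) (simp add: mult.commute[of B] mult_left_mono)
      qed (use t in auto)
      then show ?thesis by (simp add: 0[OF t(2)])
    qed
    with B(1) show ?thesis by blast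
  qed
  {
    case 0
    then show ?case using base[of f] by simp
  next
    case (Suc n)
    let ?P = "time_square T"
    from Suc.prems(1) obtain f' where f': "\<And>p x. p \<in> ?P \<Longrightarrow> (f p has_derivative f' p x) (at x)"
      "\<And>v. diff_family (C1_in_time T) ?P n (\<lambda>p x. f' p x v)"
      by (rule diff_family_SucE) blast
    have 0: "f' (t, t) x v = 0" if t: "t \<in> {0..T}" for t x v
    proof -
      have "(f (t, t) has_derivative (\<lambda>v. 0)) (at x)"
        using has_derivative_const[of 0 "at x"] ext[of "f (t, t)" "\<lambda>x. 0", OF Suc.prems(2)[OF t]] by simp
      then have "f' (t, t) x = (\<lambda>v. 0)"
        using f'(1)[of "(t, t)" x] t by (intro has_derivative_unique) auto
      then show ?thesis by simp
    qed
    from base[OF diff_family_base[OF Suc.prems(1)] Suc.prems(2)] obtain B0 where B0: "0 \<le> B0"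
      "\<And>t t0 x. t \<in> {0..T} \<Longrightarrow> t0 \<in> {0..T} \<Longrightarrow> x \<in> U \<Longrightarrow> norm (f (t, t0) x) \<le> B0 * \<bar>t - t0\<bar>"
      by blast
    obtain B where B: "\<And>v. 0 \<le> B v" "\<And>v t t0. t \<in> {0..T} \<Longrightarrow> t0 \<in> {0..T} \<Longrightarrow>
        Cn_bound n U (\<lambda>x. f' (t, t0) x v) (B v * \<bar>t - t0\<bar>)"
      using Suc.IH[OF f'(2) 0] by metis
    define C where "C = B0 + (\<Sum>b\<in>Basis. B b)"
    have "Cn_bound (Suc n) U (f (t, t0)) (C * \<bar>t - t0\<bar>)" if t: "t \<in> {0..T}" "t0 \<in> {0..T}" for t t0
    proof -
      have p: "(t, t0) \<in> ?P" using t by simp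
      show ?thesis
      proof (rule Cn_bound_SucI[OF _ f'(1)[OF p]])
        show "norm (f (t, t0) x) \<le> C * \<bar>t - t0\<bar>" if "x \<in> U" for x
        proof -
          have "norm (f (t, t0) x) \<le> B0 * \<bar>t - t0\<bar>" using B0(2)[OF t that] .
          also have "\<dots> \<le> C * \<bar>t - t0\<bar>"
            using B(1) by (intro mult_right_mono) (auto simp: C_def sum_nonneg)
          finally show ?thesis .
        qed
        show "Cn_bound n U (\<lambda>x. f' (t, t0) x v) (C * \<bar>t - t0\<bar>)" if "norm v \<le> 1" for v
        proof (rule Cn_bound_mono)
          show "Cn_bound n U (\<lambda>x. f' (t, t0) x v) (\<Sum>b\<in>Basis. B b * \<bar>t - t0\<bar>)"
            by (intro Cn_bound_of_linear_family that B t has_derivative_linear[OF f'(1)[OF p]])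
               (simp add: B)
          show "(\<Sum>b\<in>Basis. B b * \<bar>t - t0\<bar>) \<le> C * \<bar>t - t0\<bar>"
            using B0(1) by (simp add: C_def sum_distrib_right[symmetric] mult_right_mono)
        qed
      qed
    qed
    moreover have "0 \<le> C" using B0 B by (simp add: C_def sum_nonneg)
    ultimately show ?case by blast
  }
qed

lemma jointly_continuous_lin_comb:
  assumes "jointly_continuous P u" "\<And>b. b \<in> Basis \<Longrightarrow> jointly_continuous P (a b)"
  shows "jointly_continuous P (\<lambda>p x. lin_comb (\<lambda>b. a b p x) (u p x))"
proof -
  have "continuous_on (P \<times> UNIV) (\<lambda>z. u (fst z) (snd z))"
    "\<And>b. b \<in> Basis \<Longrightarrow> continuous_on (P \<times> UNIV) (\<lambda>z. a b (fst z) (snd z))"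
    using assms by (simp_all add: jointly_continuous_def case_prod_unfold)
  then show ?thesis unfolding jointly_continuous_def case_prod_unfold
    by (auto intro!: continuous_intros)
qed

text \<open>Two solutions for nearby initial times and parameters are compared along the whole time interval by Gronwall's
inequality. Their difference satisfies the equation of the first one, with the change of the right-hand side along
the second one as inhomogeneity. At the initial time \<open>t0\<close> of the first they differ only by how far the
second has moved between the two initial times, as both start from \<open>c\<close>.\<close>

lemma linear_ode_jointly_continuous:
  fixes u :: "real \<times> real \<Rightarrow> 'a::euclidean_space \<Rightarrow> 'b::euclidean_space"
  assumes a: "\<And>b. b \<in> Basis \<Longrightarrow> jointly_continuous (time_square T) (a b)"
    and \<beta>: "jointly_continuous (time_square T) \<beta>"
    and u: "\<And>t t0 x. t \<in> {0..T} \<Longrightarrow> t0 \<in> {0..T} \<Longrightarrow>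
      ((\<lambda>s. u (s, t0) x) has_vector_derivative lin_comb (\<lambda>b. a b (t, t0) x) (u (t, t0) x) + \<beta> (t, t0) x)
        (at t within {0..T})"
    and u0: "\<And>t0 x. t0 \<in> {0..T} \<Longrightarrow> u (t0, t0) x = c"
  shows "jointly_continuous (time_square T) u"
proof -
  let ?P = "time_square T"
  note cpt = compact_Times[OF compact_Icc compact_Icc]
  have "\<exists>d>0. \<forall>p\<in>?P. \<forall>x. dist (p, x) (ps, xs) < d \<longrightarrow> norm (u p x - u ps xs) < e"
    if ps: "ps \<in> ?P" and e: "0 < e" for ps xs e
  proof -
    obtain ts t0s where pst: "ps = (ts, t0s)" by force
    with ps have ts: "ts \<in> {0..T}" "t0s \<in> {0..T}" by auto
    then have T: "0 \<le> T" by auto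
    let ?U = "cball xs 1"
    have "\<exists>L\<ge>0. \<forall>p\<in>?P. \<forall>x\<in>?U. norm (a b p x) \<le> L" if "b \<in> Basis" for b
      by (rule jointly_continuous_bounded[OF a[OF that] cpt compact_cball[of xs 1]]) auto
    then obtain La where La: "\<And>b p x. b \<in> Basis \<Longrightarrow> p \<in> ?P \<Longrightarrow> x \<in> ?U \<Longrightarrow> norm (a b p x) \<le> La b"
      "\<And>b. b \<in> Basis \<Longrightarrow> 0 \<le> La b" by metis
    define L where "L = (\<Sum>b\<in>Basis. La b)"
    have L: "0 \<le> L" using La by (simp add: L_def sum_nonneg)
    have lin: "norm (lin_comb (\<lambda>b. a b p x) y) \<le> L * norm y" if "p \<in> ?P" "x \<in> ?U" for p x y
      using La(1) that by (auto simp: L_def intro!: order_trans[OF norm_lin_comb_le] mult_right_mono sum_mono)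
    obtain B\<beta> where B\<beta>: "0 \<le> B\<beta>" "\<And>p x. p \<in> ?P \<Longrightarrow> x \<in> ?U \<Longrightarrow> norm (\<beta> p x) \<le> B\<beta>"
      by (rule jointly_continuous_bounded[OF \<beta> cpt compact_cball[of xs 1]]) auto
    let ?G = "gronwall_factor L T"
    have G: "1 \<le> ?G" by (rule gronwall_factor_ge_1[OF L T])
    define B where "B = (norm c + B\<beta>) * ?G"
    have uB: "norm (u (t, t0) x) \<le> B" if "t \<in> {0..T}" "t0 \<in> {0..T}" "x \<in> ?U" for t t0 x
    proof -
      have "norm (u (t, t0) x) \<le> (norm (u (t0, t0) x) + B\<beta>) * ?G"
      proof (rule gronwall_norm[of 0 T _ _ L B\<beta> t0 t T])
        fix t assume t: "t \<in> {0..T}"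
        show "((\<lambda>s. u (s, t0) x) has_vector_derivative lin_comb (\<lambda>b. a b (t, t0) x) (u (t, t0) x) + \<beta> (t, t0) x)
          (at t within {0..T})" by (rule u[OF t that(2)])
        show "norm (lin_comb (\<lambda>b. a b (t, t0) x) (u (t, t0) x) + \<beta> (t, t0) x) \<le> L * norm (u (t, t0) x) + B\<beta>"
          using t that by (intro norm_triangle_mono lin B\<beta>) auto
      qed (use that L B\<beta> in auto)
      then show ?thesis by (simp add: u0[OF that(2)] B_def)
    qed
    have B: "0 \<le> B" using G B\<beta> by (simp add: B_def)
    define M where "M = L * B + B\<beta>"
    have M: "0 \<le> M" using L B B\<beta> by (simp add: M_def)
    have lip: "norm (u (t, t0) x - u (t', t0) x) \<le> M * \<bar>t - t'\<bar>"
      if t: "t \<in> {0..T}" "t' \<in> {0..T}" and t0: "t0 \<in> {0..T}" and x: "x \<in> ?U" for t t' t0 x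
    proof -
      have "norm (u (t, t0) x - u (t', t0) x) \<le> M * norm (t - t')"
      proof (rule differentiable_bound[where S = "{0..T}" and f = "\<lambda>s. u (s, t0) x" and
            f' = "\<lambda>s h. h *\<^sub>R (lin_comb (\<lambda>b. a b (s, t0) x) (u (s, t0) x) + \<beta> (s, t0) x)"])
        fix s assume s: "s \<in> {0..T}"
        show "((\<lambda>s. u (s, t0) x) has_derivative
            (\<lambda>h. h *\<^sub>R (lin_comb (\<lambda>b. a b (s, t0) x) (u (s, t0) x) + \<beta> (s, t0) x))) (at s within {0..T})"
          using u[OF s t0] by (simp add: has_vector_derivative_def)
        have "norm (lin_comb (\<lambda>b. a b (s, t0) x) (u (s, t0) x) + \<beta> (s, t0) x) \<le> L * norm (u (s, t0) x) + B\<beta>"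
          using s t0 x by (intro norm_triangle_mono lin B\<beta>) auto
        also have "\<dots> \<le> M" using uB[OF s t0 x] L by (simp add: M_def mult_left_mono)
        finally show "onorm (\<lambda>h. h *\<^sub>R (lin_comb (\<lambda>b. a b (s, t0) x) (u (s, t0) x) + \<beta> (s, t0) x)) \<le> M"
          by (intro onorm_le) (simp add: mult.commute[of M] mult_left_mono)
      qed (use t in auto)
      then show ?thesis by simp
    qed
    \<comment> \<open>The right-hand side evaluated along the fixed reference solution, as a function of the varying parameters.\<close>
    define \<zeta> where "\<zeta> p x = lin_comb (\<lambda>b. a b p x) (u (fst p, t0s) xs) + \<beta> p x" for p x
    have "continuous_on {0..T} (\<lambda>s. u (s, t0s) xs)"
      using u[OF _ ts(2), of _ xs] by (intro continuous_on_vector_derivative) blast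
    then have "continuous_on (?P \<times> (UNIV :: 'a set)) (\<lambda>z. u (fst (fst z), t0s) xs)"
      by (rule continuous_on_compose2) (auto intro!: continuous_intros)
    then have "jointly_continuous ?P (\<lambda>p (x::'a). u (fst p, t0s) xs)"
      by (simp add: jointly_continuous_def case_prod_unfold)
    then have \<zeta>: "jointly_continuous ?P \<zeta>"
      unfolding \<zeta>_def by (intro jointly_continuous_add jointly_continuous_lin_comb a \<beta>)
    \<comment> \<open>Initial deviation and inhomogeneity contribute \<open>2 \<eta>\<close> times the Gronwall factor, i.e. \<open>e / 2\<close>.\<close>
    define \<eta> where "\<eta> = e / (4 * ?G)"
    have \<eta>: "0 < \<eta>" using e G by (simp add: \<eta>_def)
    obtain d1 where d1: "0 < d1"
      "\<And>p p' x x'. p \<in> ?P \<Longrightarrow> p' \<in> ?P \<Longrightarrow> x \<in> ?U \<Longrightarrow> x' \<in> ?U \<Longrightarrow> dist p p' < d1 \<Longrightarrow> dist x x' < d1 \<Longrightarrow>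
         norm (\<zeta> p x - \<zeta> p' x') < \<eta>"
      using jointly_continuous_uniformly[OF \<zeta> cpt compact_cball \<eta>] by metis
    define d where "d = min (min 1 d1) (\<eta> / (M + 1))"
    have d: "0 < d" "d \<le> 1" "d \<le> d1" "d * (M + 1) \<le> \<eta>"
    proof -
      have "d \<le> \<eta> / (M + 1)" by (simp add: d_def)
      then show "d * (M + 1) \<le> \<eta>" using M by (simp add: pos_le_divide_eq)
    qed (use d1(1) \<eta> M in \<open>auto simp: d_def\<close>)
    have "norm (u p x - u ps xs) < e" if p: "p \<in> ?P" and near: "dist (p, x) (ps, xs) < d" for p x
    proof -
      obtain t t0 where pt: "p = (t, t0)" by force
      with p have t: "t \<in> {0..T}" "t0 \<in> {0..T}" by auto
      have dx: "dist x xs < d" using near dist_snd_le[of "(p, x)" "(ps, xs)"] by simp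
      have dp: "dist p ps < d" using near dist_fst_le[of "(p, x)" "(ps, xs)"] by simp
      have dt: "\<bar>t - ts\<bar> < d" using dp dist_fst_le[of p ps] by (simp add: pt pst dist_real_def)
      have dt0: "\<bar>t0 - t0s\<bar> < d" using dp dist_snd_le[of p ps] by (simp add: pt pst dist_real_def)
      have x: "x \<in> ?U" using dx d by (simp add: dist_commute)
      have Md: "M * \<bar>s\<bar> \<le> \<eta>" if "\<bar>s\<bar> < d" for s
      proof -
        have "M * \<bar>s\<bar> \<le> (M + 1) * d" using that M by (intro mult_mono) auto
        with d(4) show ?thesis by (simp add: mult.commute)
      qed
      have "norm (u (t, t0) x - u (t, t0s) xs) \<le> (norm (u (t0, t0) x - u (t0, t0s) xs) + \<eta>) * ?G"
      proof (rule gronwall_norm[of 0 T _ _ L \<eta> t0 t T])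
        fix s assume s: "s \<in> {0..T}"
        show "((\<lambda>s. u (s, t0) x - u (s, t0s) xs) has_vector_derivative
            (lin_comb (\<lambda>b. a b (s, t0) x) (u (s, t0) x) + \<beta> (s, t0) x
              - (lin_comb (\<lambda>b. a b (s, t0s) xs) (u (s, t0s) xs) + \<beta> (s, t0s) xs))) (at s within {0..T})"
          by (intro has_vector_derivative_diff u s t ts)
        have "lin_comb (\<lambda>b. a b (s, t0) x) (u (s, t0) x) + \<beta> (s, t0) x
              - (lin_comb (\<lambda>b. a b (s, t0s) xs) (u (s, t0s) xs) + \<beta> (s, t0s) xs)
            = lin_comb (\<lambda>b. a b (s, t0) x) (u (s, t0) x - u (s, t0s) xs) + (\<zeta> (s, t0) x - \<zeta> (s, t0s) xs)"
          by (simp add: \<zeta>_def linear_diff[OF linear_lin_comb])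
        also have "norm \<dots> \<le> L * norm (u (s, t0) x - u (s, t0s) xs) + \<eta>"
        proof (intro norm_triangle_mono lin less_imp_le[OF d1(2)])
          show "dist (s, t0) (s, t0s) < d1" using dt0 d(3) by (simp add: dist_Pair_Pair dist_real_def)
        qed (use s t ts x dx d in auto)
        finally show "norm (lin_comb (\<lambda>b. a b (s, t0) x) (u (s, t0) x) + \<beta> (s, t0) x
              - (lin_comb (\<lambda>b. a b (s, t0s) xs) (u (s, t0s) xs) + \<beta> (s, t0s) xs))
            \<le> L * norm (u (s, t0) x - u (s, t0s) xs) + \<eta>" .
      qed (use L \<eta> t in auto)
      also have "\<dots> \<le> (\<eta> + \<eta>) * ?G"
      proof (intro mult_right_mono add_right_mono)
        have "norm (u (t0, t0) x - u (t0, t0s) xs) = norm (u (t0, t0s) xs - u (t0s, t0s) xs)"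
          using u0[OF t(2)] u0[OF ts(2)] by (simp add: norm_minus_commute)
        also have "\<dots> \<le> M * \<bar>t0 - t0s\<bar>" by (intro lip) (use t ts in auto)
        also have "\<dots> \<le> \<eta>" by (rule Md[OF dt0])
        finally show "norm (u (t0, t0) x - u (t0, t0s) xs) \<le> \<eta>" .
      qed (use G in auto)
      also have "\<dots> = e / 2" using G by (simp add: \<eta>_def field_simps)
      finally have 1: "norm (u (t, t0) x - u (t, t0s) xs) \<le> e / 2" .
      have "norm (u (t, t0s) xs - u (ts, t0s) xs) \<le> M * \<bar>t - ts\<bar>" by (intro lip) (use t ts in auto)
      also have "\<dots> \<le> \<eta>" by (rule Md[OF dt])
      also have "\<dots> \<le> e / 4" unfolding \<eta>_def using e G by (intro divide_left_mono) auto
      finally have 2: "norm (u (t, t0s) xs - u (ts, t0s) xs) \<le> e / 4" .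
      have "norm (u p x - u ps xs) \<le> e / 2 + e / 4"
        unfolding pt pst using norm_triangle_mono[OF 1 2] by simp
      with e show ?thesis by linarith
    qed
    with d(1) show ?thesis by blast
  qed
  then show ?thesis
    unfolding jointly_continuous_def continuous_on_iff by (simp add: dist_norm) 
qed

section \<open>Smooth dependence of linear equations on a parameter\<close>

lemma difference_quotient_uniform_limit:
  fixes f :: "'p::metric_space \<Rightarrow> 'a::euclidean_space \<Rightarrow> 'b::real_normed_vector"
  assumes f': "\<And>p x. p \<in> P \<Longrightarrow> (f p has_derivative f' p x) (at x)"
    "\<And>v. jointly_continuous P (\<lambda>p x. f' p x v)"
    and P: "compact P"
  shows "uniform_limit P (\<lambda>s p. (f p (x + s *\<^sub>R v) - f p x) /\<^sub>R s) (\<lambda>p. f' p x v) (at 0)"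
proof (rule uniform_limitI)
  fix e :: real assume e: "0 < e"
  define e' where "e' = e / (norm v + 1)"
  have nv: "0 < norm v + 1" by (simp add: add_nonneg_pos)
  have e': "0 < e'" "e' * norm v < e"
    using e nv by (auto simp: e'_def field_simps)
  obtain d where d: "0 < d" "\<And>p z y. p \<in> P \<Longrightarrow> norm z \<le> norm x \<Longrightarrow> norm (y - z) < d \<Longrightarrow>
       norm (f p y - f p z - f' p z (y - z)) \<le> e' * norm (y - z)"
    using Cn_family_uniform_linearization[of P f f' e' "norm x", OF f' P e'(1)] by metis
  have "dist ((f p (x + s *\<^sub>R v) - f p x) /\<^sub>R s) (f' p x v) < e"
    if s: "s \<noteq> 0" "dist s 0 < d / (norm v + 1)" and p: "p \<in> P" for s p
  proof -
    have lin: "linear (f' p x)" using has_derivative_linear[OF f'(1)[OF p]] .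
    have "\<bar>s\<bar> * norm v \<le> \<bar>s\<bar> * (norm v + 1)" by (intro mult_left_mono) auto
    also have "\<dots> < d" using s nv by (simp add: dist_real_def field_simps)
    finally have "norm (f p (x + s *\<^sub>R v) - f p x - f' p x (s *\<^sub>R v)) \<le> e' * (\<bar>s\<bar> * norm v)"
      using d(2)[OF p, of x "x + s *\<^sub>R v"] by simp
    then have *: "\<bar>inverse s\<bar> * norm (f p (x + s *\<^sub>R v) - f p x - f' p x (s *\<^sub>R v)) \<le> \<bar>inverse s\<bar> * (e' * (\<bar>s\<bar> * norm v))"
      by (rule mult_left_mono) simp
    have "(f p (x + s *\<^sub>R v) - f p x) /\<^sub>R s - f' p x v = inverse s *\<^sub>R (f p (x + s *\<^sub>R v) - f p x - f' p x (s *\<^sub>R v))"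
      using s by (simp add: linear_scale[OF lin] scaleR_diff_right)
    then have "norm ((f p (x + s *\<^sub>R v) - f p x) /\<^sub>R s - f' p x v) \<le> e' * norm v"
      using * s by (simp add: mult.assoc[symmetric] mult.commute[of _ "\<bar>s\<bar>"])
    then show ?thesis using e'(2) by (simp add: dist_norm)
  qed
  then show "\<forall>\<^sub>F s in at 0. \<forall>p\<in>P. dist ((f p (x + s *\<^sub>R v) - f p x) /\<^sub>R s) (f' p x v) < e"
    unfolding eventually_at using d(1) nv by (intro exI[of _ "d / (norm v + 1)"]) auto
qed

lemma translation_uniform_limit:
  fixes u :: "'p::metric_space \<Rightarrow> 'a::euclidean_space \<Rightarrow> 'b::real_normed_vector"
  assumes u: "jointly_continuous P u" and P: "compact P"
  shows "uniform_limit P (\<lambda>s p. u p (x + s *\<^sub>R v)) (\<lambda>p. u p x) (at 0)"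
proof (rule uniform_limitI)
  fix e :: real assume e: "0 < e"
  obtain d where d: "0 < d" "\<And>p p' y y'. p \<in> P \<Longrightarrow> p' \<in> P \<Longrightarrow> y \<in> cball x 1 \<Longrightarrow> y' \<in> cball x 1 \<Longrightarrow>
      dist p p' < d \<Longrightarrow> dist y y' < d \<Longrightarrow> norm (u p y - u p' y') < e"
    using jointly_continuous_uniformly[OF u P compact_cball e] by metis
  have nv: "0 < norm v + 1" by (simp add: add_nonneg_pos)
  define d' where "d' = min d 1 / (norm v + 1)"
  have "dist (u p (x + s *\<^sub>R v)) (u p x) < e" if s: "dist s 0 < d'" and p: "p \<in> P" for s p
  proof -
    have "\<bar>s\<bar> * norm v \<le> \<bar>s\<bar> * (norm v + 1)" by (intro mult_left_mono) auto
    also have "\<dots> < min d 1" using s nv by (simp add: d'_def dist_real_def field_simps)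
    finally have "norm (s *\<^sub>R v) < min d 1" by simp
    then have "norm (u p (x + s *\<^sub>R v) - u p x) < e"
      using d by (intro d(2) p) (auto simp: dist_norm)
    then show ?thesis by (simp add: dist_norm)
  qed
  moreover have "0 < d'" using d(1) nv by (simp add: d'_def)
  ultimately show "\<forall>\<^sub>F s in at 0. \<forall>p\<in>P. dist (u p (x + s *\<^sub>R v)) (u p x) < e"
    unfolding eventually_at by (intro exI[of _ d']) auto
qed

lemma uniform_limit_sum:
  fixes f :: "'i \<Rightarrow> 's \<Rightarrow> 'p \<Rightarrow> 'b::real_normed_vector"
  assumes "finite I" "\<And>i. i \<in> I \<Longrightarrow> uniform_limit X (f i) (l i) F"
  shows "uniform_limit X (\<lambda>s p. \<Sum>i\<in>I. f i s p) (\<lambda>p. \<Sum>i\<in>I. l i p) F"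
  using assms
proof (induction I)
  case empty
  show ?case by (simp add: uniform_limit_const)
next
  case (insert i I)
  then show ?case by (simp add: uniform_limit_add)
qed

lemma jointly_continuous_bounded_slice:
  assumes "jointly_continuous P f" "compact P"
  shows "bounded ((\<lambda>p. f p x) ` P)"
  by (rule jointly_continuous_bounded[OF assms compact_insert[OF compact_empty, of x]])
     (auto simp: bounded_iff)

text \<open>The difference quotient of a solution in direction \<open>v\<close> solves the equation with the unshifted coefficients and an
inhomogeneity built from the difference quotients of the coefficients, which converge uniformly in time.\<close>

lemma linear_ode_difference_quotient_limit:
  fixes u :: "real \<times> real \<Rightarrow> 'a::euclidean_space \<Rightarrow> 'b::euclidean_space"
  assumes a: "\<And>b. b \<in> Basis \<Longrightarrow> jointly_continuous (time_square T) (a b)"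
    and a': "\<And>b p x. b \<in> Basis \<Longrightarrow> p \<in> time_square T \<Longrightarrow> (a b p has_derivative a' b p x) (at x)"
      "\<And>b v. b \<in> Basis \<Longrightarrow> jointly_continuous (time_square T) (\<lambda>p x. a' b p x v)"
    and \<beta>': "\<And>p x. p \<in> time_square T \<Longrightarrow> (\<beta> p has_derivative \<beta>' p x) (at x)"
      "\<And>v. jointly_continuous (time_square T) (\<lambda>p x. \<beta>' p x v)"
    and uc: "jointly_continuous (time_square T) u"
    and u: "\<And>t t0 x. t \<in> {0..T} \<Longrightarrow> t0 \<in> {0..T} \<Longrightarrow>
      ((\<lambda>s. u (s, t0) x) has_vector_derivative lin_comb (\<lambda>b. a b (t, t0) x) (u (t, t0) x) + \<beta> (t, t0) x)
        (at t within {0..T})"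
    and u0: "\<And>t0 x. t0 \<in> {0..T} \<Longrightarrow> u (t0, t0) x = c"
    and t0: "t0 \<in> {0..T}"
  shows "\<exists>w. w t0 = 0 \<and>
    (\<forall>t\<in>{0..T}. (w has_vector_derivative
        lin_comb (\<lambda>b. a b (t, t0) x) (w t) +
        (lin_comb (\<lambda>b. a' b (t, t0) x v) (u (t, t0) x) + \<beta>' (t, t0) x v)) (at t within {0..T})) \<and>
    (\<forall>t\<in>{0..T}. ((\<lambda>s. (u (t, t0) (x + s *\<^sub>R v) - u (t, t0) x) /\<^sub>R s) \<longlongrightarrow> w t) (at 0))"
proof -
  let ?P = "time_square T"
  have cpt: "compact ?P" by (intro compact_Times compact_Icc)
  have "\<exists>L\<ge>0. \<forall>p\<in>?P. norm (a b p x) \<le> L" if "b \<in> Basis" for b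
    by (rule jointly_continuous_bounded[OF a[OF that] cpt compact_insert[OF compact_empty, of x]]) auto
  then obtain La where La: "\<And>b p. b \<in> Basis \<Longrightarrow> p \<in> ?P \<Longrightarrow> norm (a b p x) \<le> La b"
    "\<And>b. b \<in> Basis \<Longrightarrow> 0 \<le> La b" by metis
  define L where "L = (\<Sum>b\<in>Basis. La b)"
  have L: "0 \<le> L" using La by (simp add: L_def sum_nonneg)
  define q where "q s t = (u (t, t0) (x + s *\<^sub>R v) - u (t, t0) x) /\<^sub>R s" for s t
  define \<gamma> where "\<gamma> s p = (\<Sum>b\<in>Basis. (u p (x + s *\<^sub>R v) \<bullet> b) *\<^sub>R ((a b p (x + s *\<^sub>R v) - a b p x) /\<^sub>R s))
      + (\<beta> p (x + s *\<^sub>R v) - \<beta> p x) /\<^sub>R s" for s p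
  define \<gamma>0 where "\<gamma>0 p = lin_comb (\<lambda>b. a' b p x v) (u p x) + \<beta>' p x v" for p
  have "uniform_limit ?P \<gamma> \<gamma>0 (at 0)"
    unfolding \<gamma>_def \<gamma>0_def
  proof (intro uniform_limit_add uniform_limit_sum finite_Basis)
    show "uniform_limit ?P (\<lambda>s p. (\<beta> p (x + s *\<^sub>R v) - \<beta> p x) /\<^sub>R s) (\<lambda>p. \<beta>' p x v) (at 0)"
      by (rule difference_quotient_uniform_limit[OF \<beta>' cpt])
    fix b :: 'b assume b: "b \<in> Basis"
    show "uniform_limit ?P (\<lambda>s p. (u p (x + s *\<^sub>R v) \<bullet> b) *\<^sub>R ((a b p (x + s *\<^sub>R v) - a b p x) /\<^sub>R s))
        (\<lambda>p. (u p x \<bullet> b) *\<^sub>R a' b p x v) (at 0)"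
    proof (rule bounded_bilinear.bounded_uniform_limit[OF bounded_bilinear_scaleR])
      show "uniform_limit ?P (\<lambda>s p. u p (x + s *\<^sub>R v) \<bullet> b) (\<lambda>p. u p x \<bullet> b) (at 0)"
        by (rule bounded_linear.uniform_limit[OF bounded_linear_inner_left translation_uniform_limit[OF uc cpt]])
      show "uniform_limit ?P (\<lambda>s p. (a b p (x + s *\<^sub>R v) - a b p x) /\<^sub>R s) (\<lambda>p. a' b p x v) (at 0)"
        by (rule difference_quotient_uniform_limit[OF a'[OF b] cpt])
      show "bounded ((\<lambda>p. a' b p x v) ` ?P)"
        by (rule jointly_continuous_bounded_slice[OF a'(2)[OF b] cpt])
      show "bounded ((\<lambda>p. u p x \<bullet> b) ` ?P)"
        using bounded_linear_image[OF jointly_continuous_bounded_slice[OF uc cpt, of x] bounded_linear_inner_left[of b]]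
        by (simp add: image_image)
    qed
  qed
  then have \<gamma>: "uniform_limit {0..T} (\<lambda>s t. \<gamma> s (t, t0)) (\<lambda>t. \<gamma>0 (t, t0)) (at 0)"
    by (rule uniform_limit_compose') (use t0 in auto)
  have q: "(q s has_vector_derivative lin_comb (\<lambda>b. a b (t, t0) x) (q s t) + \<gamma> s (t, t0)) (at t within {0..T})"
    if s: "s \<noteq> 0" and t: "t \<in> {0..T}" for s t
  proof -
    let ?x = "x + s *\<^sub>R v"
    have "(q s has_vector_derivative
        ((lin_comb (\<lambda>b. a b (t, t0) ?x) (u (t, t0) ?x) + \<beta> (t, t0) ?x)
          - (lin_comb (\<lambda>b. a b (t, t0) x) (u (t, t0) x) + \<beta> (t, t0) x)) /\<^sub>R s) (at t within {0..T})"
      unfolding q_def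
      by (rule bounded_linear.has_vector_derivative[OF bounded_linear_scaleR_right])
         (intro has_vector_derivative_diff u t t0)
    moreover have "((lin_comb (\<lambda>b. a b (t, t0) ?x) (u (t, t0) ?x) + \<beta> (t, t0) ?x)
          - (lin_comb (\<lambda>b. a b (t, t0) x) (u (t, t0) x) + \<beta> (t, t0) x)) /\<^sub>R s
        = lin_comb (\<lambda>b. a b (t, t0) x) (q s t) + \<gamma> s (t, t0)"
      by (simp add: q_def \<gamma>_def inner_diff_left algebra_simps sum.distrib sum_subtractf scaleR_sum_right)
    ultimately show ?thesis by simp
  qed
  have lin: "norm (lin_comb (\<lambda>b. a b (t, t0) x) y) \<le> L * norm y" if "t \<in> {0..T}" for t y
    using La(1) that t0
    by (auto simp: L_def intro!: order_trans[OF norm_lin_comb_le] mult_right_mono sum_mono)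
  have q0: "q s t0 = 0" for s by (simp add: q_def u0[OF t0])
  show ?thesis
    using linear_ode_limit[of T "\<lambda>t. lin_comb (\<lambda>b. a b (t, t0) x)",
        OF linear_lin_comb lin L t0 q q0 \<gamma>]
    by (simp add: q_def \<gamma>0_def)
qed

lemma linear_ode_C1_in_time:
  fixes u :: "real \<times> real \<Rightarrow> 'a::euclidean_space \<Rightarrow> 'b::euclidean_space"
  assumes a: "\<And>b. b \<in> Basis \<Longrightarrow> jointly_continuous (time_square T) (a b)"
    and \<beta>: "jointly_continuous (time_square T) \<beta>"
    and u: "\<And>t t0 x. t \<in> {0..T} \<Longrightarrow> t0 \<in> {0..T} \<Longrightarrow>
      ((\<lambda>s. u (s, t0) x) has_vector_derivative lin_comb (\<lambda>b. a b (t, t0) x) (u (t, t0) x) + \<beta> (t, t0) x)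
        (at t within {0..T})"
    and u0: "\<And>t0 x. t0 \<in> {0..T} \<Longrightarrow> u (t0, t0) x = c"
  shows "C1_in_time T u"
proof -
  have uc: "jointly_continuous (time_square T) u"
    by (rule linear_ode_jointly_continuous[OF assms])
  have "jointly_continuous (time_square T) (\<lambda>p x. lin_comb (\<lambda>b. a b p x) (u p x) + \<beta> p x)"
    by (intro jointly_continuous_add jointly_continuous_lin_comb uc a \<beta>)
  with uc u show ?thesis
    unfolding C1_in_time_def
    by (intro conjI exI[of _ "\<lambda>p x. lin_comb (\<lambda>b. a b p x) (u p x) + \<beta> p x"]) auto
qed

text \<open>One more order of differentiability is gained as soon as the directional derivatives exist pointwise and form,
for each fixed direction, a family of the lower order; their joint continuity then makes them Frechet derivatives.\<close>

lemma diff_family_Suc_of_directional: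
  fixes u :: "'p::topological_space \<Rightarrow> 'a::euclidean_space \<Rightarrow> 'b::real_normed_vector"
  assumes Q: "\<And>f. Q f \<Longrightarrow> jointly_continuous P f" and u: "Q u"
    and lim: "\<And>p x v. p \<in> P \<Longrightarrow> ((\<lambda>s. (u p (x + s *\<^sub>R v) - u p x) /\<^sub>R s) \<longlongrightarrow> W v p x) (at 0)"
    and W: "\<And>v. diff_family Q P n (W v)"
  shows "diff_family Q P (Suc n) u"
proof (rule diff_family_SucI[where f' = "\<lambda>p x v. W v p x"])
  show "Q u" by (rule u)
  show "diff_family Q P n (\<lambda>p x. W v p x)" for v using W .
  fix p x assume p: "p \<in> P"
  show "(u p has_derivative (\<lambda>v. W v p x)) (at x)"
  proof (rule has_derivative_of_directional)
    show "((\<lambda>s. (u p (x + s *\<^sub>R v) - u p x) /\<^sub>R s) \<longlongrightarrow> W v p x) (at 0)" for x v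
      by (rule lim[OF p])
    have "continuous_on UNIV (\<lambda>y. (\<lambda>(p, x). W b p x) (p, y))" for b
      using Q[OF diff_family_base[OF W[of b]]] unfolding jointly_continuous_def
      by (rule continuous_on_compose2) (use p in \<open>auto intro!: continuous_intros\<close>)
    then show "isCont (\<lambda>y. W b p y) x" for b
      by (simp add: continuous_on_eq_continuous_at)
  qed
qed

text \<open>The directional derivatives of \<open>u\<close> solve a linear equation with the same coefficients \<open>a\<close>, with initial value \<open>0\<close>
and with an inhomogeneity of one order less, which involves \<open>u\<close> itself. The induction hypothesis is applied
first to \<open>u\<close>, so that this inhomogeneity has the required smoothness, and then to the directional derivatives.\<close>

lemma linear_ode_family:
  fixes u :: "real \<times> real \<Rightarrow> 'a::euclidean_space \<Rightarrow> 'b::euclidean_space"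
  assumes a: "\<And>b. b \<in> Basis \<Longrightarrow> Cn_family n (time_square T) (a b)"
    and \<beta>: "Cn_family n (time_square T) \<beta>"
    and u: "\<And>t t0 x. t \<in> {0..T} \<Longrightarrow> t0 \<in> {0..T} \<Longrightarrow>
      ((\<lambda>s. u (s, t0) x) has_vector_derivative lin_comb (\<lambda>b. a b (t, t0) x) (u (t, t0) x) + \<beta> (t, t0) x)
        (at t within {0..T})"
    and u0: "\<And>t0 x. t0 \<in> {0..T} \<Longrightarrow> u (t0, t0) x = c"
  shows "diff_family (C1_in_time T) (time_square T) n u"
  using assms
proof (induction n arbitrary: u \<beta> c)
  case 0
  then show ?case using linear_ode_C1_in_time[of T a \<beta> u c] by simp
next
  case (Suc n)
  let ?P = "time_square T"
  note a = Suc.prems(1) and \<beta> = Suc.prems(2) and u = Suc.prems(3) and u0 = Suc.prems(4)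
  have IH: "diff_family (C1_in_time T) ?P n u"
    by (rule Suc.IH[OF diff_family_SucD[OF a] diff_family_SucD[OF \<beta>] u u0])
  have un: "Cn_family n ?P u"
    by (rule diff_family_weaken[OF IH]) (simp add: C1_in_time_def)
  have "\<exists>a'. (\<forall>p\<in>?P. \<forall>x. (a b p has_derivative a' p x) (at x)) \<and> (\<forall>v. Cn_family n ?P (\<lambda>p x. a' p x v))"
    if "b \<in> Basis" for b
    using a[OF that] by simp
  then obtain a' where a': "\<And>b p x. b \<in> Basis \<Longrightarrow> p \<in> ?P \<Longrightarrow> (a b p has_derivative a' b p x) (at x)"
    "\<And>b v. b \<in> Basis \<Longrightarrow> Cn_family n ?P (\<lambda>p x. a' b p x v)" by metis
  from \<beta> obtain \<beta>' where \<beta>': "\<And>p x. p \<in> ?P \<Longrightarrow> (\<beta> p has_derivative \<beta>' p x) (at x)"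
    "\<And>v. Cn_family n ?P (\<lambda>p x. \<beta>' p x v)"
    by (rule diff_family_SucE) blast
  define W where "W v p x = (SOME y. ((\<lambda>s. (u p (x + s *\<^sub>R v) - u p x) /\<^sub>R s) \<longlongrightarrow> y) (at 0))" for v p x
  have W: "W v (t0, t0) x = 0"
    "\<And>t. t \<in> {0..T} \<Longrightarrow> ((\<lambda>s. (u (t, t0) (x + s *\<^sub>R v) - u (t, t0) x) /\<^sub>R s) \<longlongrightarrow> W v (t, t0) x) (at 0)"
    "\<And>t. t \<in> {0..T} \<Longrightarrow> ((\<lambda>s. W v (s, t0) x) has_vector_derivative
        lin_comb (\<lambda>b. a b (t, t0) x) (W v (t, t0) x) +
        (lin_comb (\<lambda>b. a' b (t, t0) x v) (u (t, t0) x) + \<beta>' (t, t0) x v)) (at t within {0..T})"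
    if t0: "t0 \<in> {0..T}" for t0 x v
  proof -
    obtain w where w: "w t0 = 0"
      "\<And>t. t \<in> {0..T} \<Longrightarrow> (w has_vector_derivative
          lin_comb (\<lambda>b. a b (t, t0) x) (w t) +
          (lin_comb (\<lambda>b. a' b (t, t0) x v) (u (t, t0) x) + \<beta>' (t, t0) x v)) (at t within {0..T})"
      "\<And>t. t \<in> {0..T} \<Longrightarrow> ((\<lambda>s. (u (t, t0) (x + s *\<^sub>R v) - u (t, t0) x) /\<^sub>R s) \<longlongrightarrow> w t) (at 0)"
      using linear_ode_difference_quotient_limit[of T a a' \<beta> \<beta>' u c t0 x v,
            OF diff_family_base[OF a] a'(1) diff_family_base[OF a'(2)] \<beta>'(1) diff_family_base[OF \<beta>'(2)]
               diff_family_base[OF un] u u0 t0] by blast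
    have Ww: "W v (t, t0) x = w t" if "t \<in> {0..T}" for t
    proof -
      have "((\<lambda>s. (u (t, t0) (x + s *\<^sub>R v) - u (t, t0) x) /\<^sub>R s) \<longlongrightarrow> W v (t, t0) x) (at 0)"
        unfolding W_def by (rule someI[of _ "w t"]) (rule w(3)[OF that])
      with w(3)[OF that] show ?thesis by (intro tendsto_unique[of "at (0::real)"]) auto
    qed
    show "W v (t0, t0) x = 0" using Ww[OF t0] w(1) by simp
    show "((\<lambda>s. (u (t, t0) (x + s *\<^sub>R v) - u (t, t0) x) /\<^sub>R s) \<longlongrightarrow> W v (t, t0) x) (at 0)"
      if "t \<in> {0..T}" for t using w(3)[OF that] Ww[OF that] by simp
    show "((\<lambda>s. W v (s, t0) x) has_vector_derivative
        lin_comb (\<lambda>b. a b (t, t0) x) (W v (t, t0) x) +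
        (lin_comb (\<lambda>b. a' b (t, t0) x v) (u (t, t0) x) + \<beta>' (t, t0) x v)) (at t within {0..T})"
      if "t \<in> {0..T}" for t
      unfolding Ww[OF that]
      by (rule has_vector_derivative_transform[OF that _ w(2)[OF that]]) (simp add: Ww)
  qed
  have Wn: "diff_family (C1_in_time T) ?P n (W v)" for v
  proof (rule Suc.IH[OF diff_family_SucD[OF a] _ W(3) W(1)])
    show "Cn_family n ?P (\<lambda>p x. lin_comb (\<lambda>b. a' b p x v) (u p x) + \<beta>' p x v)"
      by (intro Cn_family_add Cn_family_sum Cn_family_scaleR Cn_family_linear[OF bounded_linear_inner_left]
           un a'(2) \<beta>'(2) finite_Basis)
  qed
  show ?case
  proof (rule diff_family_Suc_of_directional[OF _ diff_family_base[OF IH] _ Wn])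
    show "((\<lambda>s. (u p (x + s *\<^sub>R v) - u p x) /\<^sub>R s) \<longlongrightarrow> W v p x) (at 0)" if "p \<in> ?P" for p x v
      using W(2)[of "snd p" "fst p"] that by (auto simp: mem_Times_iff)
  qed (simp add: C1_in_time_def)
qed

section \<open>Smoothness of the flow\<close>

text \<open>A vector field that is only locally Lipschitz admits the Gronwall estimate as long as \<open>z\<close> stays within distance \<open>1\<close>
of \<open>y\<close>. If the distance were \<open>1\<close> somewhere, then up to the nearest such time, seen from \<open>t0\<close>, the estimate
would be valid and give a distance below \<open>1\<close>, a contradiction.\<close>

lemma solutions_stay_close:
  fixes y z :: "real \<Rightarrow> 'a::euclidean_space"
  assumes y: "\<And>t. t \<in> {0..T} \<Longrightarrow> (y has_vector_derivative g (y t) t) (at t within {0..T})"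
    and z: "\<And>t. t \<in> {0..T} \<Longrightarrow> (z has_vector_derivative g (z t) t) (at t within {0..T})"
    and lip: "\<And>t a b. t \<in> {0..T} \<Longrightarrow> norm a \<le> R + 1 \<Longrightarrow> norm b \<le> R + 1 \<Longrightarrow>
        norm (g a t - g b t) \<le> L * norm (a - b)"
    and L: "0 \<le> L" and yR: "\<And>t. t \<in> {0..T} \<Longrightarrow> norm (y t) \<le> R"
    and t0: "t0 \<in> {0..T}" and small: "norm (z t0 - y t0) * gronwall_factor L T < 1"
    and t: "t \<in> {0..T}"
  shows "norm (z t - y t) \<le> norm (z t0 - y t0) * gronwall_factor L T"
proof -
  let ?C = "gronwall_factor L T" and ?w = "\<lambda>t. norm (z t - y t)"
  have C: "1 \<le> ?C" using gronwall_factor_ge_1[OF L] t0 by auto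
  have w0: "?w t0 < 1" using small C mult_left_mono[OF C, of "?w t0"] by simp
  have close: "?w s \<le> ?w t0 * ?C"
    if ab: "0 \<le> a" "b \<le> T" "t0 \<in> {a..b}" and le1: "\<And>s. s \<in> {a..b} \<Longrightarrow> ?w s \<le> 1" and s: "s \<in> {a..b}" for a b s
  proof -
    have sub: "{a..b} \<subseteq> {0..T}" using ab by auto
    have "?w s \<le> (?w t0 + 0) * ?C"
    proof (rule gronwall_norm[of a b _ _ L 0 t0 s T])
      fix t assume t: "t \<in> {a..b}"
      then have t': "t \<in> {0..T}" using sub by auto
      show "((\<lambda>t. z t - y t) has_vector_derivative (g (z t) t - g (y t) t)) (at t within {a..b})"
        using y[OF t'] z[OF t'] sub by (intro has_vector_derivative_within_subset[OF has_vector_derivative_diff])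
      have "norm (z t) \<le> R + 1"
        using norm_triangle_ineq2[of "z t" "y t"] yR[OF t'] le1[OF t] by simp
      then show "norm (g (z t) t - g (y t) t) \<le> L * norm (z t - y t) + 0"
        using lip[OF t', of "z t" "y t"] yR[OF t'] by simp
    qed (use L ab s in auto)
    then show ?thesis by simp
  qed
  have cont: "continuous_on {0..T} ?w"
    using y z by (intro continuous_on_norm continuous_on_diff continuous_on_vector_derivative) auto
  have crossing: "\<exists>s'\<in>{0..T}. \<bar>s' - t0\<bar> \<le> \<bar>s - t0\<bar> \<and> ?w s' = 1" if s: "s \<in> {0..T}" "1 \<le> ?w s" for s
  proof (cases "t0 \<le> s")
    case True
    have "\<exists>s'. t0 \<le> s' \<and> s' \<le> s \<and> ?w s' = 1"
      by (rule IVT') (use True w0 s t0 in \<open>auto intro: continuous_on_subset[OF cont]\<close>)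
    then show ?thesis using s t0 by force
  next
    case False
    have "\<exists>s'. s \<le> s' \<and> s' \<le> t0 \<and> ?w s' = 1"
      by (rule IVT2') (use False w0 s t0 in \<open>auto intro: continuous_on_subset[OF cont]\<close>)
    then show ?thesis using s t0 by force
  qed
  let ?Z = "{s \<in> {0..T}. ?w s = 1}"
  have "?Z = {}"
  proof (rule ccontr)
    assume ne: "?Z \<noteq> {}"
    have "closed ?Z"
      using continuous_closed_preimage_constant[OF cont closed_atLeastAtMost, of 1] by simp
    moreover have "bounded ?Z"
      by (rule bounded_subset[OF bounded_closed_interval[of 0 T]]) auto
    ultimately have "compact ?Z"
      by (simp add: compact_eq_bounded_closed)
    moreover have "continuous_on ?Z (\<lambda>s. \<bar>s - t0\<bar>)" by (intro continuous_intros)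
    ultimately obtain s1 where s1: "s1 \<in> ?Z" "\<And>s. s \<in> ?Z \<Longrightarrow> \<bar>s1 - t0\<bar> \<le> \<bar>s - t0\<bar>"
      using continuous_attains_inf[of ?Z "\<lambda>s. \<bar>s - t0\<bar>"] ne by blast
    have "?w s1 \<le> ?w t0 * ?C"
    proof (rule close[of "min t0 s1" "max t0 s1"])
      fix s assume s: "s \<in> {min t0 s1..max t0 s1}"
      show "?w s \<le> 1"
      proof (rule ccontr)
        assume gt: "\<not> ?w s \<le> 1"
        have sI: "s \<in> {0..T}" using s s1(1) t0 by auto
        with gt crossing[of s] obtain s' where s': "s' \<in> ?Z" "\<bar>s' - t0\<bar> \<le> \<bar>s - t0\<bar>" by auto
        with s1(2)[of s'] have "\<bar>s1 - t0\<bar> \<le> \<bar>s - t0\<bar>" by auto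
        with s have "s = s1" by (auto simp: min_def max_def abs_if split: if_splits)
        with gt s1(1) show False by simp
      qed
    qed (use s1(1) t0 in auto)
    with s1(1) small show False by simp
  qed
  then have "?w s \<le> 1" if "s \<in> {0..T}" for s
    using crossing[OF that] by (cases "1 \<le> ?w s") auto
  then show ?thesis using close[of 0 T t] t0 t by auto
qed

text \<open>The order is shifted by one so that \<open>n\<close> is the order in which the method converges.\<close>

locale smooth_flow =
  fixes n :: nat and g :: "'a::euclidean_space \<Rightarrow> real \<Rightarrow> 'a" and T :: real and F :: "real \<Rightarrow> real \<Rightarrow> 'a \<Rightarrow> 'a"
  assumes flow: "is_flow g T F"
    and g: "Cn_family (Suc n) {0..T} (\<lambda>t x. g x t)"
begin

abbreviation "flow_map p x \<equiv> F (fst p) (snd p) x"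

lemma flow_init: "t0 \<in> {0..T} \<Longrightarrow> F t0 t0 x = x"
  using flow by (simp add: is_flow_def)

lemma flow_ode:
  "t0 \<in> {0..T} \<Longrightarrow> t \<in> {0..T} \<Longrightarrow>
    ((\<lambda>s. F s t0 x) has_vector_derivative g (F t t0 x) t) (at t within {0..T})"
  using flow by (simp add: is_flow_def)

lemma g_lipschitz:
  obtains L where "0 \<le> L" "\<And>t a b. t \<in> {0..T} \<Longrightarrow> norm a \<le> R \<Longrightarrow> norm b \<le> R \<Longrightarrow>
        norm (g a t - g b t) \<le> L * norm (a - b)"
proof -
  have "Cn_family (Suc 0) {0..T} (\<lambda>t x. g x t)" using g by (rule diff_family_le) simp
  from Cn_family_bounded[OF compact_Icc compact_cball this, of 0 R] obtain L where
    "0 \<le> L" "\<forall>t\<in>{0..T}. Cn_bound (Suc 0) (cball 0 R) (\<lambda>x. g x t) L" by blast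
  then show ?thesis
    by (intro that[of L] Cn_bound_lipschitz[OF convex_cball[of 0 R], of 0])
       (auto simp del: Cn_bound.simps)
qed

lemma flow_continuous_in_time: "t0 \<in> {0..T} \<Longrightarrow> continuous_on {0..T} (\<lambda>s. F s t0 x)"
  using flow_ode by (intro continuous_on_vector_derivative) auto

text \<open>The constant \<open>C\<close> serves all initial times \<open>s\<close> at once, which gives continuity in the initial time and
uniqueness of solutions.\<close>

lemma flow_stability:
  assumes t0: "t0 \<in> {0..T}"
  obtains C where "1 \<le> C" "\<And>t s x'. t \<in> {0..T} \<Longrightarrow> s \<in> {0..T} \<Longrightarrow> norm (x' - F s t0 x) * C < 1 \<Longrightarrow>
      norm (F t s x' - F t t0 x) \<le> norm (x' - F s t0 x) * C"
proof -
  have "bounded ((\<lambda>s. F s t0 x) ` {0..T})"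
    by (intro compact_imp_bounded compact_continuous_image flow_continuous_in_time t0 compact_Icc)
  then obtain R where R: "\<And>t. t \<in> {0..T} \<Longrightarrow> norm (F t t0 x) \<le> R"
    unfolding bounded_iff by blast
  obtain L where L: "0 \<le> L" "\<And>t a b. t \<in> {0..T} \<Longrightarrow> norm a \<le> R + 1 \<Longrightarrow> norm b \<le> R + 1 \<Longrightarrow>
        norm (g a t - g b t) \<le> L * norm (a - b)"
    using g_lipschitz by metis
  show ?thesis
  proof (rule that[of "gronwall_factor L T"])
    show "1 \<le> gronwall_factor L T" using gronwall_factor_ge_1[OF L(1)] t0 by auto
    fix t s x' assume t: "t \<in> {0..T}" and s: "s \<in> {0..T}"
      and small: "norm (x' - F s t0 x) * gronwall_factor L T < 1"
    show "norm (F t s x' - F t t0 x) \<le> norm (x' - F s t0 x) * gronwall_factor L T"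
      using solutions_stay_close[of T "\<lambda>t. F t t0 x" g "\<lambda>t. F t s x'" R L s t,
          OF flow_ode[OF t0] flow_ode[OF s] L(2,1) R s _ t] small
      by (simp add: flow_init[OF s])
  qed
qed

lemma flow_semigroup:
  assumes "t0 \<in> {0..T}" "s \<in> {0..T}" "t \<in> {0..T}"
  shows "F t s (F s t0 x) = F t t0 x"
proof -
  obtain C where "1 \<le> C" "\<And>t s x'. t \<in> {0..T} \<Longrightarrow> s \<in> {0..T} \<Longrightarrow> norm (x' - F s t0 x) * C < 1 \<Longrightarrow>
      norm (F t s x' - F t t0 x) \<le> norm (x' - F s t0 x) * C"
    using flow_stability[OF assms(1)] by metis
  from this(2)[OF assms(3,2), of "F s t0 x"] show ?thesis by simp
qed

lemma flow_jointly_continuous: "jointly_continuous (time_square T) flow_map"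
proof -
  have "\<exists>d>0. \<forall>p\<in>time_square T. \<forall>x. dist (p, x) (ps, xs) < d \<longrightarrow> norm (flow_map p x - flow_map ps xs) < e"
    if ps: "ps \<in> time_square T" and e: "0 < e" for ps xs e
  proof -
    obtain ts t0s where pst: "ps = (ts, t0s)" by force
    with ps have ts: "ts \<in> {0..T}" "t0s \<in> {0..T}" by auto
    obtain C where C: "1 \<le> C" "\<And>t s x'. t \<in> {0..T} \<Longrightarrow> s \<in> {0..T} \<Longrightarrow> norm (x' - F s t0s xs) * C < 1 \<Longrightarrow>
        norm (F t s x' - F t t0s xs) \<le> norm (x' - F s t0s xs) * C"
      using flow_stability[OF ts(2)] by metis
    \<comment> \<open>The initial deviation will be at most \<open>2 \<eta>\<close>; the minimum with \<open>1\<close> makes the stability estimate applicable.\<close>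
    define \<eta> where "\<eta> = min 1 e / (4 * C)"
    have \<eta>: "0 < \<eta>" "2 * \<eta> * C < 1" "2 * \<eta> * C \<le> e / 2" "\<eta> \<le> e / 4"
    proof -
      show "0 < \<eta>" using e C(1) by (simp add: \<eta>_def)
      have "2 * \<eta> * C = min 1 e / 2" using C(1) by (simp add: \<eta>_def)
      then show "2 * \<eta> * C < 1" "2 * \<eta> * C \<le> e / 2" using e by auto
      have "\<eta> * 1 \<le> \<eta> * C" using C(1) \<open>0 < \<eta>\<close> by (intro mult_left_mono) auto
      with \<open>2 * \<eta> * C \<le> e / 2\<close> show "\<eta> \<le> e / 4" by simp
    qed
    have "\<exists>d>0. \<forall>s\<in>{0..T}. dist s r < d \<longrightarrow> dist (F s t0s xs) (F r t0s xs) < \<eta>" if "r \<in> {0..T}" for r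
      using flow_continuous_in_time[OF ts(2), of xs] \<eta>(1) that unfolding continuous_on_iff by blast
    from this[OF ts(1)] this[OF ts(2)] obtain d1 d2 where
      d1: "0 < d1" "\<And>s. s \<in> {0..T} \<Longrightarrow> dist s ts < d1 \<Longrightarrow> dist (F s t0s xs) (F ts t0s xs) < \<eta>" and
      d2: "0 < d2" "\<And>s. s \<in> {0..T} \<Longrightarrow> dist s t0s < d2 \<Longrightarrow> dist (F s t0s xs) (F t0s t0s xs) < \<eta>"
      by blast
    define d where "d = min \<eta> (min d1 d2)"
    have "norm (flow_map p x - flow_map ps xs) < e"
      if p: "p \<in> time_square T" and near: "dist (p, x) (ps, xs) < d" for p x
    proof -
      obtain t t0 where pt: "p = (t, t0)" by force
      with p have t: "t \<in> {0..T}" "t0 \<in> {0..T}" by auto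
      have dx: "dist x xs < d" using near dist_snd_le[of "(p, x)" "(ps, xs)"] by simp
      have dp: "dist p ps < d" using near dist_fst_le[of "(p, x)" "(ps, xs)"] by simp
      have dt: "dist t ts < d" using dp dist_fst_le[of p ps] by (simp add: pt pst)
      have dt0: "dist t0 t0s < d" using dp dist_snd_le[of p ps] by (simp add: pt pst)
      have "dist x (F t0 t0s xs) \<le> dist x xs + dist (F t0 t0s xs) (F t0s t0s xs)"
        using dist_triangle2[of x "F t0 t0s xs" xs] by (simp add: flow_init[OF ts(2)])
      also have "\<dots> < 2 * \<eta>" using dx d2(2)[OF t(2)] dt0 by (simp add: d_def)
      finally have x: "norm (x - F t0 t0s xs) \<le> 2 * \<eta>" by (simp add: dist_norm)
      then have xC: "norm (x - F t0 t0s xs) * C \<le> 2 * \<eta> * C" using C(1) by (intro mult_right_mono) auto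
      have "norm (F t t0 x - F t t0s xs) \<le> norm (x - F t0 t0s xs) * C"
        using xC \<eta>(2) by (intro C(2) t) linarith
      also have "\<dots> \<le> e / 2" using xC \<eta>(3) by linarith
      finally have 1: "norm (F t t0 x - F t t0s xs) \<le> e / 2" .
      have 2: "norm (F t t0s xs - F ts t0s xs) \<le> e / 4"
        using d1(2)[OF t(1)] dt \<eta>(4) by (simp add: d_def dist_norm)
      have "norm (flow_map p x - flow_map ps xs) \<le> e / 2 + e / 4"
        unfolding pt pst using norm_triangle_mono[OF 1 2] by simp
      with e show ?thesis by linarith
    qed
    moreover have "0 < d" using \<eta> d1 d2 by (simp add: d_def)
    ultimately show ?thesis by blast
  qed
  then show ?thesis
    unfolding jointly_continuous_def continuous_on_iff by (simp add: dist_norm)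
qed

text \<open>The spatial difference quotients of the flow solve the variational equation up to the linearization error of \<open>g\<close>.
This error is small relative to the distance of the two trajectories, which is at most proportional to the
increment by stability.\<close>

lemma flow_difference_quotient_limit:
  assumes g': "\<And>t x. t \<in> {0..T} \<Longrightarrow> ((\<lambda>x. g x t) has_derivative g' t x) (at x)"
    "\<And>v. jointly_continuous {0..T} (\<lambda>t x. g' t x v)"
    and t0: "t0 \<in> {0..T}"
  shows "\<exists>w. w t0 = v \<and>
    (\<forall>t\<in>{0..T}. (w has_vector_derivative lin_comb (\<lambda>b. g' t (F t t0 x) b) (w t)) (at t within {0..T})) \<and>
    (\<forall>t\<in>{0..T}. ((\<lambda>s. (F t t0 (x + s *\<^sub>R v) - F t t0 x) /\<^sub>R s) \<longlongrightarrow> w t) (at 0))"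
proof -
  obtain C where C: "1 \<le> C" "\<And>t s x'. t \<in> {0..T} \<Longrightarrow> s \<in> {0..T} \<Longrightarrow> norm (x' - F s t0 x) * C < 1 \<Longrightarrow>
      norm (F t s x' - F t t0 x) \<le> norm (x' - F s t0 x) * C"
    using flow_stability[OF t0] by metis
  have "bounded ((\<lambda>s. F s t0 x) ` {0..T})"
    by (intro compact_imp_bounded compact_continuous_image flow_continuous_in_time t0 compact_Icc)
  then obtain R where R: "\<And>t. t \<in> {0..T} \<Longrightarrow> norm (F t t0 x) \<le> R"
    unfolding bounded_iff by blast
  have "\<exists>L\<ge>0. \<forall>t\<in>{0..T}. \<forall>x\<in>cball 0 R. norm (g' t x b) \<le> L" for b
    by (rule jointly_continuous_bounded[OF g'(2)[of b] compact_Icc compact_cball[of 0 R]]) auto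
  then obtain La where La: "\<And>b t x. t \<in> {0..T} \<Longrightarrow> norm x \<le> R \<Longrightarrow> norm (g' t x b) \<le> La b"
    "\<And>b. 0 \<le> La b" by (metis mem_cball_0)
  define L where "L = (\<Sum>b\<in>Basis. La b)"
  have L: "0 \<le> L" using La by (simp add: L_def sum_nonneg)
  define q where "q s t = (F t t0 (x + s *\<^sub>R v) - F t t0 x) /\<^sub>R s" for s t
  define \<gamma> where "\<gamma> s t = (g (F t t0 (x + s *\<^sub>R v)) t - g (F t t0 x) t
      - g' t (F t t0 x) (F t t0 (x + s *\<^sub>R v) - F t t0 x)) /\<^sub>R s" for s t
  have \<gamma>: "uniform_limit {0..T} \<gamma> (\<lambda>t. 0) (at 0)"
  proof (rule uniform_limitI)
    fix e :: real assume e: "0 < e"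
    \<comment> \<open>The trajectories separate by at most \<open>\<bar>s\<bar> (norm v * C)\<close>; adding \<open>1\<close> makes \<open>K\<close> positive.\<close>
    define K where "K = norm v * C + 1"
    have K: "1 \<le> K" using C(1) by (simp add: K_def)
    define e' where "e' = e / K"
    have e': "0 < e'" "e' * (norm v * C) < e" using e K by (auto simp: e'_def field_simps K_def)
    obtain d where d: "0 < d" "\<And>t z y. t \<in> {0..T} \<Longrightarrow> norm z \<le> R \<Longrightarrow> norm (y - z) < d \<Longrightarrow>
       norm (g y t - g z t - g' t z (y - z)) \<le> e' * norm (y - z)"
      using Cn_family_uniform_linearization[of "{0..T}" "\<lambda>t x. g x t" g' e' R, OF g' compact_Icc e'(1)] by metis
    have "dist (\<gamma> s t) 0 < e" if s: "s \<noteq> 0" "dist s 0 < min 1 d / K" and t: "t \<in> {0..T}" for s t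
    proof -
      have "\<bar>s\<bar> * (norm v * C) \<le> \<bar>s\<bar> * K" by (intro mult_left_mono) (auto simp: K_def)
      also have "\<dots> < min 1 d" using s K by (simp add: dist_real_def pos_less_divide_eq)
      finally have small: "\<bar>s\<bar> * (norm v * C) < min 1 d" .
      have "norm (F t t0 (x + s *\<^sub>R v) - F t t0 x) \<le> norm ((x + s *\<^sub>R v) - F t0 t0 x) * C"
        using small by (intro C(2) t t0) (simp add: flow_init[OF t0] mult.assoc)
      then have inc: "norm (F t t0 (x + s *\<^sub>R v) - F t t0 x) \<le> \<bar>s\<bar> * (norm v * C)"
        by (simp add: flow_init[OF t0] mult.assoc)
      with small have "norm (g (F t t0 (x + s *\<^sub>R v)) t - g (F t t0 x) t
          - g' t (F t t0 x) (F t t0 (x + s *\<^sub>R v) - F t t0 x)) \<le> e' * norm (F t t0 (x + s *\<^sub>R v) - F t t0 x)"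
        by (intro d(2) t R) linarith
      also have "\<dots> \<le> e' * (\<bar>s\<bar> * (norm v * C))" using inc e' by (intro mult_left_mono) auto
      finally have "inverse \<bar>s\<bar> * norm (g (F t t0 (x + s *\<^sub>R v)) t - g (F t t0 x) t
          - g' t (F t t0 x) (F t t0 (x + s *\<^sub>R v) - F t t0 x)) \<le> inverse \<bar>s\<bar> * (e' * (\<bar>s\<bar> * (norm v * C)))"
        by (rule mult_left_mono) simp
      also have "\<dots> = e' * (norm v * C)" using s(1) by simp
      finally have "norm (\<gamma> s t) \<le> e' * (norm v * C)" by (simp add: \<gamma>_def)
      with e'(2) show ?thesis by simp
    qed
    moreover have "0 < min 1 d / K" using d K by simp
    ultimately show "\<forall>\<^sub>F s in at 0. \<forall>t\<in>{0..T}. dist (\<gamma> s t) 0 < e"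
      unfolding eventually_at by (intro exI[of _ "min 1 d / K"]) auto
  qed
  have q: "(q s has_vector_derivative lin_comb (\<lambda>b. g' t (F t t0 x) b) (q s t) + \<gamma> s t) (at t within {0..T})"
    if s: "s \<noteq> 0" and t: "t \<in> {0..T}" for s t
  proof -
    have lin: "linear (g' t (F t t0 x))" using has_derivative_linear[OF g'(1)[OF t]] .
    have dq: "(q s has_vector_derivative (g (F t t0 (x + s *\<^sub>R v)) t - g (F t t0 x) t) /\<^sub>R s) (at t within {0..T})"
      unfolding q_def
      by (rule bounded_linear.has_vector_derivative[OF bounded_linear_scaleR_right])
         (intro has_vector_derivative_diff flow_ode t t0)
    have "lin_comb (\<lambda>b. g' t (F t t0 x) b) (q s t) = g' t (F t t0 x) (q s t)"
      by (rule linear_basis_expansion[OF lin, symmetric])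
    moreover have "g' t (F t t0 x) (q s t) = g' t (F t t0 x) (F t t0 (x + s *\<^sub>R v) - F t t0 x) /\<^sub>R s"
      unfolding q_def by (rule linear_scale[OF lin])
    ultimately have "lin_comb (\<lambda>b. g' t (F t t0 x) b) (q s t) + \<gamma> s t = (g (F t t0 (x + s *\<^sub>R v)) t - g (F t t0 x) t) /\<^sub>R s"
      by (simp add: \<gamma>_def scaleR_diff_right)
    with dq show ?thesis by simp
  qed
  have lin: "norm (lin_comb (\<lambda>b. g' t (F t t0 x) b) y) \<le> L * norm y" if "t \<in> {0..T}" for t y
    using La(1) R that
    by (auto simp: L_def intro!: order_trans[OF norm_lin_comb_le] mult_right_mono sum_mono)
  have q0: "q s t0 = v" if "s \<noteq> 0" for s using that by (simp add: q_def flow_init[OF t0])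
  show ?thesis
    using linear_ode_limit[of T "\<lambda>t. lin_comb (\<lambda>b. g' t (F t t0 x) b)", OF linear_lin_comb lin L t0 q q0 \<gamma>]
    by (simp add: q_def)
qed

text \<open>If the flow is smooth of order \<open>m\<close> then so are the coefficients of the variational equation, provided that \<open>D g\<close> is of
order \<open>m\<close>; then the solutions of this equation, which are the directional derivatives of the flow, are of order
\<open>m\<close> as well.\<close>

lemma flow_family: "m \<le> Suc n \<Longrightarrow> diff_family (C1_in_time T) (time_square T) m flow_map"
proof (induction m)
  let ?P = "time_square T"
  have fst: "continuous_on ?P fst" "fst ` ?P \<subseteq> {0..T}" by (auto intro!: continuous_intros)
  have C1: "C1_in_time T flow_map"
  proof -
    have "jointly_continuous ?P (\<lambda>p x. g (flow_map p x) (fst p))"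
      by (rule jointly_continuous_compose[OF jointly_continuous_reparam[OF diff_family_base[OF g] fst] flow_jointly_continuous])
    then show ?thesis
      unfolding C1_in_time_def using flow_jointly_continuous flow_ode
      by (intro conjI exI[of _ "\<lambda>p x. g (flow_map p x) (fst p)"]) auto
  qed
  {
    case 0
    show ?case using C1 by simp
  next
    case (Suc m)
    then have Fm: "diff_family (C1_in_time T) ?P m flow_map" by simp
    have Fm': "Cn_family m ?P flow_map"
      by (rule diff_family_weaken[OF Fm]) (simp add: C1_in_time_def)
    from g obtain g' where g': "\<And>t x. t \<in> {0..T} \<Longrightarrow> ((\<lambda>x. g x t) has_derivative g' t x) (at x)"
      "\<And>v. Cn_family n {0..T} (\<lambda>t x. g' t x v)"
      by (rule diff_family_SucE) blast
    \<comment> \<open>The limits of the difference quotients, chosen separately at each point.\<close>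
    define W where "W v p x = (SOME y. ((\<lambda>s. (flow_map p (x + s *\<^sub>R v) - flow_map p x) /\<^sub>R s) \<longlongrightarrow> y) (at 0))" for v p x
    have W: "W v (t0, t0) x = v"
      "\<And>t. t \<in> {0..T} \<Longrightarrow> ((\<lambda>s. (F t t0 (x + s *\<^sub>R v) - F t t0 x) /\<^sub>R s) \<longlongrightarrow> W v (t, t0) x) (at 0)"
      "\<And>t. t \<in> {0..T} \<Longrightarrow> ((\<lambda>s. W v (s, t0) x) has_vector_derivative
          lin_comb (\<lambda>b. g' t (F t t0 x) b) (W v (t, t0) x)) (at t within {0..T})"
      if t0: "t0 \<in> {0..T}" for t0 x v
    proof -
      obtain w where w: "w t0 = v"
        "\<And>t. t \<in> {0..T} \<Longrightarrow>
          (w has_vector_derivative lin_comb (\<lambda>b. g' t (F t t0 x) b) (w t)) (at t within {0..T})"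
        "\<And>t. t \<in> {0..T} \<Longrightarrow> ((\<lambda>s. (F t t0 (x + s *\<^sub>R v) - F t t0 x) /\<^sub>R s) \<longlongrightarrow> w t) (at 0)"
        using flow_difference_quotient_limit[of g' t0 v x, OF g'(1) diff_family_base[OF g'(2)] t0] by blast
      have Ww: "W v (t, t0) x = w t" if "t \<in> {0..T}" for t
      proof -
        have "((\<lambda>s. (F t t0 (x + s *\<^sub>R v) - F t t0 x) /\<^sub>R s) \<longlongrightarrow> W v (t, t0) x) (at 0)"
          unfolding W_def fst_conv snd_conv by (rule someI[of _ "w t"]) (rule w(3)[OF that])
        with w(3)[OF that] show ?thesis by (intro tendsto_unique[of "at (0::real)"]) auto
      qed
      show "W v (t0, t0) x = v" using Ww[OF t0] w(1) by simp
      show "((\<lambda>s. (F t t0 (x + s *\<^sub>R v) - F t t0 x) /\<^sub>R s) \<longlongrightarrow> W v (t, t0) x) (at 0)"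
        if "t \<in> {0..T}" for t using w(3)[OF that] Ww[OF that] by simp
      show "((\<lambda>s. W v (s, t0) x) has_vector_derivative
          lin_comb (\<lambda>b. g' t (F t t0 x) b) (W v (t, t0) x)) (at t within {0..T})"
        if "t \<in> {0..T}" for t
        unfolding Ww[OF that]
        by (rule has_vector_derivative_transform[OF that _ w(2)[OF that]]) (simp add: Ww)
    qed
    have "Cn_family m {0..T} (\<lambda>t x. g' t x b)" for b
      using Suc.prems by (intro diff_family_le[OF g'(2)]) simp
    then have a: "Cn_family m ?P (\<lambda>p x. g' (fst p) (flow_map p x) b)" for b
      by (intro Cn_family_compose[OF Cn_family_reparam[OF fst] Fm'])
    have Wm: "diff_family (C1_in_time T) ?P m (W v)" for v
      by (rule linear_ode_family[where a = "\<lambda>b p x. g' (fst p) (flow_map p x) b" and \<beta> = "\<lambda>p x. 0" and c = v])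
         (use a W in \<open>auto simp: diff_family_const jointly_continuous_const\<close>)
    show ?case
    proof (rule diff_family_Suc_of_directional[OF _ C1 _ Wm])
      show "((\<lambda>s. (flow_map p (x + s *\<^sub>R v) - flow_map p x) /\<^sub>R s) \<longlongrightarrow> W v p x) (at 0)" if "p \<in> ?P" for p x v
        using W(2)[of "snd p" "fst p"] that by (auto simp: mem_Times_iff)
    qed (simp add: C1_in_time_def)
  }
qed

lemma flow_Cn_bound:
  assumes "compact U"
  shows "\<exists>B\<ge>0. \<forall>t\<in>{0..T}. \<forall>t0\<in>{0..T}. Cn_bound (Suc n) U (F t t0) B"
proof -
  have "Cn_family (Suc n) (time_square T) flow_map"
    by (rule diff_family_weaken[OF flow_family]) (simp_all add: C1_in_time_def)
  from Cn_family_bounded[OF compact_Times[OF compact_Icc compact_Icc] assms this] obtain B where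
    "0 \<le> B" "\<forall>p\<in>time_square T. Cn_bound (Suc n) U (flow_map p) B" by blast
  then show ?thesis by (intro exI[of _ B]) (simp del: Cn_bound.simps)
qed

lemma flow_increment_Cn_bound:
  assumes "compact U"
  shows "\<exists>B\<ge>0. \<forall>t\<in>{0..T}. \<forall>t0\<in>{0..T}. Cn_bound (Suc n) U (\<lambda>x. F t t0 x - x) (B * \<bar>t - t0\<bar>)"
proof -
  have "diff_family (C1_in_time T) (time_square T) (Suc n) (\<lambda>p x. flow_map p x - x)"
  proof (rule diff_family_diff)
    show "diff_family (C1_in_time T) (time_square T) (Suc n) (\<lambda>p x. x)"
      by (intro diff_family_ident C1_in_time_const continuous_on_const continuous_on_id)
    show "diff_family (C1_in_time T) (time_square T) (Suc n) flow_map"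
      by (rule flow_family) simp
  qed (rule C1_in_time_diff)
  from Cn_bound_of_C1_in_time[OF assms this] show ?thesis
    using flow_init by (simp del: Cn_bound.simps)
qed

end

section \<open>Error propagation\<close>

lemma SUP_norm_le_imp:
  assumes "(SUP (x, t)\<in>K \<times> I. multilinear_norm l (A x t)) \<le> ennreal B" "0 \<le> B"
    and "x \<in> K" "t \<in> I" "length vs = l" "\<forall>v\<in>set vs. norm v \<le> 1"
  shows "norm (A x t vs) \<le> B"
proof -
  have "ennreal (norm (A x t vs)) \<le> multilinear_norm l (A x t)"
    unfolding multilinear_norm_def by (rule SUP_upper) (use assms in auto)
  also have "\<dots> \<le> (SUP (x, t)\<in>K \<times> I. multilinear_norm l (A x t))"
    by (rule SUP_upper2[of "(x, t)"]) (use assms in auto)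
  also have "\<dots> \<le> ennreal B" by fact
  finally show ?thesis using assms(2) by simp
qed

lemma higher_deriv_differentiable_of_family:
  "diff_family Q P n f \<Longrightarrow> p \<in> P \<Longrightarrow> length vs < n \<Longrightarrow> higher_deriv UNIV (f p) vs differentiable (at x)"
proof (induction n arbitrary: f vs)
  case (Suc n)
  from Suc.prems(1) obtain f' where f': "\<And>p x. p \<in> P \<Longrightarrow> (f p has_derivative f' p x) (at x)"
    "\<And>v. diff_family Q P n (\<lambda>p x. f' p x v)"
    by (rule diff_family_SucE) blast
  show ?case
  proof (cases vs rule: rev_cases)
    case Nil
    then show ?thesis using f'(1)[OF Suc.prems(2), of x] by (auto simp: differentiable_def)
  next
    case (snoc ws v)
    have "(\<lambda>x. frechet_derivative (f p) (at x) v) = (\<lambda>x. f' p x v)"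
      using frechet_derivative_at[OF f'(1)[OF Suc.prems(2)]] by metis
    then show ?thesis
      using Suc.IH[OF f'(2) Suc.prems(2), of ws v] Suc.prems(3) by (simp add: snoc higher_deriv_snoc)
  qed
qed simp

context smooth_flow
begin

lemma consistency_Cn_bound:
  assumes one_step: "\<And>h t. h \<in> {0<..T} \<Longrightarrow> t \<in> {0..T - h} \<Longrightarrow> class_C_on n (Fh (t + h) t) UNIV"
    and cons: "consistent_on n T F Fh U"
  shows "\<exists>M>0. \<forall>h\<in>{0<..T}. \<forall>t\<in>{0..T - h}.
      Cn_bound n U (\<lambda>x. Fh (t + h) t x - F (t + h) t x) (M * h\<^sup>2)"
proof -
  from cons obtain M where M: "0 < M" "\<And>h l. h \<in> {0<..T} \<Longrightarrow> l \<in> {0..n} \<Longrightarrow>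
      (SUP (x, t)\<in>U \<times> {0..T - h}. multilinear_norm l (\<lambda>vs. higher_deriv UNIV (Fh (t + h) t) vs x
         - higher_deriv UNIV (F (t + h) t) vs x)) \<le> ennreal (M * h\<^sup>2)"
    unfolding consistent_on_def by blast
  have "Cn_bound n U (\<lambda>x. Fh (t + h) t x - F (t + h) t x) (M * h\<^sup>2)"
    if h: "h \<in> {0<..T}" and t: "t \<in> {0..T - h}" for h t
  proof (rule Cn_bound_of_higher_deriv)
    show "higher_deriv UNIV (Fh (t + h) t) vs differentiable at x" if "length vs < n" for vs x
      using one_step[OF h t] that unfolding class_C_on_def by (simp add: differentiable_on_def)
    show "higher_deriv UNIV (F (t + h) t) vs differentiable at x" if "length vs < n" for vs x
      using higher_deriv_differentiable_of_family[OF flow_family[OF order_refl], of "(t + h, t)" vs x] that h t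
      by simp
    show "norm (higher_deriv UNIV (Fh (t + h) t) vs x - higher_deriv UNIV (F (t + h) t) vs x) \<le> M * h\<^sup>2"
      if "length vs \<le> n" "\<forall>v\<in>set vs. norm v \<le> 1" "x \<in> U" for vs x
      using SUP_norm_le_imp[OF M(2)[OF h, of "length vs"], of x t vs] that t M(1) by simp
  qed
  with M(1) show ?thesis by blast
qed

lemma grid_times:
  assumes "h \<in> {0<..T}" "real (Suc k) * h \<le> T"
  shows "real k * h \<in> {0..T - h}" "real k * h \<in> {0..T}" "real k * h + h \<in> {0..T}"
    "real (Suc k) * h = real k * h + h"
  using assms by (auto simp: algebra_simps)

text \<open>The bound may grow with the number \<open>k\<close> of steps in an uncontrolled way, but it is uniform in the step size. It
covers the large step sizes, for which only boundedly many steps are taken.\<close>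

lemma numerical_flow_Cn_bound:
  assumes one_step: "\<And>h t. h \<in> {0<..T} \<Longrightarrow> t \<in> {0..T - h} \<Longrightarrow> class_C_on n (Fh (t + h) t) UNIV"
    and cons: "\<And>K. compact K \<Longrightarrow> consistent_on n T F Fh K"
    and K: "compact K"
  shows "\<exists>B\<ge>0. \<forall>h\<in>{0<..T}. real k * h \<le> T \<longrightarrow> Cn_bound n K (numerical_flow Fh h k) B"
proof (induction k)
  case 0
  have "Cn_family n {0::real} (\<lambda>_ x::'a. x)"
    by (rule diff_family_ident) (auto simp: jointly_continuous_def case_prod_unfold intro!: continuous_intros)
  from Cn_family_bounded[OF compact_insert[OF compact_empty] K this] obtain B where "0 \<le> B" "Cn_bound n K (\<lambda>x::'a. x) B" by auto
  then show ?case by (auto simp: id_def)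
next
  case (Suc k)
  then obtain B where B: "0 \<le> B"
    "\<And>h. h \<in> {0<..T} \<Longrightarrow> real k * h \<le> T \<Longrightarrow> Cn_bound n K (numerical_flow Fh h k) B" by blast
  let ?V = "cball (0::'a) B"
  obtain A where A: "0 \<le> A" "\<And>t t0. t \<in> {0..T} \<Longrightarrow> t0 \<in> {0..T} \<Longrightarrow> Cn_bound (Suc n) ?V (F t t0) A"
    using flow_Cn_bound[OF compact_cball[of 0 B]] by blast
  obtain M where M: "0 < M" "\<And>h t. h \<in> {0<..T} \<Longrightarrow> t \<in> {0..T - h} \<Longrightarrow>
      Cn_bound n ?V (\<lambda>x. Fh (t + h) t x - F (t + h) t x) (M * h\<^sup>2)"
    using consistency_Cn_bound[OF one_step cons[OF compact_cball[of 0 B]]] by blast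
  obtain c where c: "0 \<le> c" "\<And>(f::'a \<Rightarrow> 'a) (g::'a \<Rightarrow> 'a) A U V. 0 \<le> A \<Longrightarrow> Cn_bound n V f A \<Longrightarrow>
      Cn_bound n U g B \<Longrightarrow> g ` U \<subseteq> V \<Longrightarrow> Cn_bound n U (\<lambda>x. f (g x)) (c * A)"
    using Cn_bound_compose[OF B(1), of n] by blast
  let ?A = "M * T\<^sup>2 + A"
  have "Cn_bound n K (numerical_flow Fh h (Suc k)) (c * ?A)"
    if h: "h \<in> {0<..T}" and k: "real (Suc k) * h \<le> T" for h
  proof -
    note gt = grid_times[OF h k]
    have Bk: "Cn_bound n K (numerical_flow Fh h k) B" using gt(2) by (intro B(2) h) auto
    have "h\<^sup>2 \<le> T\<^sup>2" using h by (intro power_mono) auto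
    then have "M * h\<^sup>2 \<le> M * T\<^sup>2" using M(1) by (intro mult_left_mono) auto
    with Cn_bound_add[OF M(2)[OF h gt(1)] Cn_bound_SucD[OF A(2)[OF gt(3,2)]]]
    have "Cn_bound n ?V (Fh (real k * h + h) (real k * h)) ?A"
      by (auto elim: Cn_bound_mono)
    then have "Cn_bound n K (\<lambda>x. Fh (real k * h + h) (real k * h) (numerical_flow Fh h k x)) (c * ?A)"
      using Cn_bound_norm[OF Bk] M(1) A(1) by (intro c(2) Bk) auto
    then show ?thesis by (simp only: numerical_flow.simps gt(4) comp_def)
  qed
  moreover have "0 \<le> c * ?A" using c M A by simp
  ultimately show ?case by blast
qed

text \<open>The recursion \<open>E\<^sub>k\<^sub>+\<^sub>1 \<ge> (1 + a h) E\<^sub>k + b h\<^sup>2\<close> with \<open>E\<^sub>0 = 0\<close> is solved by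
\<open>E\<^sub>k = b h (k h) (1 + a h) ^ k\<close>, which is at most \<open>C h\<close> up to time \<open>T\<close>. The condition \<open>C h \<le> 1\<close> keeps the
numerical trajectories in the ball of radius \<open>R + 1\<close> and their derivatives within \<open>1\<close> of those of the exact flow, so that the
constants of the recursion do not depend on \<open>k\<close>.\<close>

lemma convergence_small_step:
  assumes one_step: "\<And>h t. h \<in> {0<..T} \<Longrightarrow> t \<in> {0..T - h} \<Longrightarrow> class_C_on n (Fh (t + h) t) UNIV"
    and cons: "\<And>K. compact K \<Longrightarrow> consistent_on n T F Fh K"
    and K: "compact K" and T: "0 \<le> T"
  shows "\<exists>C>0. \<forall>h\<in>{0<..T}. \<forall>k. C * h \<le> 1 \<longrightarrow> real k * h \<le> T \<longrightarrow>
      Cn_bound n K (\<lambda>x. numerical_flow Fh h k x - F (real k * h) 0 x) (C * h)"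
proof -
  have T0: "0 \<in> {0..T}" using T by simp
  obtain R where R: "0 \<le> R" "\<And>t. t \<in> {0..T} \<Longrightarrow> Cn_bound (Suc n) K (F t 0) R"
    using flow_Cn_bound[OF K] T0 by blast
  let ?V = "cball (0::'a) (R + 1)"
  obtain A where A: "0 \<le> A" "\<And>t t0. t \<in> {0..T} \<Longrightarrow> t0 \<in> {0..T} \<Longrightarrow>
      Cn_bound (Suc n) ?V (\<lambda>x. F t t0 x - x) (A * \<bar>t - t0\<bar>)"
    using flow_increment_Cn_bound[OF compact_cball[of 0 "R + 1"]] by blast
  obtain M where M: "0 < M" "\<And>h t. h \<in> {0<..T} \<Longrightarrow> t \<in> {0..T - h} \<Longrightarrow>
      Cn_bound n ?V (\<lambda>x. Fh (t + h) t x - F (t + h) t x) (M * h\<^sup>2)"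
    using consistency_Cn_bound[OF one_step cons[OF compact_cball[of 0 "R + 1"]]] by blast
  have R1: "0 \<le> R + 1" using R(1) by simp
  obtain c1 where c1: "0 \<le> c1" "\<And>(f::'a \<Rightarrow> 'a) (g::'a \<Rightarrow> 'a) A U V. 0 \<le> A \<Longrightarrow> Cn_bound n V f A \<Longrightarrow>
      Cn_bound n U g (R + 1) \<Longrightarrow> g ` U \<subseteq> V \<Longrightarrow> Cn_bound n U (\<lambda>x. f (g x)) (c1 * A)"
    using Cn_bound_compose[OF R1, of n] by blast
  obtain c2 where c2: "0 \<le> c2" "\<And>(f::'a \<Rightarrow> 'a) (g::'a \<Rightarrow> 'a) h A E U V.
      convex V \<Longrightarrow> 0 \<le> A \<Longrightarrow> 0 \<le> E \<Longrightarrow> Cn_bound (Suc n) V f A \<Longrightarrow>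
      Cn_bound n U g (R + 1) \<Longrightarrow> Cn_bound n U h (R + 1) \<Longrightarrow> Cn_bound n U (\<lambda>x. g x - h x) E \<Longrightarrow>
      g ` U \<subseteq> V \<Longrightarrow> h ` U \<subseteq> V \<Longrightarrow> Cn_bound n U (\<lambda>x. f (g x) - f (h x)) (c2 * (A * E))"
    using Cn_bound_compose_diff[OF R1, of n] by blast
  define a where "a = c2 * A"
  \<comment> \<open>The summand \<open>1\<close> only serves to make \<open>b\<close>, and with it \<open>C\<close>, strictly positive.\<close>
  define b where "b = c1 * M + 1"
  have ab: "0 \<le> a" "1 \<le> b" using c1 c2 A M by (auto simp: a_def b_def)
  define C where "C = b * (T + 1) * exp (a * T)"
  have C: "0 < C" using ab T by (simp add: C_def)
  have main: "Cn_bound n K (\<lambda>x. numerical_flow Fh h k x - F (real k * h) 0 x) (b * h * (real k * h) * (1 + a * h) ^ k)"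
    and bound: "b * h * (real k * h) * (1 + a * h) ^ k \<le> C * h"
    if h: "h \<in> {0<..T}" and small: "C * h \<le> 1" and k: "real k * h \<le> T" for h k
  proof -
    have h0: "0 < h" using h by simp
    define E where "E k = b * h * (real k * h) * (1 + a * h) ^ k" for k
    have E0: "0 \<le> E k" for k using ab h0 by (simp add: E_def)
    have EC: "E k \<le> C * h" if "real k * h \<le> T" for k
    proof -
      have "(1 + a * h) ^ k \<le> exp (a * h) ^ k"
        using ab h0 by (intro power_mono exp_ge_add_one_self) auto
      also have "\<dots> = exp (a * (real k * h))" by (simp add: exp_of_nat_mult[symmetric] algebra_simps)
      also have "\<dots> \<le> exp (a * T)" using that ab by (simp add: mult_left_mono)
      finally have e: "(1 + a * h) ^ k \<le> exp (a * T)" .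
      have "E k \<le> b * h * (T + 1) * exp (a * T)"
        unfolding E_def using that ab h0 T e by (intro mult_mono) auto
      then show ?thesis by (simp add: C_def algebra_simps)
    qed
    show "b * h * (real k * h) * (1 + a * h) ^ k \<le> C * h" using EC[OF k] by (simp add: E_def)
    have "Cn_bound n K (\<lambda>x. numerical_flow Fh h k x - F (real k * h) 0 x) (E k)"
      using k
    proof (induction k)
      case 0
      have "(\<lambda>x. numerical_flow Fh h 0 x - F (real 0 * h) 0 x) = (\<lambda>x. 0)"
        by (simp add: flow_init[OF T0])
      then show ?case using Cn_bound_zero[of "E 0" n K] E0[of 0] by simp
    next
      case (Suc k)
      note gt = grid_times[OF h Suc.prems]
      let ?t = "real k * h"
      let ?\<Phi> = "numerical_flow Fh h k" and ?F = "F ?t 0"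
      let ?\<rho> = "\<lambda>x. Fh (?t + h) ?t x - F (?t + h) ?t x" and ?\<psi> = "\<lambda>x. F (?t + h) ?t x - x"
      have e: "Cn_bound n K (\<lambda>x. ?\<Phi> x - ?F x) (E k)" using gt(2) by (intro Suc.IH) auto
      have "E k \<le> 1" using EC[of k] gt(2) small by simp
      then have e1: "Cn_bound n K (\<lambda>x. ?\<Phi> x - ?F x) 1" using Cn_bound_mono[OF e] by simp
      have F: "Cn_bound n K ?F R" by (rule Cn_bound_SucD[OF R(2)[OF gt(2)]])
      then have F': "Cn_bound n K ?F (R + 1)" by (rule Cn_bound_mono) simp
      have \<Phi>: "Cn_bound n K ?\<Phi> (R + 1)" using Cn_bound_add[OF F e1] by simp
      have V: "?\<Phi> ` K \<subseteq> ?V" "?F ` K \<subseteq> ?V"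
        using Cn_bound_norm[OF \<Phi>] Cn_bound_norm[OF F'] by auto
      have \<rho>: "Cn_bound n K (\<lambda>x. ?\<rho> (?\<Phi> x)) (c1 * (M * h\<^sup>2))"
        using M(1) by (intro c1(2)[OF _ M(2)[OF h gt(1)] \<Phi> V(1)]) simp
      have "Cn_bound (Suc n) ?V ?\<psi> (A * h)"
        using A(2)[OF gt(3,2)] h0 by simp
      then have \<psi>: "Cn_bound n K (\<lambda>x. ?\<psi> (?\<Phi> x) - ?\<psi> (?F x)) (c2 * (A * h * E k))"
        using A(1) h0 E0 by (intro c2(2)[OF convex_cball _ _ _ \<Phi> F' e V]) auto
      have sg: "F (?t + h) 0 x = F (?t + h) ?t (?F x)" for x
        using flow_semigroup[OF T0 gt(2,3)] by simp
      have "(\<lambda>x. numerical_flow Fh h (Suc k) x - F (real (Suc k) * h) 0 x)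
          = (\<lambda>x. (?\<Phi> x - ?F x) + (?\<rho> (?\<Phi> x) + (?\<psi> (?\<Phi> x) - ?\<psi> (?F x))))"
        unfolding gt(4) numerical_flow.simps comp_def sg by simp
      with Cn_bound_add[OF e Cn_bound_add[OF \<rho> \<psi>]]
      have "Cn_bound n K (\<lambda>x. numerical_flow Fh h (Suc k) x - F (real (Suc k) * h) 0 x)
          (E k + (c1 * (M * h\<^sup>2) + c2 * (A * h * E k)))" by simp
      then show ?case
      proof (rule Cn_bound_mono)
        have "E k + (c1 * (M * h\<^sup>2) + c2 * (A * h * E k)) = (1 + a * h) * E k + c1 * M * h\<^sup>2"
          by (simp add: a_def algebra_simps)
        also have "\<dots> \<le> (1 + a * h) * E k + b * h\<^sup>2 * 1"
          by (simp add: b_def mult_right_mono)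
        also have "\<dots> \<le> (1 + a * h) * E k + b * h\<^sup>2 * (1 + a * h) ^ Suc k"
          using ab h0 by (intro add_left_mono mult_left_mono one_le_power) auto
        also have "\<dots> = E (Suc k)"
          by (simp add: E_def power2_eq_square algebra_simps)
        finally show "E k + (c1 * (M * h\<^sup>2) + c2 * (A * h * E k)) \<le> E (Suc k)" .
      qed
    qed
    then show "Cn_bound n K (\<lambda>x. numerical_flow Fh h k x - F (real k * h) 0 x) (b * h * (real k * h) * (1 + a * h) ^ k)"
      by (simp add: E_def)
  qed
  show ?thesis using C Cn_bound_mono[OF main bound] by blast
qed

lemma convergence:
  assumes one_step: "\<And>h t. h \<in> {0<..T} \<Longrightarrow> t \<in> {0..T - h} \<Longrightarrow> class_C_on n (Fh (t + h) t) UNIV"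
    and cons: "\<And>K. compact K \<Longrightarrow> consistent_on n T F Fh K"
    and K: "compact K" and T: "0 \<le> T"
  shows "\<exists>C>0. \<forall>h\<in>{0<..T}. \<forall>k. real k * h \<le> T \<longrightarrow>
      Cn_bound n K (\<lambda>x. numerical_flow Fh h k x - F (real k * h) 0 x) (C * h)"
proof -
  have T0: "0 \<in> {0..T}" using T by simp
  obtain C where C: "0 < C" "\<And>h k. h \<in> {0<..T} \<Longrightarrow> C * h \<le> 1 \<Longrightarrow> real k * h \<le> T \<Longrightarrow>
      Cn_bound n K (\<lambda>x. numerical_flow Fh h k x - F (real k * h) 0 x) (C * h)"
    using convergence_small_step[OF one_step cons K T] by blast
  obtain B where B: "\<And>k. 0 \<le> B k" "\<And>k h. h \<in> {0<..T} \<Longrightarrow> real k * h \<le> T \<Longrightarrow>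
      Cn_bound n K (numerical_flow Fh h k) (B k)"
    using numerical_flow_Cn_bound[OF one_step cons K] by metis
  obtain R where R: "0 \<le> R" "\<And>t. t \<in> {0..T} \<Longrightarrow> Cn_bound (Suc n) K (F t 0) R"
    using flow_Cn_bound[OF K] T0 by blast
  \<comment> \<open>A bound for the number of steps when \<open>C * h > 1\<close>.\<close>
  define N where "N = nat \<lfloor>T * C\<rfloor>"
  define D where "D = (\<Sum>k\<le>N. B k) + R"
  have D: "0 \<le> D" using B R by (simp add: D_def sum_nonneg)
  \<comment> \<open>If \<open>C * h > 1\<close> then the crude error bound \<open>D\<close> is at most \<open>D * C * h\<close>.\<close>
  define C' where "C' = C + D * C"
  have "Cn_bound n K (\<lambda>x. numerical_flow Fh h k x - F (real k * h) 0 x) (C' * h)"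
    if h: "h \<in> {0<..T}" and k: "real k * h \<le> T" for h k
  proof (cases "C * h \<le> 1")
    case True
    have "C * h \<le> C' * h" using h D C(1) by (simp add: C'_def)
    then show ?thesis by (rule Cn_bound_mono[OF C(2)[OF h True k]])
  next
    case False
    have "real k * 1 \<le> real k * (C * h)" using False by (intro mult_left_mono) auto
    also have "\<dots> \<le> T * C" using mult_right_mono[OF k, of C] C(1) by (simp add: algebra_simps)
    finally have "k \<le> N" unfolding N_def by (simp add: le_nat_floor)
    then have "B k \<le> (\<Sum>k\<le>N. B k)" using B(1) by (intro member_le_sum) auto
    then have "B k + R \<le> D * 1" by (simp add: D_def)
    also have "\<dots> \<le> D * (C * h)" using False D by (intro mult_left_mono) auto
    also have "\<dots> \<le> C' * h" using C(1) h by (simp add: C'_def algebra_simps)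
    finally have le: "B k + R \<le> C' * h" .
    have "real k * h \<in> {0..T}" using h k by simp
    from Cn_bound_diff[OF B(2)[OF h k] Cn_bound_SucD[OF R(2)[OF this]]] le
    show ?thesis by (rule Cn_bound_mono)
  qed
  moreover have "0 < C'" using C(1) D by (simp add: C'_def add_pos_nonneg)
  ultimately show ?thesis by blast
qed

end

theorem theorem2p3:
  fixes r :: nat and T :: real
    and g :: "real ^ 'd \<Rightarrow> real \<Rightarrow> real ^ 'd"
    and F Fh :: "real \<Rightarrow> real \<Rightarrow> real ^ 'd \<Rightarrow> real ^ 'd"
  assumes "0 < T"
    and "class_C_on (r + 1) (\<lambda>(x, t). g x t) (UNIV \<times> {0..T})"
    and "is_flow g T F"
    and "\<And>h t. h \<in> {0<..T} \<Longrightarrow> t \<in> {0..T - h} \<Longrightarrow> class_C_on r (Fh (t + h) t) UNIV"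
    and "\<And>K. compact K \<Longrightarrow> consistent_on r T F Fh K"
    and "\<And>K. compact K \<Longrightarrow> stable_on T Fh K"
  shows "\<forall>K. compact K \<longrightarrow>
           (\<exists>C>0. \<forall>h\<in>{0<..T}.
              (MAX k\<in>{0..nat \<lfloor>T / h\<rfloor>}.
                 C_norm r K (\<lambda>x. numerical_flow Fh h k x - F (real k * h) 0 x))
              \<le> ennreal (C * h))"
proof (intro allI impI)
  fix K :: "(real ^ 'd) set" assume K: "compact K"
  have "Cn_family (Suc r) {0..T} (\<lambda>t x. g x t)"
    using Cn_family_of_class_C_on[OF assms(2)] by (simp del: diff_family.simps)
  then interpret smooth_flow r g T F
    using assms(3) by unfold_locales
  obtain C where C: "0 < C" "\<And>h k. h \<in> {0<..T} \<Longrightarrow> real k * h \<le> T \<Longrightarrow>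
      Cn_bound r K (\<lambda>x. numerical_flow Fh h k x - F (real k * h) 0 x) (C * h)"
    using convergence[OF assms(4,5) K less_imp_le[OF assms(1)]] by blast
  have "(MAX k\<in>{0..nat \<lfloor>T / h\<rfloor>}. C_norm r K (\<lambda>x. numerical_flow Fh h k x - F (real k * h) 0 x))
      \<le> ennreal (C * h)" if h: "h \<in> {0<..T}" for h
  proof (rule Max.boundedI)
    fix y assume "y \<in> (\<lambda>k. C_norm r K (\<lambda>x. numerical_flow Fh h k x - F (real k * h) 0 x)) ` {0..nat \<lfloor>T / h\<rfloor>}"
    then obtain k where k: "k \<le> nat \<lfloor>T / h\<rfloor>"
      and y: "y = C_norm r K (\<lambda>x. numerical_flow Fh h k x - F (real k * h) 0 x)" by auto
    have "real k \<le> T / h"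
      using k h assms(1) by (simp add: le_nat_iff le_floor_iff)
    then have "real k * h \<le> T" using h by (simp add: pos_le_divide_eq)
    then show "y \<le> ennreal (C * h)"
      unfolding y by (intro C_norm_le_of_Cn_bound C(2) h)
  qed auto
  with C(1) show "\<exists>C>0. \<forall>h\<in>{0<..T}.
      (MAX k\<in>{0..nat \<lfloor>T / h\<rfloor>}. C_norm r K (\<lambda>x. numerical_flow Fh h k x - F (real k * h) 0 x))
        \<le> ennreal (C * h)" by blast
qed

end
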